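(* For each positive integer $n$, let $G_n^1,G_n^2$ be two independent random graphs, each chosen uniformly at random from the set of all $2^{\binom{n}{2}}$ graphs on the vertex set $[n]=\{1,\ldots,n\}$. For $n$ large, let $\hat k=\hat k(n)\in[1,n]$ be the unique root of the equation $f^{\mathrm{ext}}(k)=0$ in the real variable $k\in[1,n]$, where $$f^{\mathrm{ext}}(k)=\ln\left[\binom{n}{k}2^k\left(1-\frac{1}{2^k}\right)^{n-k}\right].$$ Then the following hold as $n\to\infty$. 1. The minimum quantifier depth of a (deterministic, possibly depending on $n$) first order sentence $\varphi=\varphi(n)$ satisfying ${\sf P}(G_n^1\models\varphi,\ G_n^2\not\models\varphi)=\frac14-o(1)$ belongs to $\{\lfloor\hat k\rfloor+1,\lfloor\hat k\rfloor+2,\lfloor\hat k\rfloor+3,\lfloor\hat k\rfloor+4\}$. That is: (a) there is a sequence of first order sentences $\varphi_n$, where $\varphi_n$ has quantifier depth at most $\lfloor\hat k(n)\rfloor+4$, such that ${\sf P}(G_n^1\models\varphi_n,\ G_n^2\not\models\varphi_n)\to\frac14$ as $n\to\infty$; and (b) there is no infinite set $N\subseteq\mathbb{N}$ and sequence of first order sentences $(\varphi_n)_{n\in N}$, where $\varphi_n$ has quantifier depth at most $\lfloor\hat k(n)\rfloor$, such that ${\sf P}(G_n^1\models\varphi_n,\ G_n^2\not\models\varphi_n)\to\frac14$ as $n\to\infty$, $n\in N$. 2. With probability tending to $1$ as $n\to\infty$, the minimum (random) quantifier depth of a first order sentence $\varphi$ (which may depend on $G_n^1,G_n^2$) such that $G_n^1\models\varphi$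 and $G_n^2\not\models\varphi$ exists and belongs to $\{\lfloor\hat k\rfloor+1,\lfloor\hat k\rfloor+2,\lfloor\hat k\rfloor+3\}$.
   Context: Graphs are finite, simple and undirected. First order (FO) sentences are over the language of graphs, with the binary relations of adjacency and equality, variables ranging over vertices. The quantifier depth of a sentence is the maximum number of nested quantifiers in it. For real $k\in[1,n]$ the binomial coefficient is $\binom{n}{k}=\frac{\Gamma(n+1)}{\Gamma(k+1)\Gamma(n-k+1)}$. One has $f^{\mathrm{ext}}(k)=k\ln n-k\ln k+k+k\ln 2-n2^{-k}+O(\ln k)$ (expansion relevant for $k$ of order $\ln n$), and the root satisfies $\hat k=\log_2 n-2\log_2\ln n+\log_2\ln 2+o(1)$. *)

theory Defs
  imports "HOL-Probability.Probability"
begin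

section \<open>First order logic of graphs\<close>

datatype fo_formula =
    Eq nat nat
  | Adj nat nat
  | Neg fo_formula
  | Conj fo_formula fo_formula
  | Disj fo_formula fo_formula
  | Impl fo_formula fo_formula
  | Exi nat fo_formula
  | Uni nat fo_formula

primrec free_vars :: "fo_formula \<Rightarrow> nat set" where
  "free_vars (Eq x y) = {x, y}"
| "free_vars (Adj x y) = {x, y}"
| "free_vars (Neg \<phi>) = free_vars \<phi>"
| "free_vars (Conj \<phi> \<psi>) = free_vars \<phi> \<union> free_vars \<psi>"
| "free_vars (Disj \<phi> \<psi>) = free_vars \<phi> \<union> free_vars \<psi>"
| "free_vars (Impl \<phi> \<psi>) = free_vars \<phi> \<union> free_vars \<psi>"
| "free_vars (Exi x \<phi>) = free_vars \<phi> - {x}"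
| "free_vars (Uni x \<phi>) = free_vars \<phi> - {x}"

definition sentence :: "fo_formula \<Rightarrow> bool" where
  "sentence \<phi> \<longleftrightarrow> free_vars \<phi> = {}"

primrec qdepth :: "fo_formula \<Rightarrow> nat" where
  "qdepth (Eq x y) = 0"
| "qdepth (Adj x y) = 0"
| "qdepth (Neg \<phi>) = qdepth \<phi>"
| "qdepth (Conj \<phi> \<psi>) = max (qdepth \<phi>) (qdepth \<psi>)"
| "qdepth (Disj \<phi> \<psi>) = max (qdepth \<phi>) (qdepth \<psi>)"
| "qdepth (Impl \<phi> \<psi>) = max (qdepth \<phi>) (qdepth \<psi>)"
| "qdepth (Exi x \<phi>) = Suc (qdepth \<phi>)"
| "qdepth (Uni x \<phi>) = Suc (qdepth \<phi>)"

text \<open>A graph on the vertex set \<open>{1..n}\<close> is represented by its set of edges, a set of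
  two-element subsets of \<open>{1..n}\<close>.\<close>

definition graphs_on :: "nat \<Rightarrow> nat set set set" where
  "graphs_on n = Pow {e. e \<subseteq> {1..n} \<and> card e = 2}"

primrec sat :: "nat \<Rightarrow> nat set set \<Rightarrow> (nat \<Rightarrow> nat) \<Rightarrow> fo_formula \<Rightarrow> bool" where
  "sat n G s (Eq x y) \<longleftrightarrow> s x = s y"
| "sat n G s (Adj x y) \<longleftrightarrow> {s x, s y} \<in> G"
| "sat n G s (Neg \<phi>) \<longleftrightarrow> \<not> sat n G s \<phi>"
| "sat n G s (Conj \<phi> \<psi>) \<longleftrightarrow> sat n G s \<phi> \<and> sat n G s \<psi>"
| "sat n G s (Disj \<phi> \<psi>) \<longleftrightarrow> sat n G s \<phi> \<or> sat n G s \<psi>"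
| "sat n G s (Impl \<phi> \<psi>) \<longleftrightarrow> (sat n G s \<phi> \<longrightarrow> sat n G s \<psi>)"
| "sat n G s (Exi x \<phi>) \<longleftrightarrow> (\<exists>v\<in>{1..n}. sat n G (s(x := v)) \<phi>)"
| "sat n G s (Uni x \<phi>) \<longleftrightarrow> (\<forall>v\<in>{1..n}. sat n G (s(x := v)) \<phi>)"

text \<open>For a sentence, \<open>sat\<close> does not depend on the assignment (\<open>models_iff_sat\<close> below), so the
  quantifier over \<open>s\<close> is harmless.\<close>

definition models :: "nat \<Rightarrow> nat set set \<Rightarrow> fo_formula \<Rightarrow> bool" where
  "models n G \<phi> \<longleftrightarrow> (\<forall>s. sat n G s \<phi>)"

lemma sat_cong:
  "(\<And>x. x \<in> free_vars \<phi> \<Longrightarrow> s x = t x) \<Longrightarrow> sat n G s \<phi> \<longleftrightarrow> sat n G t \<phi>"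
proof (induction \<phi> arbitrary: s t)
  case (Exi x \<phi>)
  have "sat n G (s(x := v)) \<phi> \<longleftrightarrow> sat n G (t(x := v)) \<phi>" for v
    by (rule Exi.IH) (use Exi.prems in auto)
  then show ?case by simp
next
  case (Uni x \<phi>)
  have "sat n G (s(x := v)) \<phi> \<longleftrightarrow> sat n G (t(x := v)) \<phi>" for v
    by (rule Uni.IH) (use Uni.prems in auto)
  then show ?case by simp
next
  case (Neg \<phi>)
  then show ?case by (metis free_vars.simps(3) sat.simps(3))
next
  case (Conj \<phi> \<psi>)
  then show ?case by (metis UnCI free_vars.simps(4) sat.simps(4))
next
  case (Disj \<phi> \<psi>)
  then show ?case by (metis UnCI free_vars.simps(5) sat.simps(5))
next
  case (Impl \<phi> \<psi>)
  then show ?case by (metis UnCI free_vars.simps(6) sat.simps(6))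
qed simp_all

lemma models_iff_sat: "sentence \<phi> \<Longrightarrow> models n G \<phi> \<longleftrightarrow> sat n G s \<phi>"
  unfolding models_def sentence_def by (metis empty_iff sat_cong)

definition distinguishes :: "nat \<Rightarrow> nat set set \<Rightarrow> nat set set \<Rightarrow> fo_formula \<Rightarrow> bool" where
  "distinguishes n G H \<phi> \<longleftrightarrow> models n G \<phi> \<and> \<not> models n H \<phi>"

definition distinguishing_depths :: "nat \<Rightarrow> nat set set \<Rightarrow> nat set set \<Rightarrow> nat set" where
  "distinguishing_depths n G H = qdepth ` {\<phi>. sentence \<phi> \<and> distinguishes n G H \<phi>}"


section \<open>Two independent uniform random graphs\<close>

definition random_graph_pair :: "nat \<Rightarrow> (nat set set \<times> nat set set) pmf" where
  "random_graph_pair n = pair_pmf (pmf_of_set (graphs_on n)) (pmf_of_set (graphs_on n))"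

definition prob_distinguishes :: "nat \<Rightarrow> fo_formula \<Rightarrow> real" where
  "prob_distinguishes n \<phi> =
     measure_pmf.prob (random_graph_pair n) {(G, H). distinguishes n G H \<phi>}"

lemma finite_graphs_on: "finite (graphs_on n)"
  unfolding graphs_on_def by (simp add: finite_subset[of _ "Pow {1..n}"] subset_iff)

lemma card_graphs_on: "card (graphs_on n) = 2 ^ (n choose 2)"
  unfolding graphs_on_def using n_subsets[of "{1..n}" 2] 
  by (simp add: card_Pow finite_subset[of _ "Pow {1..n}"] subset_iff)


section \<open>The threshold\<close>

definition binom_ext :: "nat \<Rightarrow> real \<Rightarrow> real" where
  "binom_ext n k = Gamma (real n + 1) / (Gamma (k + 1) * Gamma (real n - k + 1))"

definition f_ext :: "nat \<Rightarrow> real \<Rightarrow> real" where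
  "f_ext n k = ln (binom_ext n k * 2 powr k * (1 - 1 / 2 powr k) powr (real n - k))"

text \<open>Only meaningful for large \<open>n\<close>, where the root is unique; unspecified otherwise.\<close>

definition k_hat :: "nat \<Rightarrow> real" where
  "k_hat n = (THE k. k \<in> {1..real n} \<and> f_ext n k = 0)"

end

theory Submission
  imports Defs "HOL-Real_Asymp.Real_Asymp"
begin

text \<open>
  Write \<open>k\<close> for the integer part of the root of \<open>f_ext n\<close> and \<open>L = (ln n)\<^sup>2 / ln 2\<close>. A graph
  realises a pattern \<open>A \<subseteq> U\<close> over a vertex set \<open>U\<close> if some vertex outside \<open>U\<close> is adjacent to all
  of \<open>A\<close> and to nothing in \<open>U - A\<close>; \<open>exp (f_ext n r)\<close> is the expected number of unrealised patterns
  over \<open>r\<close>-sets. To leading order it is \<open>exp (r ln n - n / 2 ^ r)\<close>, so at the root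
  \<open>n / 2 powr k_hat n\<close> is \<open>L\<close> up to a factor \<open>1 + o(1)\<close> (\<open>k_hat_window\<close>). Only one per cent of precision
  is used below.

  Depth \<open>k\<close> does not suffice. Over \<open>(k - 1)\<close>-sets the expected number of unrealised patterns is
  about \<open>exp (L - 2 L)\<close> or smaller, so typically all of them are realised, and two graphs with this
  property satisfy the same sentences of depth \<open>k\<close> (\<open>models_eq_of_ext_prop\<close>).

  Depth \<open>k + 3\<close> suffices. Let \<open>m = k + 2\<close>, so that \<open>n / 2 ^ m\<close> lies between about \<open>L / 4\<close> and
  \<open>L / 2\<close>. Attach to every \<open>m\<close>-set \<open>U\<close> a family \<open>S U\<close> of \<open>J\<close> patterns, and look for a \<open>U\<close> over which
  none of them is realised. The number of such \<open>U\<close> has expectation about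
  \<open>exp (L - J n / 2 ^ m)\<close>, whereas a fixed labelled graph on \<open>m\<close> vertices occurs in this way with
  expectation about \<open>exp (L - L / 2 - J n / 2 ^ m)\<close>. If \<open>J n / 2 ^ m\<close> is between \<open>L / 2\<close> and \<open>L\<close>, then such a
  \<open>U\<close> exists in the first graph, while the second graph contains no copy of it; the
  sentence saying that a copy exists has depth \<open>m + 1\<close> (\<open>definable_ex_realizes\<close>). The choice \<open>J = 2\<close>
  works unless \<open>n / 2 ^ m\<close> is close to \<open>L / 4\<close>, and then \<open>J = 3\<close> works.

  The delicate point is \<open>J = 2\<close> with \<open>n / 2 ^ m\<close> close to \<open>L / 2\<close>, where the leading terms cancel. Two
  patterns over \<open>m\<close> vertices are missed with the same probability per vertex as one pattern over
  \<open>m - 1\<close> vertices, so the expectation can be compared directly with \<open>exp (f_ext n (k + 1))\<close>, which exceeds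
  \<open>1\<close> because \<open>k + 1\<close> lies to the right of the root. The comparison leaves a factor of order
  \<open>ln n\<close> (\<open>expected_two_patterns\<close>). Existence follows from the second moment method
  (\<open>ex_omitting_set_window\<close>). The families \<open>{{}, U}\<close> and \<open>{{}, U, {Min U}}\<close> are chosen such that the events
  for two overlapping sets have few compatible pairs of patterns, which keeps the correlation small.

  Hence two random graphs typically differ on a sentence of depth \<open>k + 3\<close>. This also gives
  sentences with distinguishing probability close to \<open>1/4\<close>: the classes of graphs that agree on all
  sentences of depth \<open>k + 3\<close> must all have small probability, so some union of classes has probability
  close to \<open>1/2\<close>, and a union of classes is defined by a sentence of that depth (\<open>ex_balanced_sentence\<close>).
\<close>

section \<open>Extension properties and the Ehrenfeucht--Fraisse argument\<close>

text \<open>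
  These extension axioms let Duplicator answer the first \<open>r + 1\<close> moves of an
  Ehrenfeucht--Fraisse game.
\<close>

definition ext_prop :: "nat \<Rightarrow> nat \<Rightarrow> nat set set \<Rightarrow> bool" where
  "ext_prop n r G \<longleftrightarrow> (\<forall>U A. U \<subseteq> {1..n} \<and> card U \<le> r \<and> A \<subseteq> U \<longrightarrow>
     (\<exists>y\<in>{1..n} - U. {u \<in> U. {y, u} \<in> G} = A))"

definition partial_iso ::
  "nat \<Rightarrow> nat set set \<Rightarrow> nat set set \<Rightarrow> nat set \<Rightarrow> (nat \<Rightarrow> nat) \<Rightarrow> (nat \<Rightarrow> nat) \<Rightarrow> bool" where
  "partial_iso n G H F s t \<longleftrightarrow> s ` F \<subseteq> {1..n} \<and> t ` F \<subseteq> {1..n} \<and>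
     (\<forall>x\<in>F. \<forall>y\<in>F. (s x = s y \<longleftrightarrow> t x = t y) \<and> ({s x, s y} \<in> G \<longleftrightarrow> {t x, t y} \<in> H))"

lemma partial_iso_sym: "partial_iso n G H F s t \<Longrightarrow> partial_iso n H G F t s"
  by (auto simp: partial_iso_def)

lemma partial_iso_mono: "partial_iso n G H F s t \<Longrightarrow> F' \<subseteq> F \<Longrightarrow> partial_iso n G H F' s t"
  unfolding partial_iso_def by blast

lemma partial_iso_card:
  assumes "partial_iso n G H F s t"
  shows "card (s ` F) = card (t ` F)"
proof (rule bij_betw_same_card)
  have *: "t (inv_into F s (s x)) = t x" if "x \<in> F" for x
    using assms that unfolding partial_iso_def
    by (metis f_inv_into_f imageI inv_into_into)
  show "bij_betw (\<lambda>v. t (inv_into F s v)) (s ` F) (t ` F)"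
    unfolding bij_betw_def
  proof
    show "inj_on (\<lambda>v. t (inv_into F s v)) (s ` F)"
      using assms * by (auto simp: inj_on_def partial_iso_def)
    show "(\<lambda>v. t (inv_into F s v)) ` s ` F = t ` F"
      using * by (auto simp: image_image)
  qed
qed

lemma loop_not_in: "G \<in> graphs_on n \<Longrightarrow> {v} \<notin> G"
  by (auto simp: graphs_on_def)

text \<open>
  One move of the game. A new vertex \<open>v\<close> is answered by a vertex that realises the image of its
  adjacency pattern; a repeated vertex is answered by its partner.
\<close>

lemma partial_iso_extend:
  assumes iso: "partial_iso n G H F s t" and x: "x \<notin> F"
    and G: "G \<in> graphs_on n" and H: "H \<in> graphs_on n"
    and ext: "ext_prop n r H" and card: "card (t ` F) \<le> r" and v: "v \<in> {1..n}"
  obtains w where "w \<in> {1..n}" "partial_iso n G H (insert x F) (s(x := v)) (t(x := w))"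
proof (cases "v \<in> s ` F")
  case True
  then obtain z where z: "z \<in> F" "v = s z" by blast
  show thesis
  proof (rule that[of "t z"])
    show "t z \<in> {1..n}" using iso z by (auto simp: partial_iso_def)
    show "partial_iso n G H (insert x F) (s(x := v)) (t(x := t z))"
      using iso x z loop_not_in[OF G] loop_not_in[OF H] unfolding partial_iso_def
      by (auto simp: image_subset_iff)
  qed
next
  case False
  define A where "A = t ` {z \<in> F. {v, s z} \<in> G}"
  have "A \<subseteq> t ` F" by (auto simp: A_def)
  moreover have "t ` F \<subseteq> {1..n}" using iso by (auto simp: partial_iso_def)
  ultimately obtain y where y: "y \<in> {1..n}" "y \<notin> t ` F" "{u \<in> t ` F. {y, u} \<in> H} = A"
    using ext card unfolding ext_prop_def by (metis DiffE)
  have adj: "{y, t z} \<in> H \<longleftrightarrow> {v, s z} \<in> G" if "z \<in> F" for z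
  proof
    assume "{y, t z} \<in> H"
    then have "t z \<in> A" using y(3) that by blast
    then obtain z' where z': "z' \<in> F" "{v, s z'} \<in> G" "t z = t z'" by (auto simp: A_def)
    then show "{v, s z} \<in> G" using iso that unfolding partial_iso_def by metis
  next
    assume "{v, s z} \<in> G"
    then have "t z \<in> A" using that by (auto simp: A_def)
    then show "{y, t z} \<in> H" using y(3) by blast
  qed
  have adj': "{t z, y} \<in> H \<longleftrightarrow> {s z, v} \<in> G" if "z \<in> F" for z
    using adj[OF that] by (simp add: insert_commute)
  show thesis
  proof (rule that[of y])
    show "y \<in> {1..n}" by fact
    have "(((s(x := v)) a = (s(x := v)) b) = ((t(x := y)) a = (t(x := y)) b)) \<and>
          ({(s(x := v)) a, (s(x := v)) b} \<in> G) = ({(t(x := y)) a, (t(x := y)) b} \<in> H)"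
      if ab: "a \<in> insert x F" "b \<in> insert x F" for a b
    proof (cases "a = x"; cases "b = x")
      assume "a = x" "b = x"
      then show ?thesis using loop_not_in[OF G] loop_not_in[OF H] by simp
    next
      assume "a = x" "b \<noteq> x"
      then show ?thesis using ab False y(2) adj by auto
    next
      assume "a \<noteq> x" "b = x"
      then show ?thesis using ab False y(2) adj' by auto
    next
      assume "a \<noteq> x" "b \<noteq> x"
      then show ?thesis using ab iso by (auto simp: partial_iso_def)
    qed
    moreover have "(s(x := v)) ` insert x F \<subseteq> {1..n}" "(t(x := y)) ` insert x F \<subseteq> {1..n}"
      using iso v y(1) x by (auto simp: partial_iso_def image_subset_iff)
    ultimately show "partial_iso n G H (insert x F) (s(x := v)) (t(x := y))"
      unfolding partial_iso_def by blast
  qed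
qed

lemma finite_free_vars: "finite (free_vars \<phi>)"
  by (induction \<phi>) auto

text \<open>
  The bookkeeping: a quantifier costs one unit of depth and adds at most one vertex to the position.
\<close>

lemma partial_iso_quantifier_step:
  assumes iso: "partial_iso n G H (free_vars \<phi> - {x}) s t"
    and card: "card (s ` (free_vars \<phi> - {x})) + Suc (qdepth \<phi>) \<le> Suc r"
    and G: "G \<in> graphs_on n" and H: "H \<in> graphs_on n" and ext: "ext_prop n r H"
    and v: "v \<in> {1..n}"
  obtains w where "w \<in> {1..n}" "partial_iso n G H (free_vars \<phi>) (s(x := v)) (t(x := w))"
    "card ((s(x := v)) ` free_vars \<phi>) + qdepth \<phi> \<le> Suc r"
proof -
  have "card (t ` (free_vars \<phi> - {x})) \<le> r"
    using card partial_iso_card[OF iso] by simp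
  then obtain w where w: "w \<in> {1..n}"
    "partial_iso n G H (insert x (free_vars \<phi> - {x})) (s(x := v)) (t(x := w))"
    using partial_iso_extend[OF iso _ G H ext _ v] by blast
  have "(s(x := v)) ` free_vars \<phi> \<subseteq> insert v (s ` (free_vars \<phi> - {x}))" by auto
  then have "card ((s(x := v)) ` free_vars \<phi>) \<le> Suc (card (s ` (free_vars \<phi> - {x})))"
    using card_mono[of "insert v (s ` (free_vars \<phi> - {x}))" "(s(x := v)) ` free_vars \<phi>"]
      card_insert_if[of "s ` (free_vars \<phi> - {x})" v] finite_free_vars[of \<phi>] by (auto split: if_splits)
  then show thesis
    using that[OF w(1)] partial_iso_mono[OF w(2), of "free_vars \<phi>"] card by fastforce
qed

text \<open>
  The sum of position size and remaining depth never increases along the induction, so at each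
  quantifier at most \<open>r\<close> vertices are in play and the extension property applies.
\<close>

lemma sat_eq_of_ext_prop:
  assumes G: "G \<in> graphs_on n" and H: "H \<in> graphs_on n"
    and extG: "ext_prop n r G" and extH: "ext_prop n r H"
  shows "partial_iso n G H (free_vars \<phi>) s t \<Longrightarrow> card (s ` free_vars \<phi>) + qdepth \<phi> \<le> Suc r \<Longrightarrow>
    sat n G s \<phi> \<longleftrightarrow> sat n H t \<phi>"
proof (induction \<phi> arbitrary: s t)
  case (Exi x \<phi>)
  have forth: "\<exists>w\<in>{1..n}. sat n H (t(x := w)) \<phi>" if v: "v \<in> {1..n}" "sat n G (s(x := v)) \<phi>" for v
  proof -
    obtain w where "w \<in> {1..n}" "partial_iso n G H (free_vars \<phi>) (s(x := v)) (t(x := w))"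
      "card ((s(x := v)) ` free_vars \<phi>) + qdepth \<phi> \<le> Suc r"
      using partial_iso_quantifier_step[of n G H \<phi> x s t r v] Exi.prems G H extH v(1) by auto
    then show ?thesis using Exi.IH v(2) by blast
  qed
  have bwd: "\<exists>v\<in>{1..n}. sat n G (s(x := v)) \<phi>" if w: "w \<in> {1..n}" "sat n H (t(x := w)) \<phi>" for w
  proof -
    have iso: "partial_iso n H G (free_vars \<phi> - {x}) t s" 
      using Exi.prems(1) by (simp add: partial_iso_sym)
    obtain v where v: "v \<in> {1..n}" "partial_iso n H G (free_vars \<phi>) (t(x := w)) (s(x := v))"
      "card ((t(x := w)) ` free_vars \<phi>) + qdepth \<phi> \<le> Suc r"
      using partial_iso_quantifier_step[OF iso _ H G extG w(1)] Exi.prems(2) partial_iso_card[OF iso]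
      by auto
    have "card ((s(x := v)) ` free_vars \<phi>) + qdepth \<phi> \<le> Suc r"
      using v(3) partial_iso_card[OF v(2)] by (simp only:)
    then show ?thesis using Exi.IH[OF partial_iso_sym[OF v(2)]] v(1) w(2) by blast
  qed
  show ?case using forth bwd by (simp only: sat.simps) blast
next
  case (Uni x \<phi>)
  have forth: "\<exists>w\<in>{1..n}. \<not> sat n H (t(x := w)) \<phi>"
    if v: "v \<in> {1..n}" "\<not> sat n G (s(x := v)) \<phi>" for v
  proof -
    obtain w where "w \<in> {1..n}" "partial_iso n G H (free_vars \<phi>) (s(x := v)) (t(x := w))"
      "card ((s(x := v)) ` free_vars \<phi>) + qdepth \<phi> \<le> Suc r"
      using partial_iso_quantifier_step[of n G H \<phi> x s t r v] Uni.prems G H extH v(1) by auto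
    then show ?thesis using Uni.IH v(2) by blast
  qed
  have bwd: "\<exists>v\<in>{1..n}. \<not> sat n G (s(x := v)) \<phi>"
    if w: "w \<in> {1..n}" "\<not> sat n H (t(x := w)) \<phi>" for w
  proof -
    have iso: "partial_iso n H G (free_vars \<phi> - {x}) t s" 
      using Uni.prems(1) by (simp add: partial_iso_sym)
    obtain v where v: "v \<in> {1..n}" "partial_iso n H G (free_vars \<phi>) (t(x := w)) (s(x := v))"
      "card ((t(x := w)) ` free_vars \<phi>) + qdepth \<phi> \<le> Suc r"
      using partial_iso_quantifier_step[OF iso _ H G extG w(1)] Uni.prems(2) partial_iso_card[OF iso]
      by auto
    have "card ((s(x := v)) ` free_vars \<phi>) + qdepth \<phi> \<le> Suc r"
      using v(3) partial_iso_card[OF v(2)] by (simp only:)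
    then show ?thesis using Uni.IH[OF partial_iso_sym[OF v(2)]] v(1) w(2) by blast
  qed
  show ?case using forth bwd by (simp only: sat.simps) blast
next
  case (Conj \<phi> \<psi>)
  have "sat n G s \<phi> = sat n H t \<phi>" "sat n G s \<psi> = sat n H t \<psi>"
    using Conj by (auto intro!: Conj.IH elim!: partial_iso_mono order_trans[rotated]
       intro!: add_mono card_mono simp: finite_free_vars)
  then show ?case by simp
next
  case (Disj \<phi> \<psi>)
  have "sat n G s \<phi> = sat n H t \<phi>" "sat n G s \<psi> = sat n H t \<psi>"
    using Disj by (auto intro!: Disj.IH elim!: partial_iso_mono order_trans[rotated]
       intro!: add_mono card_mono simp: finite_free_vars)
  then show ?case by simp
next
  case (Impl \<phi> \<psi>)
  have "sat n G s \<phi> = sat n H t \<phi>" "sat n G s \<psi> = sat n H t \<psi>"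
    using Impl by (auto intro!: Impl.IH elim!: partial_iso_mono order_trans[rotated]
       intro!: add_mono card_mono simp: finite_free_vars)
  then show ?case by simp
qed (auto simp: partial_iso_def)

lemma models_eq_of_ext_prop:
  assumes "G \<in> graphs_on n" "H \<in> graphs_on n" "ext_prop n r G" "ext_prop n r H"
    and \<phi>: "sentence \<phi>" "qdepth \<phi> \<le> Suc r"
  shows "models n G \<phi> \<longleftrightarrow> models n H \<phi>"
proof -
  have "sat n G (\<lambda>_. 0) \<phi> \<longleftrightarrow> sat n H (\<lambda>_. 0) \<phi>"
    using \<phi> by (intro sat_eq_of_ext_prop[OF assms(1-4)]) (auto simp: sentence_def partial_iso_def)
  then show ?thesis using models_iff_sat[OF \<phi>(1)] by blast
qed

section \<open>Semantic definability with bounded quantifier depth\<close>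

text \<open>
  Definability is treated semantically, so that sentences are obtained from closure properties
  instead of being written down. The free variables are the first \<open>m\<close> ones; a quantifier always binds
  variable \<open>m\<close>.
\<close>

definition definable ::
  "nat \<Rightarrow> nat \<Rightarrow> nat \<Rightarrow> (nat set set \<Rightarrow> (nat \<Rightarrow> nat) \<Rightarrow> bool) \<Rightarrow> bool" where
  "definable n m d P \<longleftrightarrow>
     (\<exists>\<phi>. free_vars \<phi> \<subseteq> {..<m} \<and> qdepth \<phi> \<le> d \<and> (\<forall>G s. sat n G s \<phi> \<longleftrightarrow> P G s))"

lemma definable_eq: "i < m \<Longrightarrow> j < m \<Longrightarrow> definable n m d (\<lambda>G s. s i = s j)"
  unfolding definable_def by (rule exI[of _ "Eq i j"]) auto

lemma definable_adj: "i < m \<Longrightarrow> j < m \<Longrightarrow> definable n m d (\<lambda>G s. {s i, s j} \<in> G)"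
  unfolding definable_def by (rule exI[of _ "Adj i j"]) auto

lemma definable_not: "definable n m d P \<Longrightarrow> definable n m d (\<lambda>G s. \<not> P G s)"
  unfolding definable_def by (metis free_vars.simps(3) qdepth.simps(3) sat.simps(3))

lemma definable_conj:
  assumes "definable n m d P" "definable n m d Q"
  shows "definable n m d (\<lambda>G s. P G s \<and> Q G s)"
proof -
  obtain \<phi> \<psi> where "free_vars \<phi> \<subseteq> {..<m}" "qdepth \<phi> \<le> d" "\<And>G s. sat n G s \<phi> \<longleftrightarrow> P G s"
    "free_vars \<psi> \<subseteq> {..<m}" "qdepth \<psi> \<le> d" "\<And>G s. sat n G s \<psi> \<longleftrightarrow> Q G s"
    using assms unfolding definable_def by blast
  then show ?thesis unfolding definable_def by (intro exI[of _ "Conj \<phi> \<psi>"]) auto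
qed

lemma definable_imp:
  "definable n m d P \<Longrightarrow> definable n m d Q \<Longrightarrow> definable n m d (\<lambda>G s. P G s \<longrightarrow> Q G s)"
  using definable_not[OF definable_conj[OF _ definable_not], of n m d P Q] by simp

lemma definable_iff_const:
  "definable n m d P \<Longrightarrow> definable n m d (\<lambda>G s. P G s \<longleftrightarrow> b)"
  by (cases b) (simp_all add: definable_not)

lemma definable_all:
  assumes "definable n (Suc m) d P"
  shows "definable n m (Suc d) (\<lambda>G s. \<forall>v\<in>{1..n}. P G (s(m := v)))"
proof -
  obtain \<phi> where "free_vars \<phi> \<subseteq> {..<Suc m}" "qdepth \<phi> \<le> d" "\<And>G s. sat n G s \<phi> \<longleftrightarrow> P G s"
    using assms unfolding definable_def by blast
  then show ?thesis unfolding definable_def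
    by (intro exI[of _ "Uni m \<phi>"]) (auto simp: less_Suc_eq)
qed

lemma definable_ex:
  assumes "definable n (Suc m) d P"
  shows "definable n m (Suc d) (\<lambda>G s. \<exists>v\<in>{1..n}. P G (s(m := v)))"
  using definable_not[OF definable_all[OF definable_not[OF assms]]] by simp

text \<open>
  There is no closed formula of depth \<open>0\<close>, hence the assumption; it is inherited by
  \<open>definable_ball\<close>, whose empty case is the true formula.
\<close>

lemma definable_True:
  assumes "0 < m \<or> 0 < d" 
  shows "definable n m d (\<lambda>G s. True)"
proof (cases "0 < m")
  case True
  then show ?thesis using definable_eq[of 0 m 0 n d] by simp
next
  case False
  then obtain d' where d: "m = 0" "d = Suc d'" using assms by (cases d) auto
  then show ?thesis using definable_all[OF definable_eq[of 0 "Suc 0" 0 n d']] by simp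
qed

lemma definable_ball:
  assumes "finite I" "0 < m \<or> 0 < d" "\<And>i. i \<in> I \<Longrightarrow> definable n m d (P i)"
  shows "definable n m d (\<lambda>G s. \<forall>i\<in>I. P i G s)"
  using assms
proof (induction I rule: finite_induct)
  case empty
  then show ?case using definable_True by simp
next
  case (insert i I)
  then show ?case using definable_conj[of n m d "P i" "\<lambda>G s. \<forall>i\<in>I. P i G s"] by simp
qed

lemma definable_ex_tuple:
  "definable n m d P \<Longrightarrow>
   definable n 0 (d + m) (\<lambda>G s. \<exists>f\<in>{..<m} \<rightarrow> {1..n}. P G (\<lambda>i. if i < m then f i else s i))"
proof (induction m arbitrary: d P)
  case 0
  then show ?case by simp
next
  case (Suc m)
  have eq: "(\<exists>f\<in>{..<Suc m} \<rightarrow> {1..n}. P G (\<lambda>i. if i < Suc m then f i else s i)) \<longleftrightarrow>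
    (\<exists>f\<in>{..<m} \<rightarrow> {1..n}. \<exists>v\<in>{1..n}. P G ((\<lambda>i. if i < m then f i else s i)(m := v)))" for G s
  proof safe
    fix f assume f: "f \<in> {..<Suc m} \<rightarrow> {1..n}" "P G (\<lambda>i. if i < Suc m then f i else s i)"
    have "(\<lambda>i. if i < m then f i else s i)(m := f m) = (\<lambda>i. if i < Suc m then f i else s i)"
      by (auto simp: less_Suc_eq)
    with f show "\<exists>f\<in>{..<m} \<rightarrow> {1..n}. \<exists>v\<in>{1..n}. P G ((\<lambda>i. if i < m then f i else s i)(m := v))"
      by (intro bexI[of _ f] bexI[of _ "f m"]) auto
  next
    fix f v assume f: "f \<in> {..<m} \<rightarrow> {1..n}" "v \<in> {1..n}"
      "P G ((\<lambda>i. if i < m then f i else s i)(m := v))"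
    have "(\<lambda>i. if i < m then f i else s i)(m := v) = (\<lambda>i. if i < Suc m then (f(m := v)) i else s i)"
      by (auto simp: less_Suc_eq)
    with f show "\<exists>f\<in>{..<Suc m} \<rightarrow> {1..n}. P G (\<lambda>i. if i < Suc m then f i else s i)"
      by (intro bexI[of _ "f(m := v)"]) (auto simp: less_Suc_eq Pi_iff)
  qed
  show ?case unfolding eq using Suc.IH[OF definable_ex[OF Suc.prems]] by (simp only: add_Suc add_Suc_right)
qed

text \<open>
  Patterns
  are sets of indices, so that they can be compared between different graphs.
\<close>

definition realizes ::
  "nat \<Rightarrow> nat \<Rightarrow> (nat \<Rightarrow> nat \<Rightarrow> bool) \<Rightarrow> nat set set \<Rightarrow> nat set set \<Rightarrow> (nat \<Rightarrow> nat) \<Rightarrow> bool" where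
  "realizes n m T S G f \<longleftrightarrow> inj_on f {..<m} \<and> (\<forall>i<m. \<forall>j<m. {f i, f j} \<in> G \<longleftrightarrow> T i j) \<and>
     (\<forall>y\<in>{1..n} - f ` {..<m}. {i \<in> {..<m}. {y, f i} \<in> G} \<notin> S)"

text \<open>
  The \<open>m\<close> vertices cost \<open>m\<close> quantifiers, and the outside vertex one more.
\<close>

lemma definable_ex_realizes:
  assumes m: "0 < m" and S: "S \<subseteq> Pow {..<m}"
  shows "definable n 0 (Suc m) (\<lambda>G s. \<exists>f\<in>{..<m} \<rightarrow> {1..n}. realizes n m T S G f)"
proof -
  have fin: "finite S" using S finite_subset by blast
  have 1: "definable n m (Suc 0) (\<lambda>G s. \<forall>i\<in>{..<m}. \<forall>j\<in>{..<m}. (s i = s j \<longleftrightarrow> i = j) \<and> ({s i, s j} \<in> G \<longleftrightarrow> T i j))"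
    using m by (intro definable_ball definable_conj definable_iff_const definable_eq definable_adj) auto
  have 2: "definable n m (Suc 0) (\<lambda>G s. \<forall>v\<in>{1..n}. (\<lambda>G s. (\<forall>i\<in>{..<m}. \<not> s m = s i) \<longrightarrow>
      (\<forall>p\<in>S. \<not> (\<forall>i\<in>{..<m}. {s m, s i} \<in> G \<longleftrightarrow> i \<in> p))) G (s(m := v)))"
    using fin by (intro definable_all definable_imp definable_ball definable_not definable_iff_const
        definable_eq definable_adj) auto
  let ?P = "\<lambda>G s. (\<forall>i\<in>{..<m}. \<forall>j\<in>{..<m}. (s i = s j \<longleftrightarrow> i = j) \<and> ({s i, s j} \<in> G \<longleftrightarrow> T i j)) \<and>
      (\<forall>v\<in>{1..n}. (\<lambda>G s. (\<forall>i\<in>{..<m}. \<not> s m = s i) \<longrightarrow>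
      (\<forall>p\<in>S. \<not> (\<forall>i\<in>{..<m}. {s m, s i} \<in> G \<longleftrightarrow> i \<in> p))) G (s(m := v)))"
  have eq: "realizes n m T S G f \<longleftrightarrow> ?P G (\<lambda>i. if i < m then f i else s i)" for G f s
  proof -
    have mem: "{i. i < m \<and> {y, f i} \<in> G} \<in> S \<longleftrightarrow> (\<exists>p\<in>S. \<forall>i<m. {y, f i} \<in> G \<longleftrightarrow> i \<in> p)" for y
    proof
      assume "\<exists>p\<in>S. \<forall>i<m. {y, f i} \<in> G \<longleftrightarrow> i \<in> p"
      then obtain p where p: "p \<in> S" "\<forall>i<m. {y, f i} \<in> G \<longleftrightarrow> i \<in> p" by blast
      then have "{i. i < m \<and> {y, f i} \<in> G} = p" using S by auto
      then show "{i. i < m \<and> {y, f i} \<in> G} \<in> S" using p by simp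
    qed (auto intro!: bexI[of _ "{i. i < m \<and> {y, f i} \<in> G}"])
    show ?thesis unfolding realizes_def by (auto simp: mem inj_on_def image_iff Ball_def)
  qed
  have "(\<lambda>G s. \<exists>f\<in>{..<m} \<rightarrow> {1..n}. realizes n m T S G f) =
      (\<lambda>G s. \<exists>f\<in>{..<m} \<rightarrow> {1..n}. ?P G (\<lambda>i. if i < m then f i else s i))"
    by (intro ext bex_cong refl eq)
  then show ?thesis
    using definable_ex_tuple[OF definable_conj[OF 1 2]] by (simp only: add_Suc add_0)
qed

section \<open>Counting graphs through disjoint edge sets\<close>

definition pairs :: "nat set \<Rightarrow> nat set set" where
  "pairs W = {e. e \<subseteq> W \<and> card e = 2}"

definition gprob :: "nat \<Rightarrow> (nat set set \<Rightarrow> bool) \<Rightarrow> real" where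
  "gprob n A = real (card {G \<in> graphs_on n. A G}) / 2 ^ (n choose 2)"

lemma finite_pairs: "finite W \<Longrightarrow> finite (pairs W)"
  unfolding pairs_def by (rule finite_subset[of _ "Pow W"]) auto

lemma card_pairs: "finite W \<Longrightarrow> card (pairs W) = card W choose 2"
  unfolding pairs_def by (rule n_subsets)

lemma graphs_on_eq_Pow_pairs: "graphs_on n = Pow (pairs {1..n})"
  by (simp add: graphs_on_def pairs_def)

text \<open>
  Independence: conditions on pairwise disjoint sets of edges.
\<close>

lemma card_subsets_indep:
  assumes "finite Y" "finite E" "disjoint_family_on D Y" "\<And>y. y \<in> Y \<Longrightarrow> D y \<subseteq> E"
  shows "real (card {G \<in> Pow E. \<forall>y\<in>Y. Q y (G \<inter> D y)}) / 2 ^ card E =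
    (\<Prod>y\<in>Y. real (card {F \<in> Pow (D y). Q y F}) / 2 ^ card (D y))"
  using assms
proof (induction Y arbitrary: E rule: finite_induct)
  case empty
  then show ?case by (simp add: Pow_def[symmetric] card_Pow)
next
  case (insert y Y)
  define E' where "E' = E - D y"
  have fin: "finite E'" "finite (D y)" using insert.prems by (auto simp: E'_def intro: finite_subset)
  have disj: "D z \<inter> D y = {}" if "z \<in> Y" for z
    using insert.prems(2) insert.hyps(2) that unfolding disjoint_family_on_def
    by (metis insertCI)
  have IH: "real (card {G \<in> Pow E'. \<forall>y\<in>Y. Q y (G \<inter> D y)}) / 2 ^ card E' =
    (\<Prod>y\<in>Y. real (card {F \<in> Pow (D y). Q y F}) / 2 ^ card (D y))"
  proof (rule insert.IH[OF fin(1)])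
    show "disjoint_family_on D Y" 
      using insert.prems(2) unfolding disjoint_family_on_def by blast
    show "D z \<subseteq> E'" if "z \<in> Y" for z using insert.prems(3) disj[OF that] that by (auto simp: E'_def)
  qed
  have cardE: "card E = card (D y) + card E'"
    using insert.prems(1,3) fin
    by (metis Diff_disjoint E'_def card_Un_disjoint insertI1 Un_Diff_cancel Un_absorb1)
  let ?A = "{F \<in> Pow (D y). Q y F}" and ?B = "{G \<in> Pow E'. \<forall>y\<in>Y. Q y (G \<inter> D y)}"
  have "bij_betw (\<lambda>(F, G). F \<union> G) (?A \<times> ?B) {G \<in> Pow E. \<forall>y\<in>insert y Y. Q y (G \<inter> D y)}"
  proof (rule bij_betw_byWitness[where f' = "\<lambda>G. (G \<inter> D y, G - D y)"])
    show "\<forall>a\<in>?A \<times> ?B. (\<lambda>G. (G \<inter> D y, G - D y)) ((\<lambda>(F, G). F \<union> G) a) = a"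
      by (auto simp: E'_def)
    show "\<forall>G\<in>{G \<in> Pow E. \<forall>y\<in>insert y Y. Q y (G \<inter> D y)}.
       (\<lambda>(F, G). F \<union> G) (G \<inter> D y, G - D y) = G" by auto
    have "(F \<union> G) \<inter> D y = F" if "F \<subseteq> D y" "G \<subseteq> E'" for F G using that by (auto simp: E'_def)
    moreover have "(F \<union> G) \<inter> D z = G \<inter> D z" if "F \<subseteq> D y" "z \<in> Y" for F G z
      using that disj[of z] by auto
    ultimately show "(\<lambda>(F, G). F \<union> G) ` (?A \<times> ?B) \<subseteq> {G \<in> Pow E. \<forall>y\<in>insert y Y. Q y (G \<inter> D y)}"
      using insert.prems(3)[of y] by (auto simp: E'_def)
    have "(G - D y) \<inter> D z = G \<inter> D z" if "z \<in> Y" for G z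
      using that disj[of z] by auto
    then show "(\<lambda>G. (G \<inter> D y, G - D y)) ` {G \<in> Pow E. \<forall>y\<in>insert y Y. Q y (G \<inter> D y)} \<subseteq> ?A \<times> ?B"
      by (auto simp: E'_def)
  qed
  from bij_betw_same_card[OF this]
  have "card {G \<in> Pow E. \<forall>y\<in>insert y Y. Q y (G \<inter> D y)} = card ?A * card ?B"
    by (simp add: card_cartesian_product)
  then show ?case unfolding prod.insert[OF insert.hyps] IH[symmetric] cardE power_add by simp
qed

text \<open>
  The edges inside \<open>W\<close> and the stars from the outside vertices into \<open>W\<close> are disjoint, so the events
  depending on them are independent.
\<close>

lemma gprob_star:
  assumes W: "W \<subseteq> {1..n}" and Y: "Y \<subseteq> {1..n} - W"
  shows "gprob n (\<lambda>G. Q (G \<inter> pairs W) \<and> (\<forall>y\<in>Y. R y {u \<in> W. {y, u} \<in> G})) =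
    real (card {F \<in> Pow (pairs W). Q F}) / 2 ^ (card W choose 2) *
    (\<Prod>y\<in>Y. real (card {p \<in> Pow W. R y p}) / 2 ^ card W)"
proof -
  have fin: "finite W" "finite Y" using W Y finite_subset by blast+
  \<comment> \<open>Vertices are positive, so the index \<open>0\<close> is free for the set of inner pairs.\<close>
  define D where "D y = (if y = 0 then pairs W else (\<lambda>u. {y, u}) ` W)" for y
  define Q' where "Q' y F = (if y = 0 then Q F else R y {u \<in> W. {y, u} \<in> F})" for y F
  have Y0: "0 \<notin> Y" using Y by auto
  have D0: "D 0 = pairs W" by (simp add: D_def)
  have Dy: "D y = (\<lambda>u. {y, u}) ` W" if "y \<in> Y" for y using that Y0 by (auto simp: D_def)
  have Q'y: "Q' y F \<longleftrightarrow> R y {u \<in> W. {y, u} \<in> F}" if "y \<in> Y" for y F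
    using that Y0 by (auto simp: Q'_def)
  have inj: "inj_on (\<lambda>u. {y, u}) W" for y
    by (auto simp: inj_on_def doubleton_eq_iff)
  have yW: "y \<notin> W" if "y \<in> Y" for y using Y that by auto
  have disj: "disjoint_family_on D (insert 0 Y)"
    unfolding disjoint_family_on_def
  proof (intro ballI impI)
    have a: "D 0 \<inter> D y = {}" if "y \<in> Y" for y
      using yW[OF that] that by (auto simp: Dy D0 pairs_def)
    have b: "D y \<inter> D z = {}" if "y \<in> Y" "z \<in> Y" "y \<noteq> z" for y z
      using yW that by (auto simp: Dy doubleton_eq_iff)
    fix y z assume "y \<in> insert 0 Y" "z \<in> insert 0 Y" "y \<noteq> z"
    then show "D y \<inter> D z = {}" using a b by blast
  qed
  have sub: "D y \<subseteq> pairs {1..n}" if "y \<in> insert 0 Y" for y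
  proof (cases "y = 0")
    case True
    then show ?thesis using W by (auto simp: D0 pairs_def)
  next
    case False
    then have "y \<in> Y" using that by simp
    then show ?thesis using W Y yW by (auto simp: Dy pairs_def card_insert_if)
  qed
  have "gprob n (\<lambda>G. Q (G \<inter> pairs W) \<and> (\<forall>y\<in>Y. R y {u \<in> W. {y, u} \<in> G})) =
    real (card {G \<in> Pow (pairs {1..n}). \<forall>y\<in>insert 0 Y. Q' y (G \<inter> D y)}) / 2 ^ card (pairs {1..n})"
  proof -
    have "{u \<in> W. {y, u} \<in> G \<inter> D y} = {u \<in> W. {y, u} \<in> G}" if "y \<in> Y" for y G
      using that by (auto simp: Dy)
    then have "{G \<in> graphs_on n. Q (G \<inter> pairs W) \<and> (\<forall>y\<in>Y. R y {u \<in> W. {y, u} \<in> G})} =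
      {G \<in> Pow (pairs {1..n}). \<forall>y\<in>insert 0 Y. Q' y (G \<inter> D y)}"
      by (auto simp: graphs_on_eq_Pow_pairs Q'y D0 Q'_def[of 0])
    then show ?thesis by (simp add: gprob_def card_pairs)
  qed
  also have "\<dots> = (\<Prod>y\<in>insert 0 Y. real (card {F \<in> Pow (D y). Q' y F}) / 2 ^ card (D y))"
    using fin disj sub by (intro card_subsets_indep) (auto simp: finite_pairs)
  also have "\<dots> = real (card {F \<in> Pow (pairs W). Q F}) / 2 ^ (card W choose 2) *
     (\<Prod>y\<in>Y. real (card {F \<in> Pow (D y). Q' y F}) / 2 ^ card (D y))"
    using fin Y0 by (simp add: D0 Q'_def[of 0] card_pairs)
  also have "(\<Prod>y\<in>Y. real (card {F \<in> Pow (D y). Q' y F}) / 2 ^ card (D y)) =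
    (\<Prod>y\<in>Y. real (card {p \<in> Pow W. R y p}) / 2 ^ card W)"
  proof (rule prod.cong[OF refl])
    fix y assume y: "y \<in> Y"
    have "bij_betw (\<lambda>p. (\<lambda>u. {y, u}) ` p) {p \<in> Pow W. R y p} {F \<in> Pow (D y). Q' y F}"
    proof (rule bij_betw_byWitness[where f' = "\<lambda>F. {u \<in> W. {y, u} \<in> F}"])
      have *: "{u \<in> W. {y, u} \<in> (\<lambda>u. {y, u}) ` p} = p" if "p \<subseteq> W" for p
        using that by (auto simp: doubleton_eq_iff)
      then show "\<forall>a\<in>{p \<in> Pow W. R y p}. {u \<in> W. {y, u} \<in> (\<lambda>u. {y, u}) ` a} = a" by auto
      show "\<forall>a'\<in>{F \<in> Pow (D y). Q' y F}. (\<lambda>u. {y, u}) ` {u \<in> W. {y, u} \<in> a'} = a'"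
        using y by (auto simp: Dy)
      show "(\<lambda>p. (\<lambda>u. {y, u}) ` p) ` {p \<in> Pow W. R y p} \<subseteq> {F \<in> Pow (D y). Q' y F}"
        using y * by (auto simp: Dy Q'y)
      show "(\<lambda>F. {u \<in> W. {y, u} \<in> F}) ` {F \<in> Pow (D y). Q' y F} \<subseteq> {p \<in> Pow W. R y p}"
        using y by (auto simp: Q'y)
    qed
    then show "real (card {F \<in> Pow (D y). Q' y F}) / 2 ^ card (D y) = real (card {p \<in> Pow W. R y p}) / 2 ^ card W"
      using y inj by (simp add: Dy card_image bij_betw_same_card)
  qed
  finally show ?thesis .
qed

definition omits :: "nat \<Rightarrow> nat set \<Rightarrow> nat set set \<Rightarrow> nat set set \<Rightarrow> bool" where
  "omits n U S G \<longleftrightarrow> (\<forall>y\<in>{1..n} - U. {u \<in> U. {y, u} \<in> G} \<notin> S)"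

lemma card_Pow_restrict:
  assumes W: "finite W" "U \<subseteq> W" and S: "S \<subseteq> Pow U"
  shows "card {p \<in> Pow W. p \<inter> U \<in> S} = card S * 2 ^ (card W - card U)"
proof -
  have "bij_betw (\<lambda>(a, b). a \<union> b) (S \<times> Pow (W - U)) {p \<in> Pow W. p \<inter> U \<in> S}"
  proof (rule bij_betw_byWitness[where f' = "\<lambda>p. (p \<inter> U, p - U)"])
    have *: "(a \<union> b) \<inter> U = a" "(a \<union> b) - U = b" "a \<subseteq> U" if "a \<in> S" "b \<subseteq> W - U" for a b
      using that S by auto
    show "\<forall>x\<in>S \<times> Pow (W - U). (\<lambda>p. (p \<inter> U, p - U)) ((\<lambda>(a, b). a \<union> b) x) = x"
      using * by auto
    show "(\<lambda>(a, b). a \<union> b) ` (S \<times> Pow (W - U)) \<subseteq> {p \<in> Pow W. p \<inter> U \<in> S}"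
    proof
      fix x assume "x \<in> (\<lambda>(a, b). a \<union> b) ` (S \<times> Pow (W - U))"
      then obtain a b where "a \<in> S" "b \<subseteq> W - U" "x = a \<union> b" by auto
      then show "x \<in> {p \<in> Pow W. p \<inter> U \<in> S}" using *[of a b] W by auto
    qed
  qed auto
  from bij_betw_same_card[OF this] have "card {p \<in> Pow W. p \<inter> U \<in> S} = card S * card (Pow (W - U))"
    by (simp add: card_cartesian_product)
  moreover have "card (W - U) = card W - card U" using W by (meson card_Diff_subset finite_subset)
  ultimately show ?thesis using W by (simp add: card_Pow)
qed

lemma gprob_omits:
  assumes U: "U \<subseteq> {1..n}" and S: "S \<subseteq> Pow U"
  shows "gprob n (omits n U S) = (1 - real (card S) / 2 ^ card U) ^ (n - card U)"
proof -
  have fin: "finite U" using U finite_subset by blast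
  have "gprob n (omits n U S) = (\<Prod>y\<in>{1..n} - U. real (card {p \<in> Pow U. p \<notin> S}) / 2 ^ card U)"
    using gprob_star[OF U order_refl, of "\<lambda>_. True" "\<lambda>y p. p \<notin> S"] fin
    by (simp add: omits_def[abs_def] Pow_def[symmetric] card_Pow finite_pairs card_pairs)
  also have "{p \<in> Pow U. p \<notin> S} = Pow U - S" by auto
  also have "card \<dots> = 2 ^ card U - card S"
    using S fin by (simp add: card_Diff_subset finite_subset card_Pow)
  also have "real (2 ^ card U - card S) / 2 ^ card U = 1 - real (card S) / 2 ^ card U"
    using card_mono[OF _ S] fin by (simp add: card_Pow of_nat_diff field_simps)
  finally show ?thesis using U fin by (simp add: card_Diff_subset)
qed

text \<open>
  A vertex outside \<open>U \<union> U'\<close> realises both \<open>p\<close> and \<open>p'\<close> only if they agree on the overlap; these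
  pairs govern the correlation of the two events.
\<close>

definition matches :: "nat set \<Rightarrow> nat set set \<Rightarrow> nat set \<Rightarrow> nat set set \<Rightarrow> (nat set \<times> nat set) set" where
  "matches U S U' S' = {(p, p') \<in> S \<times> S'. p \<inter> U' = p' \<inter> U}"

text \<open>
  Inclusion--exclusion for a single outside vertex; the vertices in the symmetric difference are
  ignored, which only increases the probability.
\<close>

lemma gprob_omits_pair:
  assumes U: "U \<subseteq> {1..n}" "S \<subseteq> Pow U" and U': "U' \<subseteq> {1..n}" "S' \<subseteq> Pow U'"
  shows "gprob n (\<lambda>G. omits n U S G \<and> omits n U' S' G) \<le>
    (1 - real (card S) / 2 ^ card U - real (card S') / 2 ^ card U'
       + real (card (matches U S U' S')) / 2 ^ card (U \<union> U')) ^ (n - card (U \<union> U'))"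
proof -
  define W where "W = U \<union> U'"
  have W: "W \<subseteq> {1..n}" using U U' by (auto simp: W_def)
  then have fin: "finite W" "finite U" "finite U'" 
    using finite_subset[of W "{1..n}"] by (auto simp: W_def)
  define A where "A = {p \<in> Pow W. p \<inter> U \<in> S}"
  define A' where "A' = {p \<in> Pow W. p \<inter> U' \<in> S'}"
  have finA: "finite A" "finite A'" using fin by (auto simp: A_def A'_def)
  have cA: "card A = card S * 2 ^ (card W - card U)"
    unfolding A_def using fin U by (intro card_Pow_restrict) (auto simp: W_def)
  have cA': "card A' = card S' * 2 ^ (card W - card U')"
    unfolding A'_def using fin U' by (intro card_Pow_restrict) (auto simp: W_def)
  have le: "card U \<le> card W" "card U' \<le> card W" using fin by (auto simp: W_def intro!: card_mono)
  have cI: "card (A \<inter> A') \<le> card (matches U S U' S')"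
  proof (rule card_inj_on_le)
    show "inj_on (\<lambda>p. (p \<inter> U, p \<inter> U')) (A \<inter> A')"
      by (auto simp: inj_on_def A_def W_def)
    show "(\<lambda>p. (p \<inter> U, p \<inter> U')) ` (A \<inter> A') \<subseteq> matches U S U' S'"
      by (auto simp: A_def A'_def matches_def)
    have "finite (S \<times> S')" using U U' fin by (meson finite_Pow_iff finite_SigmaI finite_subset)
    then show "finite (matches U S U' S')"
      unfolding matches_def by (rule finite_subset[rotated]) auto
  qed
  let ?R = "\<lambda>y p. p \<inter> U \<notin> S \<and> p \<inter> U' \<notin> S'"
  have "gprob n (\<lambda>G. omits n U S G \<and> omits n U' S' G) \<le>
    gprob n (\<lambda>G. True \<and> (\<forall>y\<in>{1..n} - W. ?R y {u \<in> W. {y, u} \<in> G}))"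
  proof -
    have "{u \<in> W. {y, u} \<in> G} \<inter> U = {u \<in> U. {y, u} \<in> G}"
      "{u \<in> W. {y, u} \<in> G} \<inter> U' = {u \<in> U'. {y, u} \<in> G}" for y G
      by (auto simp: W_def)
    then have "{G \<in> graphs_on n. omits n U S G \<and> omits n U' S' G} \<subseteq>
      {G \<in> graphs_on n. \<forall>y\<in>{1..n} - W. ?R y {u \<in> W. {y, u} \<in> G}}"
      by (auto simp: omits_def W_def)
    then show ?thesis
      by (auto simp: gprob_def divide_right_mono card_mono finite_graphs_on)
  qed
  also have "\<dots> = (\<Prod>y\<in>{1..n} - W. real (card {p \<in> Pow W. ?R y p}) / 2 ^ card W)"
    using fin by (subst gprob_star[OF W order_refl])
      (simp add: Pow_def[symmetric] card_Pow finite_pairs card_pairs)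
  also have "{p \<in> Pow W. p \<inter> U \<notin> S \<and> p \<inter> U' \<notin> S'} = Pow W - (A \<union> A')"
    by (auto simp: A_def A'_def)
  also have "card (Pow W - (A \<union> A')) = 2 ^ card W - card (A \<union> A')"
    using fin finA by (subst card_Diff_subset) (auto simp: card_Pow A_def A'_def)
  also have "(\<Prod>y\<in>{1..n} - W. real (2 ^ card W - card (A \<union> A')) / 2 ^ card W) \<le>
     (1 - real (card S) / 2 ^ card U - real (card S') / 2 ^ card U'
       + real (card (matches U S U' S')) / 2 ^ card (U \<union> U')) ^ (n - card (U \<union> U'))"
  proof -
    have "card (A \<union> A') \<le> card (Pow W)"
      using fin by (intro card_mono) (auto simp: A_def A'_def)
    then have "real (2 ^ card W - card (A \<union> A')) = 2 ^ card W - real (card (A \<union> A'))"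
      using fin by (simp add: card_Pow of_nat_diff)
    also have "real (card (A \<union> A')) = real (card A) + real (card A') - real (card (A \<inter> A'))"
      using card_Un_Int[OF finA] by simp
    also have "2 ^ card W - (real (card A) + real (card A') - real (card (A \<inter> A'))) \<le>
      2 ^ card W - (real (card A) + real (card A') - real (card (matches U S U' S')))"
      using cI by simp
    also have "\<dots> = 2 ^ card W * (1 - real (card S) / 2 ^ card U - real (card S') / 2 ^ card U'
       + real (card (matches U S U' S')) / 2 ^ card W)"
      using le unfolding cA cA' of_nat_mult of_nat_power of_nat_numeral
      by (simp add: power_diff field_simps)
    finally have "real (2 ^ card W - card (A \<union> A')) / 2 ^ card W \<le>
      1 - real (card S) / 2 ^ card U - real (card S') / 2 ^ card U'
       + real (card (matches U S U' S')) / 2 ^ card W"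
      by (simp add: divide_le_eq mult.commute)
    moreover have "card ({1..n} - W) = n - card W" using W fin by (simp add: card_Diff_subset)
    ultimately show ?thesis by (simp add: power_mono flip: W_def)
  qed
  finally show ?thesis .
qed

lemma gprob_mono: "(\<And>G. G \<in> graphs_on n \<Longrightarrow> A G \<Longrightarrow> B G) \<Longrightarrow> gprob n A \<le> gprob n B"
  unfolding gprob_def by (intro divide_right_mono) (auto intro!: card_mono simp: finite_graphs_on)

lemma gprob_nonneg: "0 \<le> gprob n A"
  by (simp add: gprob_def)

lemma gprob_union_bound:
  assumes "finite I"
  shows "gprob n (\<lambda>G. \<exists>i\<in>I. A i G) \<le> (\<Sum>i\<in>I. gprob n (A i))"
proof -
  have "{G \<in> graphs_on n. \<exists>i\<in>I. A i G} = (\<Union>i\<in>I. {G \<in> graphs_on n. A i G})" by auto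
  then have "card {G \<in> graphs_on n. \<exists>i\<in>I. A i G} \<le> (\<Sum>i\<in>I. card {G \<in> graphs_on n. A i G})"
    using card_UN_le[OF assms] by simp
  then show ?thesis
    unfolding gprob_def sum_divide_distrib[symmetric] of_nat_sum[symmetric]
    by (intro divide_right_mono) (simp_all only: of_nat_le_iff, simp)
qed

section \<open>First and second moments\<close>

text \<open>
  Smaller sets inherit their patterns from a superset of size exactly \<open>r\<close>.
\<close>

lemma ext_prop_of_exact:
  assumes r: "r \<le> n"
    and ext: "\<And>U A. U \<subseteq> {1..n} \<Longrightarrow> card U = r \<Longrightarrow> A \<subseteq> U \<Longrightarrow> \<not> omits n U {A} G"
  shows "ext_prop n r G"
  unfolding ext_prop_def
proof (intro allI impI, elim conjE)
  fix U A assume U: "U \<subseteq> {1..n}" "card U \<le> r" and A: "A \<subseteq> U"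
  then obtain U' where U': "U \<subseteq> U'" "U' \<subseteq> {1..n}" "card U' = r"
    using exists_subset_between[of U r "{1..n}"] r by auto
  obtain y where "y \<in> {1..n} - U'" "{u \<in> U'. {y, u} \<in> G} = A"
    using ext[OF U'(2,3) order_trans[OF A U'(1)]] unfolding omits_def by auto
  then show "\<exists>y\<in>{1..n} - U. {u \<in> U. {y, u} \<in> G} = A"
    using U'(1) A by (intro bexI[of _ y]) auto
qed

lemma gprob_not_ext_prop:
  assumes r: "r \<le> n"
  shows "gprob n (\<lambda>G. \<not> ext_prop n r G) \<le> real (n choose r) * 2 ^ r * (1 - 1 / 2 ^ r) ^ (n - r)"
proof -
  define I where "I = Sigma {U. U \<subseteq> {1..n} \<and> card U = r} Pow"
  have finU: "finite U" if "U \<subseteq> {1..n}" for U using that finite_subset by blast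
  have finI: "finite I" unfolding I_def by (rule finite_SigmaI) (use finU in auto)
  have "gprob n (\<lambda>G. \<not> ext_prop n r G) \<le> gprob n (\<lambda>G. \<exists>i\<in>I. omits n (fst i) {snd i} G)"
  proof (rule gprob_mono)
    fix G assume "\<not> ext_prop n r G"
    then obtain U A where "U \<subseteq> {1..n}" "card U = r" "A \<subseteq> U" "omits n U {A} G"
      using ext_prop_of_exact[OF r, of G] by blast
    then show "\<exists>i\<in>I. omits n (fst i) {snd i} G"
      by (intro bexI[of _ "(U, A)"]) (simp_all add: I_def)
  qed
  also have "\<dots> \<le> (\<Sum>i\<in>I. gprob n (omits n (fst i) {snd i}))"
    by (rule gprob_union_bound[OF finI])
  also have "\<dots> = (\<Sum>i\<in>I. (1 - 1 / 2 ^ r) ^ (n - r))"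
    by (rule sum.cong) (auto simp: I_def gprob_omits)
  also have "\<dots> = real (card I) * (1 - 1 / 2 ^ r) ^ (n - r)" by simp
  also have "card I = (n choose r) * 2 ^ r"
  proof -
    have "card I = (\<Sum>U | U \<subseteq> {1..n} \<and> card U = r. card (Pow U))"
      unfolding I_def by (rule card_SigmaI) (use finU in auto)
    also have "\<dots> = (\<Sum>U | U \<subseteq> {1..n} \<and> card U = r. 2 ^ r)"
      by (rule sum.cong) (auto simp: card_Pow finU)
    also have "\<dots> = (n choose r) * 2 ^ r" using n_subsets[of "{1..n}" r] by simp
    finally show ?thesis .
  qed
  finally show ?thesis by simp
qed

lemma realizes_cong:
  assumes "\<And>i. i < m \<Longrightarrow> f i = g i"
  shows "realizes n m T S G f \<longleftrightarrow> realizes n m T S G g"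
proof -
  have "f ` {..<m} = g ` {..<m}" "inj_on f {..<m} \<longleftrightarrow> inj_on g {..<m}"
    using assms by (auto intro!: inj_on_cong)
  moreover have "{i \<in> {..<m}. {y, f i} \<in> G} = {i \<in> {..<m}. {y, g i} \<in> G}" for y
    using assms by auto
  ultimately show ?thesis using assms by (simp add: realizes_def)
qed

lemma gprob_realizes:
  assumes f: "f \<in> {..<m} \<rightarrow> {1..n}" and S: "S \<subseteq> Pow {..<m}"
  shows "gprob n (\<lambda>G. realizes n m T S G f) \<le>
    1 / 2 ^ (m choose 2) * (1 - real (card S) / 2 ^ m) ^ (n - m)"
proof (cases "inj_on f {..<m}")
  case False
  have "card S \<le> 2 ^ m" using card_mono[OF _ S] by (simp add: card_Pow)
  then have "real (card S) \<le> 2 ^ m" by (metis of_nat_le_iff of_nat_numeral of_nat_power)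
  then show ?thesis using False by (simp add: realizes_def gprob_def)
next
  case inj: True
  define W where "W = f ` {..<m}"
  define F0 where "F0 = {e \<in> pairs W. \<exists>i<m. \<exists>j<m. e = {f i, f j} \<and> T i j}"
  define S' where "S' = (`) f ` S"
  have W: "W \<subseteq> {1..n}" "card W = m" "finite W" using f inj by (auto simp: W_def card_image)
  have injP: "inj_on ((`) f) (Pow {..<m})" by (rule inj_on_image_Pow[OF inj])
  have S': "S' \<subseteq> Pow W" using S by (auto simp: S'_def W_def)
  have card_S': "card S' = card S"
    unfolding S'_def by (rule card_image[OF inj_on_subset[OF injP S]])
  have real_imp: "G \<inter> pairs W = F0 \<and> (\<forall>y\<in>{1..n} - W. {u \<in> W. {y, u} \<in> G} \<notin> S')"
    if "realizes n m T S G f" for G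
  proof (intro conjI ballI)
    have r2: "\<forall>i<m. \<forall>j<m. {f i, f j} \<in> G \<longleftrightarrow> T i j"
      using that unfolding realizes_def by (elim conjE)
    have adj: "{f i, f j} \<in> G \<longleftrightarrow> T i j" if "i < m" "j < m" for i j
      by (rule r2[rule_format, OF that])
    show "G \<inter> pairs W = F0"
    proof (intro set_eqI iffI)
      fix e assume e: "e \<in> G \<inter> pairs W"
      then have "card e = 2" "e \<subseteq> W" by (simp_all add: pairs_def)
      then obtain u v where "e = {u, v}" by (auto simp only: card_2_iff)
      with \<open>e \<subseteq> W\<close> have uv: "e = {u, v}" "u \<in> W" "v \<in> W" by simp_all
      obtain i j where ij: "i < m" "j < m" "u = f i" "v = f j"
        using uv(2,3) by (auto simp: W_def)
      have "T i j" using adj[OF ij(1,2)] e uv(1) ij(3,4) by simp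
      have "e = {f i, f j}" using ij uv by simp
      with \<open>T i j\<close> ij(1,2) have "\<exists>i<m. \<exists>j<m. e = {f i, f j} \<and> T i j"
        by (intro exI[of _ i] exI[of _ j] conjI)
      then show "e \<in> F0" using e by (simp add: F0_def)
    next
      fix e assume "e \<in> F0"
      then have "e \<in> pairs W" "\<exists>i<m. \<exists>j<m. e = {f i, f j} \<and> T i j"
        by (simp_all only: F0_def mem_Collect_eq)
      then show "e \<in> G \<inter> pairs W" using adj by (elim exE conjE) simp
    qed
  next
    fix y assume y: "y \<in> {1..n} - W"
    let ?A = "{i \<in> {..<m}. {y, f i} \<in> G}"
    have "\<forall>y\<in>{1..n} - f ` {..<m}. {i \<in> {..<m}. {y, f i} \<in> G} \<notin> S"
      using that unfolding realizes_def by (elim conjE)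
    then have A: "?A \<notin> S" using y unfolding W_def by (rule bspec)
    have "{u \<in> W. {y, u} \<in> G} = f ` ?A" by (auto simp: W_def)
    moreover have "f ` ?A \<notin> S'"
    proof
      assume "f ` ?A \<in> S'"
      then obtain p where p: "p \<in> S" "f ` ?A = f ` p" unfolding S'_def by blast
      with p have "?A = p" using inj_on_image_eq_iff[OF inj, of ?A p] S by auto
      then show False using A p(1) by simp
    qed
    ultimately show "{u \<in> W. {y, u} \<in> G} \<notin> S'" by simp
  qed
  have "gprob n (\<lambda>G. realizes n m T S G f) \<le>
    gprob n (\<lambda>G. G \<inter> pairs W = F0 \<and> (\<forall>y\<in>{1..n} - W. {u \<in> W. {y, u} \<in> G} \<notin> S'))"
    using real_imp by (intro gprob_mono) blast
  also have "\<dots> = real (card {F \<in> Pow (pairs W). F = F0}) / 2 ^ (card W choose 2) *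
    (\<Prod>y\<in>{1..n} - W. real (card {p \<in> Pow W. p \<notin> S'}) / 2 ^ card W)"
    by (rule gprob_star[OF W(1) order_refl])
  also have "{F \<in> Pow (pairs W). F = F0} = {F0}" by (auto simp: F0_def)
  also have "{p \<in> Pow W. p \<notin> S'} = Pow W - S'" by auto
  also have "card \<dots> = 2 ^ m - card S"
    using S' W card_S' by (subst card_Diff_subset) (auto intro: finite_subset simp: card_Pow)
  also have "real (2 ^ m - card S) / 2 ^ card W = 1 - real (card S) / 2 ^ m"
    using card_mono[OF _ S] by (simp add: W card_Pow of_nat_diff field_simps)
  finally show ?thesis using W by (simp add: card_Diff_subset)
qed

lemma gprob_ex_realizes:
  assumes S: "S \<subseteq> Pow {..<m}"
  shows "gprob n (\<lambda>G. \<exists>f\<in>{..<m} \<rightarrow> {1..n}. realizes n m T S G f) \<le>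
    real n ^ m / 2 ^ (m choose 2) * (1 - real (card S) / 2 ^ m) ^ (n - m)"
proof -
  let ?F = "{..<m} \<rightarrow>\<^sub>E {1..n}"
  have "gprob n (\<lambda>G. \<exists>f\<in>{..<m} \<rightarrow> {1..n}. realizes n m T S G f) \<le>
    gprob n (\<lambda>G. \<exists>f\<in>?F. realizes n m T S G f)"
  proof (rule gprob_mono)
    fix G assume "\<exists>f\<in>{..<m} \<rightarrow> {1..n}. realizes n m T S G f"
    then obtain f where "f \<in> {..<m} \<rightarrow> {1..n}" "realizes n m T S G f" by blast
    then show "\<exists>f\<in>?F. realizes n m T S G f"
      using realizes_cong[of m f "restrict f {..<m}"] by (intro bexI[of _ "restrict f {..<m}"]) auto
  qed
  also have "\<dots> \<le> (\<Sum>f\<in>?F. gprob n (\<lambda>G. realizes n m T S G f))"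
    by (rule gprob_union_bound) (simp add: finite_PiE)
  also have "\<dots> \<le> (\<Sum>f\<in>?F. 1 / 2 ^ (m choose 2) * (1 - real (card S) / 2 ^ m) ^ (n - m))"
    by (intro sum_mono gprob_realizes S) auto
  also have "\<dots> = real n ^ m / 2 ^ (m choose 2) * (1 - real (card S) / 2 ^ m) ^ (n - m)"
    by (simp add: card_PiE)
  finally show ?thesis .
qed

text \<open>
  Any enumeration of \<open>U\<close> turns the sets of vertices into sets of indices.
\<close>

lemma omits_realizes:
  assumes U: "U \<subseteq> {1..n}" "card U = m" and S: "S \<subseteq> Pow U" and om: "omits n U S G"
  obtains T S' f where "f \<in> {..<m} \<rightarrow> {1..n}" "realizes n m T S' G f" "S' \<subseteq> Pow {..<m}"
    "card S' = card S"
proof -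
  have finU: "finite U" using U finite_subset by blast
  obtain f where f: "bij_betw f {..<m} U"
    using ex_bij_betw_nat_finite[OF finU] U(2) by (auto simp: atLeast0LessThan)
  then have inj: "inj_on f {..<m}" and im: "f ` {..<m} = U" by (auto simp: bij_betw_def)
  define S' where "S' = {p \<in> Pow {..<m}. f ` p \<in> S}"
  have injP: "inj_on ((`) f) (Pow {..<m})" by (rule inj_on_image_Pow[OF inj])
  have "(`) f ` S' = S"
  proof
    show "S \<subseteq> (`) f ` S'"
    proof
      fix p assume p: "p \<in> S"
      then have "p \<subseteq> f ` {..<m}" using S im by auto
      then obtain q where "q \<subseteq> {..<m}" "p = f ` q" by (auto simp: subset_image_iff)
      then show "p \<in> (`) f ` S'" using p by (auto simp: S'_def)
    qed
  qed (auto simp: S'_def)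
  moreover have "inj_on ((`) f) S'" by (rule inj_on_subset[OF injP]) (auto simp: S'_def)
  ultimately have "card S' = card S" using card_image by metis
  moreover have "realizes n m (\<lambda>i j. {f i, f j} \<in> G) S' G f"
    unfolding realizes_def
  proof (intro conjI ballI)
    fix y assume "y \<in> {1..n} - f ` {..<m}"
    then have "{u \<in> U. {y, u} \<in> G} \<notin> S" using om im by (simp add: omits_def)
    moreover have "{u \<in> U. {y, u} \<in> G} = f ` {i \<in> {..<m}. {y, f i} \<in> G}" using im by auto
    ultimately show "{i \<in> {..<m}. {y, f i} \<in> G} \<notin> S'" by (simp add: S'_def)
  qed (use inj in auto)
  moreover have "f \<in> {..<m} \<rightarrow> {1..n}" using im U by auto
  moreover have "S' \<subseteq> Pow {..<m}" by (auto simp: S'_def)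
  ultimately show thesis using that by blast
qed

text \<open>
  Cauchy--Schwarz applied to the number of events that occur and the indicator that it is positive.
\<close>

lemma second_moment:
  assumes I: "finite I"
  shows "(\<Sum>i\<in>I. gprob n (B i))\<^sup>2 \<le>
    gprob n (\<lambda>G. \<exists>i\<in>I. B i G) * (\<Sum>i\<in>I. \<Sum>j\<in>I. gprob n (\<lambda>G. B i G \<and> B j G))"
proof -
  let ?\<Omega> = "graphs_on n" and ?N = "(2::real) ^ (n choose 2)"
  define X where "X G = (\<Sum>i\<in>I. of_bool (B i G) :: real)" for G
  define Z where "Z G = (of_bool (\<exists>i\<in>I. B i G) :: real)" for G
  have p: "gprob n A = (\<Sum>G\<in>?\<Omega>. of_bool (A G)) / ?N" for A
    by (simp add: gprob_def sum_of_bool_eq finite_graphs_on Int_def conj_commute)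
  have XZ: "X G * Z G = X G" for G
    by (auto simp: X_def Z_def intro!: sum.neutral)
  have "(\<Sum>G\<in>?\<Omega>. X G)\<^sup>2 \<le> (\<Sum>G\<in>?\<Omega>. (X G)\<^sup>2) * (\<Sum>G\<in>?\<Omega>. (Z G)\<^sup>2)"
    using Cauchy_Schwarz_ineq_sum[of X Z ?\<Omega>] by (simp add: XZ)
  also have "(\<Sum>G\<in>?\<Omega>. (Z G)\<^sup>2) = ?N * gprob n (\<lambda>G. \<exists>i\<in>I. B i G)"
    by (simp add: p Z_def power2_eq_square flip: of_bool_conj)
  also have "(\<Sum>G\<in>?\<Omega>. (X G)\<^sup>2) = ?N * (\<Sum>i\<in>I. \<Sum>j\<in>I. gprob n (\<lambda>G. B i G \<and> B j G))"
  proof -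
    have "(\<Sum>G\<in>?\<Omega>. (X G)\<^sup>2) = (\<Sum>G\<in>?\<Omega>. \<Sum>i\<in>I. \<Sum>j\<in>I. of_bool (B i G \<and> B j G))"
      by (simp add: X_def power2_eq_square sum_product of_bool_conj)
    also have "\<dots> = (\<Sum>i\<in>I. \<Sum>G\<in>?\<Omega>. \<Sum>j\<in>I. of_bool (B i G \<and> B j G))" by (rule sum.swap)
    also have "\<dots> = (\<Sum>i\<in>I. \<Sum>j\<in>I. \<Sum>G\<in>?\<Omega>. of_bool (B i G \<and> B j G))"
      by (intro sum.cong refl sum.swap)
    also have "\<dots> = ?N * (\<Sum>i\<in>I. \<Sum>j\<in>I. gprob n (\<lambda>G. B i G \<and> B j G))"
      unfolding p sum_divide_distrib[symmetric] by simp
    finally show ?thesis .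
  qed
  finally have "(\<Sum>G\<in>?\<Omega>. X G)\<^sup>2 / ?N\<^sup>2 \<le>
    (gprob n (\<lambda>G. \<exists>i\<in>I. B i G) * (\<Sum>i\<in>I. \<Sum>j\<in>I. gprob n (\<lambda>G. B i G \<and> B j G)))"
    by (simp add: divide_le_eq power2_eq_square mult_ac)
  moreover have "(\<Sum>G\<in>?\<Omega>. X G) / ?N = (\<Sum>i\<in>I. gprob n (B i))"
    unfolding X_def by (subst sum.swap) (simp add: p sum_divide_distrib)
  ultimately show ?thesis by (simp only: power_divide[symmetric])
qed

lemma binomial_ratio_le:
  assumes "m \<le> n"
  shows "real (m choose i) * real n ^ i \<le> real (n choose i) * real m ^ i"
proof (induction i)
  case (Suc i)
  show ?case
  proof (cases "i < m")
    case False
    then show ?thesis by (simp add: binomial_eq_0)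
  next
    case True
    have rec: "real (Suc i) * real (k choose Suc i) = (real k - real i) * real (k choose i)"
      if "i < k" for k
    proof -
      have "Suc i * (k choose Suc i) = (k - i) * (k choose i)"
        by (simp only: binomial_absorption binomial_absorb_comp)
      then have "real (Suc i * (k choose Suc i)) = real ((k - i) * (k choose i))" by simp
      then show ?thesis using that by (simp only: of_nat_mult of_nat_diff less_imp_le)
    qed
    have *: "(real m - real i) * real n \<le> (real n - real i) * real m"
      using mult_left_mono[of "real m" "real n" "real i"] assms by (simp add: algebra_simps)
    have "real (Suc i) * (real (m choose Suc i) * real n ^ Suc i) =
      (real (Suc i) * real (m choose Suc i)) * (real n * real n ^ i)"
      by (simp only: power_Suc mult_ac)
    also have "\<dots> = ((real m - real i) * real n) * (real (m choose i) * real n ^ i)"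
      unfolding rec[OF True] by (simp only: mult_ac)
    also have "\<dots> \<le> ((real n - real i) * real m) * (real (n choose i) * real m ^ i)"
      using True assms by (intro mult_mono Suc.IH *) simp_all
    also have "\<dots> = (real (Suc i) * real (n choose Suc i)) * (real m * real m ^ i)"
      using True assms by (subst rec) (simp_all only: mult_ac)
    also have "\<dots> = real (Suc i) * (real (n choose Suc i) * real m ^ Suc i)"
      by (simp only: power_Suc mult_ac)
    finally show ?thesis by (simp only: mult_le_cancel_left_pos of_nat_0_less_iff zero_less_Suc)
  qed
qed simp

lemma card_supersets:
  assumes V: "finite V" and I: "I \<subseteq> V"
  shows "card {U. I \<subseteq> U \<and> U \<subseteq> V \<and> card U = card I + s} = (card V - card I) choose s"
proof -
  have fin: "finite I" using I V finite_subset by blast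
  have "bij_betw (\<lambda>A. A \<union> I) {A. A \<subseteq> V - I \<and> card A = s} {U. I \<subseteq> U \<and> U \<subseteq> V \<and> card U = card I + s}"
  proof (rule bij_betw_byWitness[where f' = "\<lambda>U. U - I"])
    have "card (A \<union> I) = card I + s" if "A \<subseteq> V - I" "card A = s" for A
      using that fin V by (subst card_Un_disjoint) (auto intro: finite_subset)
    then show "(\<lambda>A. A \<union> I) ` {A. A \<subseteq> V - I \<and> card A = s} \<subseteq> {U. I \<subseteq> U \<and> U \<subseteq> V \<and> card U = card I + s}"
      using I by auto
    show "(\<lambda>U. U - I) ` {U. I \<subseteq> U \<and> U \<subseteq> V \<and> card U = card I + s} \<subseteq> {A. A \<subseteq> V - I \<and> card A = s}"
      using fin by (auto simp: card_Diff_subset)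
  qed auto
  from bij_betw_same_card[OF this] show ?thesis
    using n_subsets[of "V - I" s] V I fin by (simp add: card_Diff_subset)
qed

text \<open>
  A set meeting \<open>U\<close> in \<open>i\<close> vertices is fixed by the intersection and an extension of it; a fixed
  \<open>i\<close>-set is contained in a random \<open>m\<close>-set with probability at most \<open>(m/n)\<^sup>i\<close>.
\<close>

lemma card_overlap_le:
  assumes mn: "m \<le> n" "0 < n" and U: "U \<subseteq> {1..n}" "card U = m" and i: "i \<le> m"
  shows "real (card {U'. U' \<subseteq> {1..n} \<and> card U' = m \<and> card (U \<inter> U') = i}) \<le>
    real (n choose m) * ((real m)\<^sup>2 / real n) ^ i"
proof -
  have finU: "finite U" using U finite_subset by blast
  have fin: "finite {U'. I \<subseteq> U' \<and> U' \<subseteq> {1..n} \<and> card U' = k}" for I k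
    by (rule finite_subset[of _ "Pow {1..n}"]) auto
  let ?I = "{I. I \<subseteq> U \<and> card I = i}"
  have "{U'. U' \<subseteq> {1..n} \<and> card U' = m \<and> card (U \<inter> U') = i} \<subseteq>
    (\<Union>I\<in>?I. {U'. I \<subseteq> U' \<and> U' \<subseteq> {1..n} \<and> card U' = card I + (m - i)})"
  proof
    fix U' assume U': "U' \<in> {U'. U' \<subseteq> {1..n} \<and> card U' = m \<and> card (U \<inter> U') = i}"
    then have "U \<inter> U' \<in> ?I" "U' \<in> {U''. U \<inter> U' \<subseteq> U'' \<and> U'' \<subseteq> {1..n} \<and> card U'' = card (U \<inter> U') + (m - i)}"
      using i by auto
    then show "U' \<in> (\<Union>I\<in>?I. {U'. I \<subseteq> U' \<and> U' \<subseteq> {1..n} \<and> card U' = card I + (m - i)})" by blast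
  qed
  then have "card {U'. U' \<subseteq> {1..n} \<and> card U' = m \<and> card (U \<inter> U') = i} \<le>
    card (\<Union>I\<in>?I. {U'. I \<subseteq> U' \<and> U' \<subseteq> {1..n} \<and> card U' = card I + (m - i)})"
    using finU fin by (intro card_mono finite_UN_I) simp_all
  also have "\<dots> \<le> (\<Sum>I\<in>?I. card {U'. I \<subseteq> U' \<and> U' \<subseteq> {1..n} \<and> card U' = card I + (m - i)})"
    using finU by (intro card_UN_le) simp
  also have "\<dots> = (\<Sum>I\<in>?I. (n - i) choose (m - i))"
  proof (rule sum.cong[OF refl])
    fix I assume "I \<in> ?I"
    then show "card {U'. I \<subseteq> U' \<and> U' \<subseteq> {1..n} \<and> card U' = card I + (m - i)} = (n - i) choose (m - i)"
      using card_supersets[of "{1..n}" I "m - i"] U by force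
  qed
  also have "\<dots> = (m choose i) * ((n - i) choose (m - i))"
    using n_subsets[OF finU, of i] U by simp
  finally have 1: "real (card {U'. U' \<subseteq> {1..n} \<and> card U' = m \<and> card (U \<inter> U') = i}) \<le>
     real (m choose i) * real ((n - i) choose (m - i))"
    unfolding of_nat_mult[symmetric] by (simp only: of_nat_le_iff)
  have pos: "0 < real (n choose i)" using i mn by simp
  have "real (n choose m) * real (m choose i) = real (n choose i) * real ((n - i) choose (m - i))"
    unfolding of_nat_mult[symmetric] by (simp only: choose_mult[OF i mn(1)])
  then have "real ((n - i) choose (m - i)) = real (n choose m) * (real (m choose i) / real (n choose i))"
    using pos by (simp add: field_simps)
  also have "real (m choose i) / real (n choose i) \<le> (real m / real n) ^ i"
    using binomial_ratio_le[OF mn(1), of i] pos mn(2) by (simp add: field_simps power_divide)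
  finally have 2: "real ((n - i) choose (m - i)) \<le> real (n choose m) * (real m / real n) ^ i"
    by (simp add: mult_left_mono)
  have 3: "real (m choose i) \<le> real m ^ i"
    unfolding of_nat_power[symmetric] of_nat_le_iff by (rule binomial_le_pow[OF i])
  have "real (m choose i) * real ((n - i) choose (m - i)) \<le>
     real m ^ i * (real (n choose m) * (real m / real n) ^ i)"
    by (intro mult_mono 2 3) auto
  also have "\<dots> = real (n choose m) * ((real m)\<^sup>2 / real n) ^ i"
    by (simp add: power2_eq_square power_mult_distrib power_divide)
  finally show ?thesis using 1 by simp
qed

section \<open>Overlapping vertex sets\<close>

text \<open>
  The second moment split by the size \<open>i\<close> of the overlap. The three summands of the bound come from
  \<open>U = U'\<close>, from disjoint sets, where the events are nearly independent, and from proper overlaps,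
  where \<open>\<rho> i\<close> bounds the correlation.
\<close>

lemma overlap_second_moment:
  fixes S :: "nat set \<Rightarrow> nat set set" and J c m n :: nat and \<rho> :: "nat \<Rightarrow> real"
  defines "q \<equiv> 1 - real J / 2 ^ m"
  assumes m: "1 \<le> m" "2 * m \<le> n" and J: "2 * J < 2 ^ m"
    and S: "\<And>U. U \<subseteq> {1..n} \<Longrightarrow> card U = m \<Longrightarrow> S U \<subseteq> Pow U \<and> card (S U) = J"
    and c: "\<And>U U'. U \<subseteq> {1..n} \<Longrightarrow> card U = m \<Longrightarrow> U' \<subseteq> {1..n} \<Longrightarrow> card U' = m \<Longrightarrow>
      U \<inter> U' \<noteq> {} \<Longrightarrow> card (matches U (S U) U' (S U')) \<le> c"
    and \<rho>: "\<And>i. 1 \<le> i \<Longrightarrow> i < m \<Longrightarrow> 0 \<le> \<rho> i \<and>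
      (1 - 2 * real J / 2 ^ m + real c / 2 ^ (2 * m - i)) ^ (n - (2 * m - i)) \<le> q ^ (2 * (n - m)) * \<rho> i"
  shows "1 \<le> gprob n (\<lambda>G. \<exists>U. U \<subseteq> {1..n} \<and> card U = m \<and> omits n U (S U) G) *
    (1 / (real (n choose m) * q ^ (n - m)) + 1 / q ^ (2 * m) + (\<Sum>i\<in>{1..<m}. ((real m)\<^sup>2 / real n) ^ i * \<rho> i))"
proof -
  define \<U> where "\<U> = {U. U \<subseteq> {1..n} \<and> card U = m}"
  define N where "N = real (n choose m)"
  define B where "B U = omits n U (S U)" for U
  define P where "P = gprob n (\<lambda>G. \<exists>U\<in>\<U>. B U G)"
  define E where "E = N * q ^ (n - m)"
  define g where "g i = (if i = 0 then q ^ (2 * (n - 2 * m)) else if i = m then q ^ (n - m)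
      else q ^ (2 * (n - m)) * \<rho> i)" for i
  have finU: "finite U" if "U \<in> \<U>" for U using that finite_subset[of U "{1..n}"] by (simp add: \<U>_def)
  have fin\<U>: "finite \<U>" unfolding \<U>_def by (rule finite_subset[of _ "Pow {1..n}"]) auto
  have card\<U>: "real (card \<U>) = N" unfolding \<U>_def N_def by (subst n_subsets) auto
  have Npos: "0 < N" using m by (simp add: N_def)
  have J': "2 * real J < 2 ^ m" 
  proof -
    have "real (2 * J) < real (2 ^ m)" using J by (simp only: of_nat_less_iff)
    then show ?thesis by simp
  qed
  have "real J < 2 ^ m" using J' of_nat_0_le_iff[of J] by linarith
  then have q: "0 < q" by (simp add: q_def)
  have Epos: "0 < E" using q Npos by (simp add: E_def)
  have g0: "0 \<le> g i" if "i \<le> m" for i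
    using q \<rho>[of i] that by (auto simp: g_def)
  have single: "gprob n (B U) = q ^ (n - m)" if "U \<in> \<U>" for U
    using that S by (simp add: B_def \<U>_def q_def gprob_omits)
  have pair: "gprob n (\<lambda>G. B U G \<and> B U' G) \<le> g (card (U \<inter> U'))" if U: "U \<in> \<U>" "U' \<in> \<U>" for U U'
  proof -
    let ?i = "card (U \<inter> U')"
    have cU: "card U = m" "card U' = m" "U \<subseteq> {1..n}" "U' \<subseteq> {1..n}" using U by (auto simp: \<U>_def)
    have un: "card (U \<union> U') = 2 * m - ?i"
      using card_Un_Int[OF finU[OF U(1)] finU[OF U(2)]] cU by simp
    have base: "gprob n (\<lambda>G. B U G \<and> B U' G) \<le>
       (1 - 2 * real J / 2 ^ m + real (card (matches U (S U) U' (S U'))) / 2 ^ (2 * m - ?i)) ^ (n - (2 * m - ?i))"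
      using gprob_omits_pair[of U n "S U" U' "S U'"] S cU by (simp add: B_def un)
    have le_m: "?i \<le> m" using card_mono[OF finU[OF U(1)], of "U \<inter> U'"] cU by simp
    consider "?i = 0" | "?i = m" "?i \<noteq> 0" | "1 \<le> ?i" "?i < m"
      using le_m by linarith
    then show ?thesis
    proof cases
      case 1
      have "finite (S U)" "finite (S U')"
        using finite_subset[of "S U" "Pow U"] finite_subset[of "S U'" "Pow U'"] S cU finU U by simp_all
      then have "card (matches U (S U) U' (S U')) \<le> card (S U \<times> S U')"
        by (intro card_mono) (auto simp: matches_def)
      also have "\<dots> = J * J" using S cU by (simp add: card_cartesian_product)
      finally have "real (card (matches U (S U) U' (S U'))) \<le> real (J * J)" by (simp only: of_nat_le_iff)
      then have "(1 - 2 * real J / 2 ^ m + real (card (matches U (S U) U' (S U'))) / 2 ^ (2 * m)) ^ (n - 2 * m) \<le>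
         (1 - 2 * real J / 2 ^ m + real (J * J) / 2 ^ (2 * m)) ^ (n - 2 * m)"
        using J' by (intro power_mono add_mono divide_right_mono) auto
      also have "1 - 2 * real J / 2 ^ m + real (J * J) / 2 ^ (2 * m) = q\<^sup>2"
        unfolding q_def power2_eq_square mult_2 power_add by (simp add: field_simps)
      finally show ?thesis using base 1 by (simp add: g_def power_mult)
    next
      case 2
      have "gprob n (\<lambda>G. B U G \<and> B U' G) \<le> gprob n (B U)" by (rule gprob_mono) auto
      then show ?thesis using 2 single[OF U(1)] by (simp add: g_def)
    next
      case 3
      then have "U \<inter> U' \<noteq> {}" by auto
      then have "real (card (matches U (S U) U' (S U'))) \<le> real c" using c cU by simp
      then have "(1 - 2 * real J / 2 ^ m + real (card (matches U (S U) U' (S U'))) / 2 ^ (2 * m - ?i)) ^ (n - (2 * m - ?i)) \<le>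
         (1 - 2 * real J / 2 ^ m + real c / 2 ^ (2 * m - ?i)) ^ (n - (2 * m - ?i))"
        using J' by (intro power_mono add_mono divide_right_mono) auto
      then show ?thesis using base \<rho>[OF 3] 3 by (simp add: g_def)
    qed
  qed
  have inner: "(\<Sum>U'\<in>\<U>. gprob n (\<lambda>G. B U G \<and> B U' G)) \<le>
     q ^ (n - m) + N * q ^ (2 * (n - 2 * m)) +
       (\<Sum>i\<in>{1..<m}. N * ((real m)\<^sup>2 / real n) ^ i * (q ^ (2 * (n - m)) * \<rho> i))" if U: "U \<in> \<U>" for U
  proof -
    have cU: "card U = m" "U \<subseteq> {1..n}" using U by (auto simp: \<U>_def)
    let ?C = "\<lambda>i. {U' \<in> \<U>. card (U \<inter> U') = i}"
    have fC: "finite (?C i)" for i using fin\<U> by simp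
    have le_m: "card (U \<inter> U') \<le> m" for U'
      using card_mono[OF finU[OF U], of "U \<inter> U'"] cU by simp
    have "(\<Sum>U'\<in>\<U>. gprob n (\<lambda>G. B U G \<and> B U' G)) \<le> (\<Sum>U'\<in>\<U>. g (card (U \<inter> U')))"
      by (intro sum_mono pair U)
    also have "\<dots> = (\<Sum>i\<in>{..m}. \<Sum>U'\<in>?C i. g (card (U \<inter> U')))"
      by (rule sum.group[symmetric]) (use fin\<U> le_m in \<open>simp_all add: image_subset_iff\<close>)
    also have "\<dots> = (\<Sum>i\<in>{..m}. real (card (?C i)) * g i)"
    proof (rule sum.cong[OF refl])
      fix i
      have "(\<Sum>U'\<in>?C i. g (card (U \<inter> U'))) = (\<Sum>U'\<in>?C i. g i)"
        by (rule sum.cong) simp_all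
      then show "(\<Sum>U'\<in>?C i. g (card (U \<inter> U'))) = real (card (?C i)) * g i"
        by (simp only: sum_constant)
    qed
    also have "{..m} = insert m (insert 0 {1..<m})" using m by auto
    also have "(\<Sum>i\<in>insert m (insert 0 {1..<m}). real (card (?C i)) * g i) =
       real (card (?C m)) * g m + (real (card (?C 0)) * g 0 + (\<Sum>i\<in>{1..<m}. real (card (?C i)) * g i))"
      using m by simp
    also have "\<dots> \<le> 1 * q ^ (n - m) + (N * q ^ (2 * (n - 2 * m)) +
       (\<Sum>i\<in>{1..<m}. (N * ((real m)\<^sup>2 / real n) ^ i) * (q ^ (2 * (n - m)) * \<rho> i)))"
    proof (intro add_mono sum_mono)
      \<comment> \<open>Overlap \<open>m\<close> means equality.\<close>
      have sub: "?C m \<subseteq> {U}"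
      proof
        fix U' assume U': "U' \<in> ?C m"
        then have "U' \<in> \<U>" and *: "card (U \<inter> U') = m" by simp_all
        have fin: "finite U'" by (rule finU[OF \<open>U' \<in> \<U>\<close>])
        have cU': "card U' = m" using \<open>U' \<in> \<U>\<close> by (simp add: \<U>_def)
        have a: "U \<inter> U' = U"
          by (rule card_subset_eq[OF finU[OF U] Int_lower1]) (rule trans[OF * cU(1)[symmetric]])
        have b: "U \<inter> U' = U'"
          by (rule card_subset_eq[OF fin Int_lower2]) (rule trans[OF * cU'[symmetric]])
        have "U' = U" using b a by (rule trans[OF sym])
        then show "U' \<in> {U}" by (simp only: singletonI)
      qed
      have "card (?C m) \<le> card {U}" by (rule card_mono[OF _ sub]) simp
      then have "real (card (?C m)) \<le> 1" by simp
      then show "real (card (?C m)) * g m \<le> 1 * q ^ (n - m)"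
        using m q by (intro mult_mono) (simp_all add: g_def)
      have "real (card (?C 0)) \<le> real (card \<U>)"
        unfolding of_nat_le_iff using fin\<U> by (intro card_mono) simp_all
      then show "real (card (?C 0)) * g 0 \<le> N * q ^ (2 * (n - 2 * m))"
        using q Npos by (intro mult_mono) (simp_all add: g_def card\<U>)
      fix i assume i: "i \<in> {1..<m}"
      have "real (card (?C i)) \<le> N * ((real m)\<^sup>2 / real n) ^ i"
      proof -
        have "?C i = {U'. U' \<subseteq> {1..n} \<and> card U' = m \<and> card (U \<inter> U') = i}"
          by (simp only: \<U>_def mem_Collect_eq conj_assoc)
        then show ?thesis unfolding N_def
          using m i by (simp only:) (rule card_overlap_le[OF _ _ cU(2,1)], simp_all)
      qed
      then show "real (card (?C i)) * g i \<le> N * ((real m)\<^sup>2 / real n) ^ i * (q ^ (2 * (n - m)) * \<rho> i)"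
        using i g0[of i] Npos by (intro mult_mono) (simp_all add: g_def)
    qed
    finally show ?thesis by (simp only: add.assoc mult_1_left)
  qed
  let ?R = "1 / E + 1 / q ^ (2 * m) + (\<Sum>i\<in>{1..<m}. ((real m)\<^sup>2 / real n) ^ i * \<rho> i)"
  have "E\<^sup>2 = (\<Sum>U\<in>\<U>. gprob n (B U))\<^sup>2"
    using single by (simp add: E_def card\<U>)
  also have "\<dots> \<le> P * (\<Sum>U\<in>\<U>. \<Sum>U'\<in>\<U>. gprob n (\<lambda>G. B U G \<and> B U' G))"
    unfolding P_def by (rule second_moment[OF fin\<U>])
  also have "\<dots> \<le> P * (\<Sum>U\<in>\<U>. q ^ (n - m) + N * q ^ (2 * (n - 2 * m)) +
       (\<Sum>i\<in>{1..<m}. N * ((real m)\<^sup>2 / real n) ^ i * (q ^ (2 * (n - m)) * \<rho> i)))"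
    by (intro mult_left_mono sum_mono inner) (auto simp: P_def gprob_nonneg)
  also have "(\<Sum>U\<in>\<U>. q ^ (n - m) + N * q ^ (2 * (n - 2 * m)) +
       (\<Sum>i\<in>{1..<m}. N * ((real m)\<^sup>2 / real n) ^ i * (q ^ (2 * (n - m)) * \<rho> i))) =
     N * (q ^ (n - m) + N * q ^ (2 * (n - 2 * m)) +
       (\<Sum>i\<in>{1..<m}. N * ((real m)\<^sup>2 / real n) ^ i * (q ^ (2 * (n - m)) * \<rho> i)))"
    by (simp only: sum_constant card\<U>)
  also have "\<dots> = E\<^sup>2 * ?R"
  proof -
    \<comment> \<open>Everything is expressed through \<open>q ^ (n - m)\<close>, the probability of a single event.\<close>
    have Q: "q ^ (2 * (n - m)) = (q ^ (n - m))\<^sup>2" by (simp only: power_mult mult.commute)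
    have "2 * (n - m) = 2 * (n - 2 * m) + 2 * m" using m by simp
    then have x: "q ^ (2 * (n - 2 * m)) = (q ^ (n - m))\<^sup>2 * (1 / q ^ (2 * m))"
      unfolding Q[symmetric] using q by (simp add: power_add)
    have s: "(\<Sum>i\<in>{1..<m}. N * ((real m)\<^sup>2 / real n) ^ i * (q ^ (2 * (n - m)) * \<rho> i)) =
      N * (q ^ (n - m))\<^sup>2 * (\<Sum>i\<in>{1..<m}. ((real m)\<^sup>2 / real n) ^ i * \<rho> i)"
      unfolding Q sum_distrib_left by (simp only: mult_ac)
    have E2: "E\<^sup>2 = N * (N * (q ^ (n - m))\<^sup>2)"
      by (simp only: E_def power2_eq_square mult_ac)
    have "E\<^sup>2 * (1 / E) = N * q ^ (n - m)"
      using Epos unfolding power2_eq_square by (simp add: E_def)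
    then show ?thesis unfolding x s distrib_left E2 by (simp only: mult_ac)
  qed
  finally have "E\<^sup>2 * 1 \<le> E\<^sup>2 * (P * ?R)" by (simp only: mult_ac mult_1_right mult_1_left)
  then have "1 \<le> P * ?R" using Epos zero_less_power[OF Epos, of 2]
    by (simp only: mult_le_cancel_left_pos)
  then show ?thesis unfolding P_def E_def N_def B_def \<U>_def by (simp add: conj_assoc)
qed

text \<open>
  The patterns \<open>{}\<close> and \<open>U\<close> over one set never agree with the opposite ones over another set that
  meets it, so only two of the four pairs match. Adding an arbitrary third pattern to both families
  gives at most three further pairs; \<open>{Min U}\<close> is just a convenient choice of it.
\<close>

definition two_patterns :: "nat set \<Rightarrow> nat set set" where
  "two_patterns U = {{}, U}"

definition three_patterns :: "nat set \<Rightarrow> nat set set" where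
  "three_patterns U = {{}, U, {Min U}}"

lemma card_two_patterns:
  "1 \<le> card U \<Longrightarrow> two_patterns U \<subseteq> Pow U \<and> card (two_patterns U) = 2"
  by (auto simp: two_patterns_def card_insert_if)

lemma card_three_patterns:
  assumes "2 \<le> card U"
  shows "three_patterns U \<subseteq> Pow U \<and> card (three_patterns U) = 3"
proof -
  have "finite U" "U \<noteq> {}" using assms card.infinite by fastforce+
  then have "Min U \<in> U" by simp
  moreover have "U \<noteq> {Min U}"
  proof
    assume "U = {Min U}"
    then have "card U = card {Min U}" by (rule arg_cong)
    then show False using assms by simp
  qed
  ultimately show ?thesis using \<open>U \<noteq> {}\<close> by (auto simp: three_patterns_def card_insert_if)
qed

lemma matches_two_patterns:
  assumes "U \<inter> U' \<noteq> {}"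
  shows "card (matches U (two_patterns U) U' (two_patterns U')) \<le> 2"
proof -
  have "matches U (two_patterns U) U' (two_patterns U') \<subseteq> {({}, {}), (U, U')}"
    using assms by (auto simp: matches_def two_patterns_def)
  then have "card (matches U (two_patterns U) U' (two_patterns U')) \<le> card {({}, {}), (U, U')}"
    by (intro card_mono) auto
  then show ?thesis by (simp add: card_insert_if split: if_splits)
qed

text \<open>
  On the nonempty overlap \<open>{}\<close> and \<open>U'\<close> have different traces, so \<open>T\<close> matches at most one of them,
  and likewise \<open>T'\<close>.
\<close>

lemma card_matches_le_5:
  assumes "U \<inter> U' \<noteq> {}"
  shows "card (matches U {{}, U, T} U' {{}, U', T'}) \<le> 5"
proof -
  let ?L = "[({}, {}), (U, U'), (T, if T \<inter> U' = {} then {} else U'),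
    (if T' \<inter> U = {} then {} else U, T'), (T, T')]"
  have "matches U {{}, U, T} U' {{}, U', T'} \<subseteq> set ?L"
  proof
    fix x assume "x \<in> matches U {{}, U, T} U' {{}, U', T'}"
    then obtain p p' where x: "x = (p, p')" and p: "p = {} \<or> p = U \<or> p = T"
      and p': "p' = {} \<or> p' = U' \<or> p' = T'" and eq: "p \<inter> U' = p' \<inter> U"
      unfolding matches_def by blast
    have UU: "U' \<inter> U \<noteq> {}" using assms by (simp add: Int_commute)
    from p show "x \<in> set ?L"
    proof (elim disjE)
      assume "p = {}"
      then have "p' \<inter> U = {}" using eq by simp
      then show ?thesis using p' UU \<open>p = {}\<close> by (elim disjE) (simp_all add: x)
    next
      assume "p = U"
      then have "p' \<inter> U \<noteq> {}" using eq assms by simp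
      then show ?thesis using p' \<open>p = U\<close> by (elim disjE) (simp_all add: x)
    next
      assume "p = T"
      then show ?thesis using p' eq UU by (elim disjE) (simp_all add: x)
    qed
  qed
  then have "card (matches U {{}, U, T} U' {{}, U', T'}) \<le> card (set ?L)"
    by (intro card_mono) simp_all
  also have "\<dots> \<le> length ?L" by (rule card_length)
  finally show ?thesis by simp
qed

section \<open>The threshold\<close>

text \<open>
  For a convex function, moving two points apart with fixed midpoint increases the sum of the values.
\<close>

lemma convex_on_sum_le_endpoints:
  fixes f :: "real \<Rightarrow> real"
  assumes f: "convex_on {x..y} f" and u: "u \<in> {x..y}"
  shows "f u + f (x + y - u) \<le> f x + f y"
proof (cases "x = y")
  case True
  then show ?thesis using u by auto
next
  case False
  then have xy: "x < y" using u by auto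
  define t where "t = (u - x) / (y - x)"
  have t: "0 \<le> t" "t \<le> 1" using u xy by (auto simp: t_def field_simps)
  have tx: "t * (y - x) = u - x" using xy by (simp add: t_def)
  have "f ((1 - t) *\<^sub>R x + t *\<^sub>R y) \<le> (1 - t) * f x + t * f y"
    using convex_onD[OF f t] xy by auto
  moreover have "f ((1 - (1 - t)) *\<^sub>R x + (1 - t) *\<^sub>R y) \<le> (1 - (1 - t)) * f x + (1 - t) * f y"
    using convex_onD[OF f, of "1 - t"] t xy by auto
  moreover have "(1 - t) *\<^sub>R x + t *\<^sub>R y = u" "(1 - (1 - t)) *\<^sub>R x + (1 - t) *\<^sub>R y = x + y - u"
    using tx by (auto simp: algebra_simps)
  ultimately have "f u \<le> (1 - t) * f x + t * f y" "f (x + y - u) \<le> t * f x + (1 - t) * f y"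
    by simp_all
  then show ?thesis by (simp add: left_diff_distrib)
qed

lemma binom_ext_pos:
  assumes "0 \<le> k" "k \<le> real n"
  shows "0 < binom_ext n k"
  using assms by (auto simp: binom_ext_def intro!: divide_pos_pos mult_pos_pos Gamma_real_pos)

lemma ln_binom_ext:
  assumes "0 \<le> k" "k \<le> real n"
  shows "ln (binom_ext n k) =
    ln (Gamma (real n + 1)) - (ln (Gamma (k + 1)) + ln (Gamma (real n - k + 1)))"
proof -
  have "0 < Gamma (k + 1)" "0 < Gamma (real n - k + 1)" "0 < Gamma (real n + 1)"
    using assms by (auto intro!: Gamma_real_pos)
  then have "0 < Gamma (k + 1) * Gamma (real n - k + 1)" 
    "Gamma (k + 1) \<noteq> 0" "Gamma (real n - k + 1) \<noteq> 0"
    by auto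
  moreover have "Gamma (real n + 1) \<noteq> 0"
    by (rule less_imp_neq[OF Gamma_real_pos, symmetric]) simp
  ultimately show ?thesis unfolding binom_ext_def by (subst ln_div) (simp_all add: ln_mult)
qed

lemma binom_ext_of_nat: "j \<le> n \<Longrightarrow> binom_ext n (real j) = real (n choose j)"
  using Gamma_fact[of n, where 'a = real] Gamma_fact[of j, where 'a = real] Gamma_fact[of "n - j", where 'a = real]
  by (simp add: binom_ext_def binomial_fact of_nat_diff add.commute)

text \<open>
  Log-convexity of the Gamma function makes the denominator \<open>\<Gamma>(k + 1) \<Gamma>(n - k + 1)\<close> decrease up to
  the midpoint, without any derivative.
\<close>

lemma ln_binom_ext_mono:
  assumes "0 \<le> k" "k \<le> k'" "k' \<le> real n / 2"
  shows "ln (binom_ext n k) \<le> ln (binom_ext n k')"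
proof -
  have "convex_on {k + 1..real n - k + 1} (ln \<circ> Gamma :: real \<Rightarrow> real)"
    using assms by (intro convex_on_subset[OF log_convex_Gamma_real]) auto
  from convex_on_sum_le_endpoints[OF this, of "k' + 1"] assms
  show ?thesis by (simp add: ln_binom_ext algebra_simps)
qed

lemma ln_binom_ext_nonneg:
  assumes "0 \<le> k" "k \<le> real n"
  shows "0 \<le> ln (binom_ext n k)"
proof -
  have "convex_on {1..real n + 1} (ln \<circ> Gamma :: real \<Rightarrow> real)"
    by (intro convex_on_subset[OF log_convex_Gamma_real]) auto
  from convex_on_sum_le_endpoints[OF this, of "k + 1"] assms
  show ?thesis by (simp add: ln_binom_ext algebra_simps)
qed

lemma f_ext_eq:
  assumes "1 \<le> k" "k \<le> real n"
  shows "f_ext n k = ln (binom_ext n k) + k * ln 2 + (real n - k) * ln (1 - 1 / 2 powr k)"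
proof -
  have "(2::real) powr 1 \<le> 2 powr k" using assms by (intro powr_mono) auto
  then have "1 / 2 powr k < (1::real)" by simp
  then show ?thesis
    using binom_ext_pos[of k n] assms by (simp add: f_ext_def ln_mult ln_powr)
qed

lemma two_powr_ge_2: "1 \<le> k \<Longrightarrow> (2::real) \<le> 2 powr k"
  using powr_mono[of 1 k "2::real"] by simp

text \<open>
  Each of the three summands of \<open>f_ext_eq\<close> is monotone up to \<open>n / 2\<close>, and \<open>k ln 2\<close> strictly so.
\<close>

lemma f_ext_strict_mono:
  assumes "1 \<le> k" "k < k'" "k' \<le> real n / 2"
  shows "f_ext n k < f_ext n k'"
proof -
  have "1 / 2 powr k' \<le> 1 / (2::real) powr k"
    using assms by (intro divide_left_mono powr_mono) auto
  moreover have "1 / 2 powr k \<le> 1 / (2::real)"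
    using two_powr_ge_2[of k] assms by (intro divide_left_mono) auto
  moreover have "0 < 1 / 2 powr k'" by simp
  ultimately have "0 < 1 - 1 / 2 powr k" "1 - 1 / 2 powr k \<le> 1 - 1 / 2 powr k'"
      "1 - 1 / 2 powr k' < 1" "0 < 1 - 1 / 2 powr k'"
    by linarith+
  then have "ln (1 - 1 / 2 powr k) \<le> ln (1 - 1 / 2 powr k')" "0 \<le> - ln (1 - 1 / 2 powr k')"
    by (auto simp del: less_diff_eq diff_gt_0_iff_gt simp: ln_le_zero_iff)
  then have "(real n - k') * (- ln (1 - 1 / 2 powr k')) \<le> (real n - k) * (- ln (1 - 1 / 2 powr k))"
    using assms by (intro mult_mono) auto
  moreover have "k * ln 2 < k' * ln 2" using assms by simp
  ultimately show ?thesis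
    using ln_binom_ext_mono[of k k' n] f_ext_eq[of k n] f_ext_eq[of k' n] assms by linarith
qed

lemma ln_one_minus_ge:
  assumes "0 \<le> x" "x \<le> (1/2::real)"
  shows "- x - 2 * x\<^sup>2 \<le> ln (1 - x)" "- 2 * x \<le> ln (1 - x)"
proof -
  show *: "- x - 2 * x\<^sup>2 \<le> ln (1 - x)" using assms by (rule ln_one_minus_pos_lower_bound)
  have "2 * x\<^sup>2 \<le> x" using mult_right_mono[OF assms(2,1)] by (simp add: power2_eq_square)
  then show "- 2 * x \<le> ln (1 - x)" using * by simp
qed

text \<open>
  Beyond \<open>n / 2\<close> monotonicity fails, but there the binomial coefficient is at least \<open>1\<close> and \<open>k ln 2\<close>
  dominates the remaining term; hence no further root arises.
\<close>

lemma f_ext_pos_right: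
  assumes "4 \<le> n" "real n / 2 \<le> k" "k \<le> real n"
  shows "0 < f_ext n k"
proof -
  have k: "2 \<le> k" using assms by simp
  have "(2::real) powr 2 \<le> 2 powr k" using k by (intro powr_mono) auto
  then have x: "1 / 2 powr k \<le> (1 / 4 :: real)" by (intro divide_left_mono) (auto simp: powr_numeral)
  have ln: "- ln (1 - 1 / 2 powr k) \<le> 2 * (1 / 4)"
  proof -
    have "- 2 * (1 / 2 powr k) \<le> ln (1 - 1 / 2 powr k)"
      by (rule ln_one_minus_ge(2)) (use x in auto)
    then show ?thesis using x by linarith
  qed
  have "(real n - k) * (- ln (1 - 1 / 2 powr k)) \<le> k * (2 * (1 / 4))"
    using ln x assms k by (intro mult_mono) auto
  moreover have "k * (1 / 2) < k * ln 2" using k ln2_ge_two_thirds by (intro mult_strict_left_mono) auto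
  ultimately show ?thesis
    using f_ext_eq[of k n] ln_binom_ext_nonneg[of k n] assms k by linarith
qed

lemma f_ext_root:
  assumes n: "4 \<le> n" and neg: "f_ext n 1 < 0"
  shows "\<exists>!k. k \<in> {1..real n} \<and> f_ext n k = 0"
    and "1 \<le> k_hat n" "k_hat n \<le> real n / 2" "f_ext n (k_hat n) = 0"
    and "\<And>x. k_hat n < x \<Longrightarrow> x \<le> real n \<Longrightarrow> 0 < f_ext n x"
    and "\<And>x. 1 \<le> x \<Longrightarrow> x < k_hat n \<Longrightarrow> f_ext n x < 0"
proof -
  have cont: "continuous_on {1..real n / 2} (f_ext n)"
  proof (subst continuous_on_cong[OF refl f_ext_eq])
    have *: "k + 1 \<notin> \<int>\<^sub>\<le>\<^sub>0" "real n - k + 1 \<notin> \<int>\<^sub>\<le>\<^sub>0" if "k \<in> {1..real n / 2}" for k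
      using that n by (auto elim!: nonpos_Ints_cases)
    have **: "1 - 1 / 2 powr k \<noteq> (0::real)" if "k \<in> {1..real n / 2}" for k :: real
      using two_powr_ge_2[of k] that by auto
    have G: "continuous_on {1::real..} Gamma"
      by (intro continuous_on_Gamma) (auto elim!: nonpos_Ints_cases)
    show "continuous_on {1..real n / 2}
      (\<lambda>k. ln (binom_ext n k) + k * ln 2 + (real n - k) * ln (1 - 1 / 2 powr k))"
      unfolding binom_ext_def using * **
      by (intro continuous_on_add continuous_on_mult continuous_on_ln continuous_on_divide
            continuous_on_compose2[OF G] continuous_intros)
        (auto simp: Gamma_eq_zero_iff)
  qed auto
  have "\<exists>k\<ge>1. k \<le> real n / 2 \<and> f_ext n k = 0"
    using neg f_ext_pos_right[of n "real n / 2"] n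
    by (intro IVT' cont) auto
  then obtain k where k: "1 \<le> k" "k \<le> real n / 2" "f_ext n k = 0" by blast
  have right: "0 < f_ext n x" if "k < x" "x \<le> real n" for x
  proof (cases "x \<le> real n / 2")
    case True
    then show ?thesis using f_ext_strict_mono[of k x n] k that by simp
  next
    case False
    then show ?thesis using f_ext_pos_right[OF n, of x] that by simp
  qed
  have left: "f_ext n x < 0" if "1 \<le> x" "x < k" for x
    using f_ext_strict_mono[of x k n] that k by simp
  have uniq: "x = k" if "x \<in> {1..real n}" "f_ext n x = 0" for x
    using right[of x] left[of x] that by (cases x k rule: linorder_cases) auto
  have kn: "k \<in> {1..real n}" using k by auto
  show ex1: "\<exists>!k. k \<in> {1..real n} \<and> f_ext n k = 0"
    using uniq kn k by blast
  have kh: "k_hat n = k" unfolding k_hat_def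
    by (rule the_equality) (use uniq kn k in auto)
  show "1 \<le> k_hat n" "k_hat n \<le> real n / 2" "f_ext n (k_hat n) = 0" using k kh by auto
  show "\<And>x. k_hat n < x \<Longrightarrow> x \<le> real n \<Longrightarrow> 0 < f_ext n x" using right kh by simp
  show "\<And>x. 1 \<le> x \<Longrightarrow> x < k_hat n \<Longrightarrow> f_ext n x < 0" using left kh by simp
qed

text \<open>
  The quantity \<open>L\<close> of the introduction, the limiting order of \<open>n / 2 powr k_hat n\<close>.
\<close>

definition lsq :: "nat \<Rightarrow> real" where
  "lsq n = (ln (real n))\<^sup>2 / ln 2"

text \<open>
  Rounding \<open>k\<close> inside the binomial coefficient only costs a factor \<open>n\<close>, which is negligible against
  \<open>n powr k\<close>; rounding it inside \<open>2 powr k\<close> would not be.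
\<close>

lemma f_ext_upper:
  assumes k: "1 \<le> k" "k + 1 \<le> real n / 2"
  shows "f_ext n k \<le> (k + 1) * ln (real n) + k * ln 2 - (real n - k) / 2 powr k"
proof -
  have n: "1 \<le> real n" using k by simp
  define j where "j = nat \<lceil>k\<rceil>"
  have j: "k \<le> real j" "real j \<le> k + 1" using k unfolding j_def by linarith+
  have jn: "j \<le> n" using j k by linarith
  have "ln (binom_ext n k) \<le> ln (binom_ext n (real j))"
    using j k by (intro ln_binom_ext_mono) auto
  also have "\<dots> = ln (real (n choose j))" using jn by (simp add: binom_ext_of_nat)
  also have "\<dots> \<le> ln (real n ^ j)"
  proof (rule ln_mono)
    have "real (n choose j) \<le> real (n ^ j)" using binomial_le_pow[OF jn] of_nat_le_iff by blast
    then show "real (n choose j) \<le> real n ^ j" by simp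
  qed (use jn n in auto)
  also have "\<dots> = real j * ln (real n)" using n by (simp add: ln_realpow)
  also have "\<dots> \<le> (k + 1) * ln (real n)" using j n by (intro mult_right_mono) auto
  finally have 1: "ln (binom_ext n k) \<le> (k + 1) * ln (real n)" .
  have "ln (1 - 1 / 2 powr k) \<le> - (1 / 2 powr k)"
    using two_powr_ge_2[OF k(1)] ln_add_one_self_le_self2[of "- (1 / 2 powr k)"] by simp
  then have "(real n - k) * ln (1 - 1 / 2 powr k) \<le> (real n - k) * - (1 / 2 powr k)"
    using k by (intro mult_left_mono) auto
  then show ?thesis using 1 k by (simp add: f_ext_eq)
qed

lemma f_ext_lower:
  assumes k: "2 \<le> k" "k \<le> real n / 2"
  shows "(k - 1) * (ln (real n) - ln k) - real n * (1 / 2 powr k + 2 * (1 / 2 powr k)\<^sup>2) \<le> f_ext n k"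
proof -
  define j where "j = nat \<lfloor>k\<rfloor>"
  have j: "real j \<le> k" "k - 1 \<le> real j" using k unfolding j_def by linarith+
  have jn: "j \<le> n" "1 \<le> j" using j k by linarith+
  have "(k - 1) * (ln (real n) - ln k) \<le> real j * (ln (real n) - ln (real j))"
    using j jn k by (intro mult_mono) auto
  also have "\<dots> = ln ((real n / real j) ^ j)" using jn by (simp add: ln_realpow ln_div)
  also have "\<dots> \<le> ln (real (n choose j))"
    using binomial_ge_n_over_k_pow_k[OF jn(1), where 'a = real] jn
    by (intro ln_mono) auto
  also have "\<dots> = ln (binom_ext n (real j))" using jn by (simp add: binom_ext_of_nat)
  also have "\<dots> \<le> ln (binom_ext n k)"
    using j k by (intro ln_binom_ext_mono) auto
  finally have 1: "(k - 1) * (ln (real n) - ln k) \<le> ln (binom_ext n k)" .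
  have "1 / 2 powr k \<le> (1 / 2 :: real)"
    using two_powr_ge_2[of k] k by (intro divide_left_mono) auto
  then have "- ln (1 - 1 / 2 powr k) \<le> 1 / 2 powr k + 2 * (1 / 2 powr k)\<^sup>2"
    using ln_one_minus_ge(1)[of "1 / 2 powr k"] by simp
  then have "(real n - k) * - ln (1 - 1 / 2 powr k) \<le> real n * (1 / 2 powr k + 2 * (1 / 2 powr k)\<^sup>2)"
    using k by (intro mult_mono) auto
  then have "- (real n * (1 / 2 powr k + 2 * (1 / 2 powr k)\<^sup>2)) \<le> (real n - k) * ln (1 - 1 / 2 powr k)"
    by simp
  moreover have "0 \<le> k * ln 2" using k by simp
  moreover have "f_ext n k = ln (binom_ext n k) + k * ln 2 + (real n - k) * ln (1 - 1 / 2 powr k)"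
    using k by (intro f_ext_eq) auto
  ultimately show ?thesis using 1 by linarith
qed

text \<open>
  The function is negative at the point where \<open>n / 2 powr k\<close> is slightly above \<open>lsq n\<close>, and positive where
  it is slightly below.
\<close>

lemma k_hat_window:
  "\<forall>\<^sub>F n in sequentially. (\<exists>!k. k \<in> {1..real n} \<and> f_ext n k = 0) \<and> 1 \<le> k_hat n \<and>
     k_hat n \<le> real n / 2 \<and> (\<forall>x. k_hat n < x \<and> x \<le> real n \<longrightarrow> 0 < f_ext n x) \<and>
     (99/100) * lsq n \<le> real n / 2 powr k_hat n \<and> real n / 2 powr k_hat n \<le> (101/100) * lsq n"
proof -
  define \<kappa> where "\<kappa> c n = log 2 (real n / (c * lsq n))" for c and n :: nat
  have "\<forall>\<^sub>F n in sequentially. (1 + 1) * ln (real n) + 1 * ln 2 - (real n - 1) / 2 powr 1 < 0"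
    by real_asymp
  moreover have "\<forall>\<^sub>F n in sequentially. (4::nat) \<le> n" by real_asymp
  moreover have "\<forall>\<^sub>F n in sequentially. 0 < lsq n" unfolding lsq_def by real_asymp
  moreover have "\<forall>\<^sub>F n in sequentially. 2 \<le> \<kappa> (99/100) n" unfolding lsq_def \<kappa>_def by real_asymp
  moreover have "\<forall>\<^sub>F n in sequentially. 2 \<le> \<kappa> (101/100) n" unfolding lsq_def \<kappa>_def by real_asymp
  moreover have "\<forall>\<^sub>F n in sequentially. \<kappa> (99/100) n + 1 \<le> real n / 2"
    unfolding lsq_def \<kappa>_def by real_asymp
  moreover have "\<forall>\<^sub>F n in sequentially. \<kappa> (101/100) n + 1 \<le> real n / 2"
    unfolding lsq_def \<kappa>_def by real_asymp
  moreover have "\<forall>\<^sub>F n in sequentially. (\<kappa> (101/100) n + 1) * ln (real n) + \<kappa> (101/100) n * ln 2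
      - (real n - \<kappa> (101/100) n) / (real n / (101/100 * lsq n)) < 0"
    unfolding lsq_def \<kappa>_def by real_asymp
  moreover have "\<forall>\<^sub>F n in sequentially. 0 < (\<kappa> (99/100) n - 1) * (ln (real n) - ln (\<kappa> (99/100) n))
      - real n * (1 / (real n / (99/100 * lsq n)) + 2 * (1 / (real n / (99/100 * lsq n)))\<^sup>2)"
    unfolding lsq_def \<kappa>_def by real_asymp
  ultimately show ?thesis
  proof eventually_elim
    case (elim n)
    have neg: "f_ext n 1 < 0" by (rule le_less_trans[OF f_ext_upper elim(1)]) (use elim(2) in auto)
    note root = f_ext_root[OF elim(2) neg]
    have p: "2 powr \<kappa> c n = real n / (c * lsq n)" if "0 < c" for c
      using that elim by (simp add: \<kappa>_def)
    have q: "real n / 2 powr \<kappa> c n = c * lsq n" if "0 < c" for c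
      using that elim by (simp add: p)
    have "f_ext n (\<kappa> (101/100) n) < 0"
      using f_ext_upper[of "\<kappa> (101/100) n" n] elim by (simp add: p)
    then have "\<kappa> (101/100) n \<le> k_hat n"
      using root(5)[of "\<kappa> (101/100) n"] elim by force
    then have "real n / 2 powr k_hat n \<le> real n / 2 powr \<kappa> (101/100) n"
      by (intro divide_left_mono powr_mono) auto
    then have up: "real n / 2 powr k_hat n \<le> 101/100 * lsq n" by (simp add: q)
    have "0 < f_ext n (\<kappa> (99/100) n)"
      using f_ext_lower[of "\<kappa> (99/100) n" n] elim by (simp add: p)
    then have "k_hat n \<le> \<kappa> (99/100) n"
      using root(6)[of "\<kappa> (99/100) n"] elim by force
    then have "real n / 2 powr \<kappa> (99/100) n \<le> real n / 2 powr k_hat n"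
      by (intro divide_left_mono powr_mono) auto
    then have "99/100 * lsq n \<le> real n / 2 powr k_hat n" by (simp add: q)
    with up root show ?case by auto
  qed
qed

section \<open>Asymptotic estimates near the threshold\<close>

lemma one_minus_power_le_exp:
  assumes "0 \<le> x" "x \<le> (1::real)"
  shows "(1 - x) ^ k \<le> exp (- (real k * x))"
proof -
  have "(1 - x) ^ k \<le> exp (- x) ^ k"
    using assms exp_ge_add_one_self[of "- x"] by (intro power_mono) auto
  then show ?thesis by (simp add: exp_of_nat_mult[symmetric])
qed

lemma of_nat_le_two_power: "real m \<le> 2 ^ m"
  by (rule less_imp_le) simp

text \<open>
  What remains of the location of the root once \<open>m = k + 2\<close> is fixed: \<open>m\<close> exceeds the root by more than
  \<open>1\<close> and at most \<open>2\<close>, and one per cent is lost on either side.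
\<close>

definition window :: "nat \<Rightarrow> nat \<Rightarrow> bool" where
  "window n m \<longleftrightarrow> (99/400) * lsq n \<le> real n / 2 ^ m \<and> real n / 2 ^ m \<le> (101/200) * lsq n"

lemma lsq_eq: "lsq n = log 2 (real n) * ln (real n)"
  by (simp add: lsq_def log_def power2_eq_square)

lemma window_log:
  "\<forall>\<^sub>F n in sequentially. \<forall>m. window n m \<longrightarrow> (99/100) * log 2 (real n) \<le> real m \<and> real m \<le> log 2 (real n)"
proof -
  have "\<forall>\<^sub>F n in sequentially. 1 \<le> (99/400) * lsq n" unfolding lsq_def by real_asymp
  moreover have "\<forall>\<^sub>F n in sequentially. log 2 ((101/200) * lsq n) \<le> (1/100) * log 2 (real n)"
    unfolding lsq_def by real_asymp
  moreover have "\<forall>\<^sub>F n in sequentially. (1::nat) \<le> n" by real_asymp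
  ultimately show ?thesis
  proof (eventually_elim, intro allI impI)
    fix n m :: nat
    assume e: "1 \<le> (99/400) * lsq n" "log 2 ((101/200) * lsq n) \<le> (1/100) * log 2 (real n)" "1 \<le> n"
      and w: "window n m"
    have n: "0 < real n" using e by simp
    have L: "0 < lsq n" using e by simp
    have "1 \<le> real n / 2 ^ m" using w e(1) unfolding window_def by linarith
    then have "log 2 1 \<le> log 2 (real n / 2 ^ m)" using n by (subst log_le_cancel_iff) auto
    then have 1: "real m \<le> log 2 (real n)" using n by (simp add: log_divide log_nat_power)
    have "log 2 (real n / 2 ^ m) \<le> log 2 ((101/200) * lsq n)"
      using w L n by (subst log_le_cancel_iff) (auto simp: window_def)
    then have "log 2 (real n) - real m \<le> (1/100) * log 2 (real n)"
      using n e(2) by (simp add: log_divide log_nat_power)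
    then show "(99/100) * log 2 (real n) \<le> real m \<and> real m \<le> log 2 (real n)" using 1 by simp
  qed
qed

text \<open>
  Here \<open>n / 2 ^ (m - 3) = 8 (n / 2 ^ m)\<close> is nearly \<open>2 L\<close>, whereas there are only about \<open>exp L\<close> sets.
\<close>

lemma gprob_not_ext_prop_window:
  "\<forall>\<^sub>F n in sequentially. \<forall>m. window n m \<and> 3 \<le> m \<longrightarrow>
     gprob n (\<lambda>G. \<not> ext_prop n (m - 3) G) \<le> exp (ln (real n) + 1 - (49/50) * lsq n)"
proof -
  have "\<forall>\<^sub>F n in sequentially. log 2 (real n) \<le> real n" by real_asymp
  moreover have "\<forall>\<^sub>F n in sequentially. (1::nat) \<le> n" by real_asymp
  moreover note window_log
  ultimately show ?thesis
  proof (eventually_elim, intro allI impI, elim conjE)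
    fix n m :: nat
    assume e: "log 2 (real n) \<le> real n" "1 \<le> n"
      "\<forall>m. window n m \<longrightarrow> (99/100) * log 2 (real n) \<le> real m \<and> real m \<le> log 2 (real n)"
      and w: "window n m" and m: "3 \<le> m"
    define r where "r = m - 3"
    have r: "real r \<le> log 2 (real n)" using e(3) w by (force simp: r_def)
    then have rn: "r \<le> n" using e(1) by linarith
    have n: "0 < real n" "0 \<le> ln (real n)" using e(2) by auto
    have "m = r + 3" using m by (simp add: r_def)
    then have "real n / 2 ^ r = 8 * (real n / 2 ^ m)" by (simp add: power_add)
    then have n2r: "(99/50) * lsq n \<le> real n / 2 ^ r" using w unfolding window_def by linarith
    have "real (n - r) * (1 / 2 ^ r) = real n / 2 ^ r - real r / 2 ^ r"
      using rn by (simp add: of_nat_diff diff_divide_distrib)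
    moreover have "real r / 2 ^ r \<le> 1" using of_nat_le_two_power[of r] by simp
    ultimately have a: "(99/50) * lsq n - 1 \<le> real (n - r) * (1 / 2 ^ r)" using n2r by linarith
    have "gprob n (\<lambda>G. \<not> ext_prop n r G) \<le> real (n choose r) * 2 ^ r * (1 - 1 / 2 ^ r) ^ (n - r)"
      by (rule gprob_not_ext_prop[OF rn])
    also have "\<dots> \<le> real n ^ r * 2 ^ r * exp (- (real (n - r) * (1 / 2 ^ r)))"
    proof (intro mult_mono one_minus_power_le_exp)
      show "real (n choose r) \<le> real n ^ r"
        unfolding of_nat_power[symmetric] of_nat_le_iff by (rule binomial_le_pow[OF rn])
    qed auto
    also have "real n ^ r * 2 ^ r = exp (real r * ln (real n) + real r * ln 2)"
      using n by (simp add: exp_add exp_of_nat_mult)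
    also have "\<dots> * exp (- (real (n - r) * (1 / 2 ^ r))) =
      exp (real r * ln (real n) + real r * ln 2 - real (n - r) * (1 / 2 ^ r))"
      by (simp add: exp_add[symmetric] exp_diff exp_minus field_simps)
    also have "\<dots> \<le> exp (ln (real n) + 1 - (49/50) * lsq n)"
    proof -
      have "real r * ln (real n) \<le> lsq n" unfolding lsq_eq by (rule mult_right_mono[OF r n(2)])
      moreover have "real r * ln 2 \<le> ln (real n)"
        using mult_right_mono[OF r, of "ln 2"] by (simp add: log_def)
      ultimately have "real r * ln (real n) + real r * ln 2 - real (n - r) * (1 / 2 ^ r) \<le>
        ln (real n) + 1 - (49/50) * lsq n" using a by linarith
      then show ?thesis by (simp only: exp_le_cancel_iff)
    qed
    finally show "gprob n (\<lambda>G. \<not> ext_prop n (m - 3) G) \<le> exp (ln (real n) + 1 - (49/50) * lsq n)"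
      by (simp only: r_def)
  qed
qed

lemma real_choose_two: "real (m choose 2) = real m * (real m - 1) / 2"
proof (cases "m = 0")
  case False
  have "2 * (m choose 2) = m * (m - 1)"
    using binomial_absorption[of 1 m] by (simp add: numeral_2_eq_2)
  then have "2 * real (m choose 2) = real m * real (m - 1)"
    by (metis of_nat_mult of_nat_numeral)
  then show ?thesis using False by (simp add: of_nat_diff)
qed simp

text \<open>
  The exponent is about \<open>L - L / 2 - 0.54 L\<close>; the middle term comes from prescribing all
  \<open>m choose 2\<close> inner pairs.
\<close>

lemma template_count_window:
  "\<forall>\<^sub>F n in sequentially. \<forall>m J. window n m \<and> J \<le> 3 \<and> (27/50) * lsq n \<le> real J * (real n / 2 ^ m) \<longrightarrow>
     real n ^ m / 2 ^ (m choose 2) * (1 - real J / 2 ^ m) ^ (n - m) \<le>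
       exp (3 + (1/2) * ln (real n) - (3/100) * lsq n)"
proof -
  have "\<forall>\<^sub>F n in sequentially. 10 \<le> log 2 (real n)" by real_asymp
  moreover have "\<forall>\<^sub>F n in sequentially. log 2 (real n) \<le> real n" by real_asymp
  moreover have "\<forall>\<^sub>F n in sequentially. (1::nat) \<le> n" by real_asymp
  moreover note window_log
  ultimately show ?thesis
  proof (eventually_elim, intro allI impI, elim conjE)
    fix n m J :: nat
    assume e: "10 \<le> log 2 (real n)" "log 2 (real n) \<le> real n" "1 \<le> n"
      "\<forall>m. window n m \<longrightarrow> (99/100) * log 2 (real n) \<le> real m \<and> real m \<le> log 2 (real n)"
      and w: "window n m" and J: "J \<le> 3" "(27/50) * lsq n \<le> real J * (real n / 2 ^ m)"
    define M where "M = log 2 (real n)"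
    have m: "(99/100) * M \<le> real m" "real m \<le> M" using e(4) w by (auto simp: M_def)
    have M10: "10 \<le> M" using e by (simp add: M_def)
    have mn: "m \<le> n" using m e by (simp add: M_def)
    have n: "0 < real n" "0 \<le> ln (real n)" using e(3) by auto
    have Mln: "M * ln 2 = ln (real n)" by (simp add: M_def log_def)
    have L: "lsq n = M * ln (real n)" by (simp add: lsq_eq M_def)
    have "m \<ge> 2" using m M10 by linarith
    then have "(2::real) ^ 2 \<le> 2 ^ m" by (intro power_increasing) auto
    then have "(4::real) \<le> 2 ^ m" by simp
    moreover have "real J \<le> 3" using J(1) by simp
    ultimately have "real J \<le> 2 ^ m" by linarith
    then have p: "real J / 2 ^ m \<le> 1" by simp
    have "real J * (real m / 2 ^ m) \<le> 3 * 1"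
      using J(1) of_nat_le_two_power[of m] by (intro mult_mono) auto
    moreover have "real (n - m) * (real J / 2 ^ m) = real J * (real n / 2 ^ m) - real J * (real m / 2 ^ m)"
      using mn by (simp add: of_nat_diff algebra_simps diff_divide_distrib)
    ultimately have a: "(27/50) * lsq n - 3 \<le> real (n - m) * (real J / 2 ^ m)" using J(2) by linarith
    have eq: "real n ^ m / 2 ^ (m choose 2) = exp (real m * ln (real n) - real (m choose 2) * ln 2)"
      using n by (simp add: exp_diff exp_of_nat_mult)
    have "real n ^ m / 2 ^ (m choose 2) * (1 - real J / 2 ^ m) ^ (n - m) \<le>
      real n ^ m / 2 ^ (m choose 2) * exp (- (real (n - m) * (real J / 2 ^ m)))"
      using p by (intro mult_left_mono one_minus_power_le_exp) auto
    also have "\<dots> = exp (real m * ln (real n) - real (m choose 2) * ln 2 - real (n - m) * (real J / 2 ^ m))"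
      unfolding eq exp_add[symmetric] by simp
    also have "\<dots> \<le> exp (3 + (1/2) * ln (real n) - (3/100) * lsq n)"
    proof -
      have "real m * ln (real n) \<le> lsq n" unfolding L by (rule mult_right_mono[OF m(2) n(2)])
      moreover have "(9801/20000) * lsq n - (99/200) * ln (real n) \<le> real (m choose 2) * ln 2"
      proof -
        have "(99/100) * M * ((99/100) * M - 1) \<le> real m * (real m - 1)"
          using m M10 by (intro mult_mono) auto
        then have "(99/100) * M * ((99/100) * M - 1) / 2 * ln 2 \<le> real (m choose 2) * ln 2"
          unfolding real_choose_two by (intro mult_right_mono divide_right_mono) auto
        moreover have "(99/100) * M * ((99/100) * M - 1) / 2 * ln 2 = (9801/20000) * (M * (M * ln 2)) - (99/200) * (M * ln 2)"
          by (simp add: field_simps)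
        ultimately show ?thesis unfolding Mln L by linarith
      qed
      moreover have "0 \<le> lsq n" using M10 n by (simp add: L)
      ultimately have "real m * ln (real n) - real (m choose 2) * ln 2 - real (n - m) * (real J / 2 ^ m) \<le>
        3 + (1/2) * ln (real n) - (3/100) * lsq n" using a n(2) by linarith
      then show ?thesis by (simp only: exp_le_cancel_iff)
    qed
    finally show "real n ^ m / 2 ^ (m choose 2) * (1 - real J / 2 ^ m) ^ (n - m) \<le>
      exp (3 + (1/2) * ln (real n) - (3/100) * lsq n)" .
  qed
qed

text \<open>
  The exponential decay of the correlation in \<open>m - i\<close> is replaced by a bound linear in \<open>i\<close>, which
  turns the sum over overlaps into a geometric series.
\<close>

lemma inverse_two_power_le_linear:
  assumes "1 \<le> i" "i < m"
  shows "1 / 2 ^ (m - i) \<le> real i / (2 * real (m - 1))"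
proof -
  have "2 * (i + s) \<le> i * 2 ^ Suc s" for s
  proof (induction s)
    case (Suc s)
    define X where "X = i * 2 ^ Suc s"
    have "2 \<le> X" using assms(1) mult_le_mono[of 1 i 2 "2 ^ Suc s"] by (simp add: X_def)
    moreover have "2 * (i + s) \<le> X" using Suc.IH by (simp only: X_def)
    ultimately have "2 * (i + Suc s) \<le> X + X" by simp
    moreover have "i * 2 ^ Suc (Suc s) = X + X" by (simp add: X_def)
    ultimately show ?case by simp
  qed simp
  from this[of "m - i - 1"] have "2 * (m - 1) \<le> i * 2 ^ (m - i)" using assms by (simp add: Suc_diff_Suc)
  then have "real (2 * (m - 1)) \<le> real (i * 2 ^ (m - i))" by (simp only: of_nat_le_iff)
  then show ?thesis using assms by (simp add: field_simps)
qed

lemma sum_power_le_geometric: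
  assumes "0 \<le> z" "z < (1::real)"
  shows "(\<Sum>i\<in>{1..<m}. z ^ i) \<le> z / (1 - z)"
proof -
  have "(\<Sum>i\<in>{1..<m}. z ^ i) \<le> (z - z ^ m) / (1 - z)" if "1 \<le> m" using that
  proof (induction m rule: dec_induct)
    case (step k)
    then have "(\<Sum>i\<in>{1..<Suc k}. z ^ i) = (\<Sum>i\<in>{1..<k}. z ^ i) + z ^ k" by simp
    also have "\<dots> \<le> (z - z ^ k) / (1 - z) + z ^ k" using step.IH by simp
    also have "\<dots> = (z - z ^ Suc k) / (1 - z)" using assms by (simp add: field_simps)
    finally show ?case .
  qed simp
  moreover have "(z - z ^ m) / (1 - z) \<le> z / (1 - z)"
    using assms by (intro divide_right_mono) auto
  moreover have "(\<Sum>i\<in>{1..<m}. z ^ i) = 0" if "m < 1" using that by simp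
  ultimately show ?thesis using assms by (cases "1 \<le> m") (auto intro: order_trans)
qed

text \<open>
  The base equals \<open>q\<^sup>2\<close> up to the matching term, which is moved into the exponential.
\<close>

lemma overlap_correction:
  fixes n m J c :: nat and \<delta> t :: real
  defines "q \<equiv> 1 - real J / 2 ^ m"
  assumes m: "2 * m \<le> n" and J: "2 * J < 2 ^ m"
    and \<delta>: "0 < 1 - \<delta>" "1 - \<delta> \<le> q ^ (2 * m)"
    and t: "real c * (real n / 2 ^ m) / (2 * real (m - 1) * (1 - \<delta>)) \<le> t"
    and i: "1 \<le> i" "i < m"
  shows "(1 - 2 * real J / 2 ^ m + real c / 2 ^ (2 * m - i)) ^ (n - (2 * m - i)) \<le>
    q ^ (2 * (n - m)) * (1 / (1 - \<delta>) * exp t ^ i)"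
proof -
  define r where "r = real c / 2 ^ (2 * m - i)"
  define k where "k = n - (2 * m - i)"
  have "real (2 * J) < real (2 ^ m)" using J by (simp only: of_nat_less_iff)
  then have J': "2 * real J < 2 ^ m" by simp
  then have "real J < 2 ^ m" using of_nat_0_le_iff[of J] by linarith
  then have q: "0 < q" "q \<le> 1" by (auto simp: q_def)
  have r: "0 \<le> r" by (simp add: r_def)
  have "q ^ (2 * m) \<le> q ^ 2" using q i by (intro power_decreasing) auto
  then have q2: "1 - \<delta> \<le> q\<^sup>2" using \<delta> by linarith
  have "q\<^sup>2 = 1 - 2 * (real J / 2 ^ m) + (real J / 2 ^ m)\<^sup>2"
    unfolding q_def by (simp add: power2_diff)
  then have "1 - 2 * real J / 2 ^ m + r \<le> q\<^sup>2 + r" by simp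
  also have "q\<^sup>2 + r = q\<^sup>2 * (1 + r / q\<^sup>2)" using q by (simp add: field_simps)
  also have "\<dots> \<le> q\<^sup>2 * exp (r / q\<^sup>2)" by (intro mult_left_mono) auto
  finally have "(1 - 2 * real J / 2 ^ m + r) ^ k \<le> (q\<^sup>2 * exp (r / q\<^sup>2)) ^ k"
    using J' r by (intro power_mono) auto
  also have "\<dots> = q ^ (2 * k) * exp (real k * (r / q\<^sup>2))"
    by (simp only: power_mult_distrib power_mult exp_of_nat_mult)
  also have "\<dots> \<le> (q ^ (2 * (n - m)) * (1 / (1 - \<delta>))) * exp t ^ i"
  proof (rule mult_mono)
    have "q ^ (2 * k) * (1 - \<delta>) \<le> q ^ (2 * k) * q ^ (2 * m)"
      using \<delta> q by (intro mult_left_mono) auto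
    also have "\<dots> = q ^ (2 * k + 2 * m)" by (simp add: power_add)
    also have "\<dots> \<le> q ^ (2 * (n - m))"
      using q m i by (intro power_decreasing) (auto simp: k_def)
    finally show "q ^ (2 * k) \<le> q ^ (2 * (n - m)) * (1 / (1 - \<delta>))"
      using \<delta> by (simp add: field_simps)
    have "real k * (r / q\<^sup>2) \<le> real n * (r / (1 - \<delta>))"
      using \<delta> q2 r q by (intro mult_mono divide_left_mono) (auto simp: k_def)
    also have "\<dots> = real c * (real n / 2 ^ m) / (1 - \<delta>) * (1 / 2 ^ (m - i))"
    proof -
      have "2 * m - i = m + (m - i)" using i by simp
      then show ?thesis by (simp add: r_def power_add mult_ac)
    qed
    also have "\<dots> \<le> real c * (real n / 2 ^ m) / (1 - \<delta>) * (real i / (2 * real (m - 1)))"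
      using \<delta> by (intro mult_left_mono inverse_two_power_le_linear i) auto
    also have "\<dots> = real i * (real c * (real n / 2 ^ m) / (2 * real (m - 1) * (1 - \<delta>)))"
      by (simp add: mult_ac)
    also have "\<dots> \<le> real i * t" using t by (intro mult_left_mono) auto
    finally have "exp (real k * (r / q\<^sup>2)) \<le> exp (real i * t)" by simp
    then show "exp (real k * (r / q\<^sup>2)) \<le> exp t ^ i" by (simp add: exp_of_nat_mult)
  qed (use q \<delta> in auto)
  finally show ?thesis unfolding r_def k_def by (simp only: mult.assoc)
qed

text \<open>
  An upper bound for the ratio of the second moment to the square of the first; the summands
  correspond to those of \<open>overlap_second_moment\<close>.
\<close>

definition second_moment_ratio :: "nat \<Rightarrow> real" where
  "second_moment_ratio n = (let M = log 2 (real n); \<delta> = 303/100 * M * lsq n / real n;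
      z = M\<^sup>2 * exp (7/10 * ln (real n)) / real n in
    M / (27/50 * lsq n - 1) + 1 / (1 - \<delta>) + 1 / (1 - \<delta>) * (z / (1 - z)))"

lemma second_moment_ratio_tendsto: "second_moment_ratio \<longlonglongrightarrow> 1"
  unfolding second_moment_ratio_def Let_def lsq_def by real_asymp

text \<open>
  With three patterns there is ample room: the exponent is about \<open>L - 0.81 L\<close>.
\<close>

lemma expected_three_patterns:
  assumes m: "1 \<le> m" "m \<le> n" "99/100 * log 2 (real n) \<le> real m" "real m \<le> log 2 (real n)" 
    and small: "3 / 2 ^ m \<le> (1/2::real)" and w: "real n / 2 ^ m \<le> 27/100 * lsq n"
    and Mn: "log 2 (real n) \<le> real n"
  shows "exp (99/100 * log 2 (real n) * (ln (real n) - ln (log 2 (real n))) - 81/100 * lsq n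
      - 18 * (27/100 * lsq n)\<^sup>2 / real n) \<le> real (n choose m) * (1 - 3 / 2 ^ m) ^ (n - m)"
proof -
  define M where "M = log 2 (real n)"
  define x where "x = 1 / (2::real) ^ m"
  have x: "0 < x" "3 * x \<le> 1/2" using small by (auto simp: x_def)
  have n: "0 < real n" using m by simp
  have M: "1 \<le> M" using m unfolding M_def by linarith
  have "M \<le> real n" using Mn by (simp only: M_def)
  then have lnM: "ln M \<le> ln (real n)" using M n by (intro ln_mono) auto
  have "exp (99/100 * M * (ln (real n) - ln M)) \<le> exp (real m * (ln (real n) - ln (real m)))"
  proof -
    have "99/100 * M * (ln (real n) - ln M) \<le> real m * (ln (real n) - ln (real m))"
      using m M lnM by (intro mult_mono) (auto simp: M_def intro!: ln_mono)
    then show ?thesis by simp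
  qed
  also have "\<dots> = (real n / real m) ^ m"
    using n m by (simp add: exp_of_nat_mult exp_diff)
  also have "\<dots> \<le> real (n choose m)"
    by (rule binomial_ge_n_over_k_pow_k[OF m(2)])
  finally have a: "exp (99/100 * M * (ln (real n) - ln M)) \<le> real (n choose m)" .
  have "exp (- 81/100 * lsq n - 18 * (27/100 * lsq n)\<^sup>2 / real n) \<le> exp (real n * ln (1 - 3 * x))"
  proof -
    have nx: "real n * x \<le> 27/100 * lsq n" using w by (simp add: x_def)
    have "- (3 * x) - 2 * (3 * x)\<^sup>2 \<le> ln (1 - 3 * x)" by (rule ln_one_minus_ge) (use x in auto)
    then have "real n * (- (3 * x) - 2 * (3 * x)\<^sup>2) \<le> real n * ln (1 - 3 * x)"
      using n by (intro mult_left_mono) auto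
    moreover have "real n * (- (3 * x) - 2 * (3 * x)\<^sup>2) = - 3 * (real n * x) - 18 * ((real n * x)\<^sup>2 / real n)"
      using n by (simp add: field_simps power2_eq_square)
    moreover have "(real n * x)\<^sup>2 / real n \<le> (27/100 * lsq n)\<^sup>2 / real n"
      using nx n x by (intro divide_right_mono power_mono) auto
    ultimately have "- 81/100 * lsq n - 18 * (27/100 * lsq n)\<^sup>2 / real n \<le> real n * ln (1 - 3 * x)"
      using nx by (simp add: field_simps)
    then show ?thesis by simp
  qed
  also have "\<dots> = (1 - 3 * x) ^ n" using x by (simp add: exp_of_nat_mult)
  also have "\<dots> \<le> (1 - 3 * x) ^ (n - m)" using x by (intro power_decreasing) auto
  finally have b: "exp (- 81/100 * lsq n - 18 * (27/100 * lsq n)\<^sup>2 / real n) \<le> (1 - 3 * x) ^ (n - m)" .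
  have "exp (99/100 * M * (ln (real n) - ln M)) * exp (- 81/100 * lsq n - 18 * (27/100 * lsq n)\<^sup>2 / real n)
    \<le> real (n choose m) * (1 - 3 * x) ^ (n - m)"
    by (intro mult_mono a b) auto
  then show ?thesis unfolding exp_add[symmetric] x_def M_def by (simp add: algebra_simps)
qed

text \<open>
  The hypothesis says that unrealised patterns over \<open>(m - 1)\<close>-sets are expected to exist. As
  \<open>2 / 2 ^ m = 1 / 2 ^ (m - 1)\<close>, the two expectations differ only by binomial coefficients, the number
  \<open>2 ^ (m - 1)\<close> of patterns and one factor close to \<open>1\<close>.
\<close>

lemma expected_two_patterns:
  assumes m: "1 \<le> m" "m \<le> n"
    and prev: "1 \<le> real (n choose (m - 1)) * 2 ^ (m - 1) * (1 - 1 / 2 ^ (m - 1)) ^ (n - (m - 1))"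
    and w: "27/100 * lsq n \<le> real n / 2 ^ m" and M: "real m \<le> M" and L: "0 \<le> 27/50 * lsq n - 1"
  shows "(27/50 * lsq n - 1) / M \<le> real (n choose m) * (1 - 2 / 2 ^ m) ^ (n - m)"
proof -
  obtain l where l: "m = Suc l" using m(1) by (cases m) auto
  define y where "y = 1 / (2::real) ^ l"
  have y: "0 < y" "y \<le> 1" by (auto simp: y_def)
  have y2: "2 / 2 ^ m = y" by (simp add: l y_def)
  have nl: "n - l = Suc (n - m)" using m l by simp
  have "m * (n choose m) = (n - l) * (n choose l)"
    unfolding l by (simp only: binomial_absorption binomial_absorb_comp)
  then have "real (m * (n choose m)) = real ((n - l) * (n choose l))" by (rule arg_cong)
  then have rec: "real m * real (n choose m) = real (n - l) * real (n choose l)" by (simp only: of_nat_mult)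
  have "27/50 * lsq n - 1 \<le> real (n - l) * y"
  proof -
    have "real (n - l) * y = real n * y - real l * y" using m l by (simp add: of_nat_diff algebra_simps)
    moreover have "real l * y \<le> 1" using of_nat_le_two_power[of l] by (simp add: y_def)
    moreover have "real n * y = 2 * (real n / 2 ^ m)" by (simp add: y_def l)
    ultimately show ?thesis using w by linarith
  qed
  also have "\<dots> \<le> real (n - l) * (real (n choose l) * (1 - y) ^ (n - l))"
  proof (intro mult_left_mono)
    \<comment> \<open>The factor \<open>2 ^ l\<close> for the choice of the pattern is cancelled here.\<close>
    have "1 * y \<le> (real (n choose l) * 2 ^ l * (1 - y) ^ (n - l)) * y"
      using prev y by (intro mult_right_mono) (auto simp: l y_def)
    then show "y \<le> real (n choose l) * (1 - y) ^ (n - l)" by (simp add: y_def mult_ac)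
  qed auto
  also have "\<dots> \<le> real (n - l) * (real (n choose l) * (1 - y) ^ (n - m))"
    using y by (intro mult_left_mono power_decreasing) (auto simp: nl)
  also have "\<dots> = real m * (real (n choose m) * (1 - y) ^ (n - m))"
    using rec by (simp only: mult.assoc[symmetric])
  also have "\<dots> \<le> M * (real (n choose m) * (1 - y) ^ (n - m))"
    using M y by (intro mult_right_mono) auto
  finally show ?thesis unfolding y2 using m(1) M by (simp add: divide_le_eq mult_ac)
qed

text \<open>
  The number \<open>0.27\<close> separates the two regimes: above it two patterns already cost more than
  \<open>0.54 L\<close>, and below it three patterns cost at most \<open>0.81 L\<close>. In both cases the number \<open>c\<close> of matching
  pairs satisfies \<open>c n / 2 ^ m \<le> 1.35 L\<close>, so that an overlap of size \<open>i\<close> has correlation at most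
  \<open>n powr (0.7 i)\<close>, which is beaten by its probability \<open>(m\<^sup>2/n)\<^sup>i\<close>.
\<close>

lemma ex_omitting_set_window:
  "\<forall>\<^sub>F n in sequentially. \<forall>m. window n m \<and>
     1 \<le> real (n choose (m - 1)) * 2 ^ (m - 1) * (1 - 1 / 2 ^ (m - 1)) ^ (n - (m - 1)) \<longrightarrow>
     (\<exists>J S. J \<le> 3 \<and> 27/50 * lsq n \<le> real J * (real n / 2 ^ m) \<and>
       (\<forall>U. U \<subseteq> {1..n} \<longrightarrow> card U = m \<longrightarrow> S U \<subseteq> Pow U \<and> card (S U) = J) \<and>
       1 \<le> gprob n (\<lambda>G. \<exists>U. U \<subseteq> {1..n} \<and> card U = m \<and> omits n U (S U) G) * second_moment_ratio n)"
proof -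
  define M where "M n = log 2 (real n)" for n :: nat
  define \<delta> where "\<delta> n = 303/100 * M n * lsq n / real n" for n
  define z where "z n = (M n)\<^sup>2 * exp (7/10 * ln (real n)) / real n" for n
  have "\<forall>\<^sub>F n in sequentially. 100 \<le> M n" unfolding M_def by real_asymp
  moreover have "\<forall>\<^sub>F n in sequentially. 2 * M n \<le> real n" unfolding M_def by real_asymp
  moreover have "\<forall>\<^sub>F n in sequentially. \<delta> n \<le> 1/100" unfolding \<delta>_def M_def lsq_def by real_asymp
  moreover have "\<forall>\<^sub>F n in sequentially. z n \<le> 1/2" unfolding z_def M_def by real_asymp
  moreover have "\<forall>\<^sub>F n in sequentially. 1 \<le> 27/50 * lsq n - 1" unfolding lsq_def by real_asymp
  moreover have "\<forall>\<^sub>F n in sequentially. (27/50 * lsq n - 1) / M n \<le>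
      exp (99/100 * M n * (ln (real n) - ln (M n)) - 81/100 * lsq n - 18 * (27/100 * lsq n)\<^sup>2 / real n)"
    unfolding M_def lsq_def by real_asymp
  moreover have "\<forall>\<^sub>F n in sequentially. (1::nat) \<le> n" by real_asymp
  moreover note window_log
  ultimately show ?thesis
  proof (eventually_elim, intro allI impI, elim conjE)
    fix n m :: nat
    assume e: "100 \<le> M n" "2 * M n \<le> real n" "\<delta> n \<le> 1/100" "z n \<le> 1/2" "1 \<le> 27/50 * lsq n - 1"
      "(27/50 * lsq n - 1) / M n \<le>
      exp (99/100 * M n * (ln (real n) - ln (M n)) - 81/100 * lsq n - 18 * (27/100 * lsq n)\<^sup>2 / real n)"
      "1 \<le> n" "\<forall>m. window n m \<longrightarrow> 99/100 * log 2 (real n) \<le> real m \<and> real m \<le> log 2 (real n)"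
      and w: "window n m"
      and prev: "1 \<le> real (n choose (m - 1)) * 2 ^ (m - 1) * (1 - 1 / 2 ^ (m - 1)) ^ (n - (m - 1))"
    have m: "99/100 * M n \<le> real m" "real m \<le> M n" using e(8) w by (auto simp: M_def)
    have n: "0 < real n" "0 \<le> ln (real n)" using e(7) by auto
    have m2: "2 \<le> m" using m e(1) by linarith
    have mn: "2 * m \<le> n" using m e(2) by linarith
    define lam where "lam = real n / 2 ^ m"
    have lam: "99/400 * lsq n \<le> lam" "lam \<le> 101/200 * lsq n"
      using w by (simp_all add: window_def lam_def)
    have L: "0 < lsq n" using e(5) by linarith
    have x: "1 / 2 ^ m = lam / real n" using n by (simp add: lam_def)
    have \<delta>0: "0 \<le> \<delta> n" "\<delta> n < 1" using e(1,3) L n by (auto simp: \<delta>_def)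
    have z0: "0 \<le> z n" by (simp add: z_def)
    have Jx: "real J / 2 ^ m \<le> 303/200 * lsq n / real n" if "J \<le> 3" for J
    proof -
      have "real J * lam \<le> 3 * (101/200 * lsq n)"
        using that lam L by (intro mult_mono) auto
      then have "real J * lam / real n \<le> 3 * (101/200 * lsq n) / real n"
        using n by (intro divide_right_mono) auto
      then show ?thesis using n by (simp add: lam_def)
    qed
    have Jx': "2 * real m * (real J / 2 ^ m) \<le> \<delta> n" if "J \<le> 3" for J
    proof -
      have "2 * real m * (real J / 2 ^ m) \<le> 2 * M n * (303/200 * lsq n / real n)"
        using Jx[OF that] m by (intro mult_mono) auto
      then show ?thesis by (simp add: \<delta>_def)
    qed
    have Jsmall: "real J / 2 ^ m \<le> 1/400" if "J \<le> 3" for J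
    proof -
      have "4 * (real J / 2 ^ m) \<le> 2 * real m * (real J / 2 ^ m)"
        using m2 by (intro mult_right_mono) auto
      then show ?thesis using Jx'[OF that] e(3) by linarith
    qed
    have qm: "1 - \<delta> n \<le> (1 - real J / 2 ^ m) ^ (2 * m)" if "J \<le> 3" for J
    proof -
      have "1 + real (2 * m) * (- (real J / 2 ^ m)) \<le> (1 + - (real J / 2 ^ m)) ^ (2 * m)"
        using Jsmall[OF that] by (intro Bernoulli_inequality) linarith
      then show ?thesis using Jx'[OF that] by simp
    qed
    have concl: "1 \<le> gprob n (\<lambda>G. \<exists>U. U \<subseteq> {1..n} \<and> card U = m \<and> omits n U (S U) G) * second_moment_ratio n"
      if J: "J \<le> 3"
        and S: "\<And>U. U \<subseteq> {1..n} \<Longrightarrow> card U = m \<Longrightarrow> S U \<subseteq> Pow U \<and> card (S U) = J"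
        and c: "\<And>U U'. U \<inter> U' \<noteq> {} \<Longrightarrow> card (matches U (S U) U' (S U')) \<le> c"
        and clam: "real c * lam \<le> 135/100 * lsq n"
        and E: "(27/50 * lsq n - 1) / M n \<le> real (n choose m) * (1 - real J / 2 ^ m) ^ (n - m)"
      for J S c
    proof -
      let ?q = "1 - real J / 2 ^ m"
      let ?b = "exp (7/10 * ln (real n))"
      let ?E = "real (n choose m) * ?q ^ (n - m)"
      have "2 * (real J / 2 ^ m) < 1" using Jsmall[OF J] by linarith
      then have "2 * real J < 2 ^ m" by (simp add: field_simps)
      then have "real (2 * J) < real (2 ^ m)" by simp
      then have J2: "2 * J < 2 ^ m" by (simp only: of_nat_less_iff)
      have t: "real c * (real n / 2 ^ m) / (2 * real (m - 1) * (1 - \<delta> n)) \<le> 7/10 * ln (real n)"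
      proof -
        have m1: "49/50 * M n \<le> real (m - 1)" using m e(1) m2 by (simp add: of_nat_diff)
        have "2 * (49/50 * M n) * (99/100) \<le> 2 * real (m - 1) * (1 - \<delta> n)"
          using m1 e(3) e(1) by (intro mult_mono) auto
        then have "7/10 * ln (real n) * (2 * (49/50 * M n) * (99/100)) \<le>
           7/10 * ln (real n) * (2 * real (m - 1) * (1 - \<delta> n))"
          using n by (intro mult_left_mono) auto
        moreover have "7/10 * ln (real n) * (2 * (49/50 * M n) * (99/100)) = 135828/100000 * lsq n"
          by (simp add: lsq_eq M_def)
        ultimately have "real c * lam \<le> 7/10 * ln (real n) * (2 * real (m - 1) * (1 - \<delta> n))"
          using clam L by linarith
        moreover have pos: "0 < 2 * real (m - 1) * (1 - \<delta> n)" using m2 \<delta>0 by simp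
        ultimately show ?thesis unfolding pos_divide_le_eq[OF pos] by (simp only: lam_def)
      qed
      have \<rho>: "0 \<le> 1 / (1 - \<delta> n) * ?b ^ i \<and>
        (1 - 2 * real J / 2 ^ m + real c / 2 ^ (2 * m - i)) ^ (n - (2 * m - i)) \<le>
          ?q ^ (2 * (n - m)) * (1 / (1 - \<delta> n) * ?b ^ i)" if "1 \<le> i" "i < m" for i
      proof
        show "0 \<le> 1 / (1 - \<delta> n) * ?b ^ i" using \<delta>0 by simp
        show "(1 - 2 * real J / 2 ^ m + real c / 2 ^ (2 * m - i)) ^ (n - (2 * m - i)) \<le>
          ?q ^ (2 * (n - m)) * (1 / (1 - \<delta> n) * ?b ^ i)"
          by (rule overlap_correction[OF mn J2 _ qm[OF J] t that]) (use \<delta>0 in simp)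
      qed
      let ?P = "gprob n (\<lambda>G. \<exists>U. U \<subseteq> {1..n} \<and> card U = m \<and> omits n U (S U) G)"
      have "1 \<le> ?P * (1 / ?E + 1 / ?q ^ (2 * m) +
          (\<Sum>i\<in>{1..<m}. ((real m)\<^sup>2 / real n) ^ i * (1 / (1 - \<delta> n) * ?b ^ i)))"
      proof (rule overlap_second_moment[OF _ mn J2])
        show "1 \<le> m" using m2 by simp
        show "S U \<subseteq> Pow U \<and> card (S U) = J" if "U \<subseteq> {1..n}" "card U = m" for U
          by (rule S[OF that])
        show "card (matches U (S U) U' (S U')) \<le> c" if "U \<inter> U' \<noteq> {}" for U U'
          by (rule c[OF that])
      qed (rule \<rho>)
      also have "\<dots> \<le> ?P * second_moment_ratio n"
      proof (rule mult_left_mono[OF _ gprob_nonneg])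
        have pos: "0 < (27/50 * lsq n - 1) / M n" using e(1,5) by simp
        have "1 / ?E \<le> 1 / ((27/50 * lsq n - 1) / M n)"
          by (rule divide_left_mono[OF E _ mult_pos_pos[OF less_le_trans[OF pos E] pos]]) simp
        then have 1: "1 / ?E \<le> M n / (27/50 * lsq n - 1)" by simp
        have 2: "1 / ?q ^ (2 * m) \<le> 1 / (1 - \<delta> n)"
          using qm[OF J] \<delta>0 by (intro divide_left_mono mult_pos_pos) (auto intro: less_le_trans[OF _ qm[OF J]])
        have "(\<Sum>i\<in>{1..<m}. ((real m)\<^sup>2 / real n) ^ i * (1 / (1 - \<delta> n) * ?b ^ i)) =
          1 / (1 - \<delta> n) * (\<Sum>i\<in>{1..<m}. ((real m)\<^sup>2 / real n * ?b) ^ i)"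
          unfolding sum_distrib_left power_mult_distrib by (simp only: mult_ac)
        also have "\<dots> \<le> 1 / (1 - \<delta> n) * (\<Sum>i\<in>{1..<m}. z n ^ i)"
        proof (intro mult_left_mono sum_mono power_mono)
          have "(real m)\<^sup>2 \<le> (M n)\<^sup>2" using m by (intro power_mono) auto
          then have "(real m)\<^sup>2 * ?b / real n \<le> (M n)\<^sup>2 * ?b / real n"
            using n by (intro divide_right_mono mult_right_mono) auto
          then show "(real m)\<^sup>2 / real n * ?b \<le> z n" by (simp add: z_def)
        qed (use \<delta>0 in auto)
        also have "\<dots> \<le> 1 / (1 - \<delta> n) * (z n / (1 - z n))"
          using \<delta>0 z0 e(4) by (intro mult_left_mono sum_power_le_geometric) auto
        finally have 3: "(\<Sum>i\<in>{1..<m}. ((real m)\<^sup>2 / real n) ^ i * (1 / (1 - \<delta> n) * ?b ^ i)) \<le>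
          1 / (1 - \<delta> n) * (z n / (1 - z n))" .
        have "second_moment_ratio n = M n / (27/50 * lsq n - 1) + 1 / (1 - \<delta> n) + 1 / (1 - \<delta> n) * (z n / (1 - z n))"
          by (simp only: second_moment_ratio_def Let_def M_def \<delta>_def z_def)
        then show "1 / ?E + 1 / ?q ^ (2 * m) +
          (\<Sum>i\<in>{1..<m}. ((real m)\<^sup>2 / real n) ^ i * (1 / (1 - \<delta> n) * ?b ^ i)) \<le> second_moment_ratio n"
          using 1 2 3 by linarith
      qed
      finally show ?thesis .
    qed
    show "\<exists>J S. J \<le> 3 \<and> 27/50 * lsq n \<le> real J * (real n / 2 ^ m) \<and>
       (\<forall>U. U \<subseteq> {1..n} \<longrightarrow> card U = m \<longrightarrow> S U \<subseteq> Pow U \<and> card (S U) = J) \<and>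
       1 \<le> gprob n (\<lambda>G. \<exists>U. U \<subseteq> {1..n} \<and> card U = m \<and> omits n U (S U) G) * second_moment_ratio n"
    proof (cases "27/100 * lsq n \<le> lam")
      case True
      show ?thesis
      proof (intro exI[of _ 2] exI[of _ two_patterns] conjI allI impI)
        show S: "two_patterns U \<subseteq> Pow U" "card (two_patterns U) = 2"
          if "U \<subseteq> {1..n}" "card U = m" for U
          using card_two_patterns[of U] that m2 by auto
        show "27/50 * lsq n \<le> real 2 * (real n / 2 ^ m)" using True unfolding lam_def by linarith
        show "1 \<le> gprob n (\<lambda>G. \<exists>U. U \<subseteq> {1..n} \<and> card U = m \<and> omits n U (two_patterns U) G) * second_moment_ratio n"
        proof (rule concl[of 2 two_patterns 2])
          show "(27/50 * lsq n - 1) / M n \<le> real (n choose m) * (1 - real 2 / 2 ^ m) ^ (n - m)"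
            using expected_two_patterns[OF _ _ prev _ m(2)] m2 mn True e(5) by (simp add: lam_def)
        qed (use S matches_two_patterns lam L in auto)
      qed simp
    next
      case False
      show ?thesis
      proof (intro exI[of _ 3] exI[of _ three_patterns] conjI allI impI)
        show S: "three_patterns U \<subseteq> Pow U" "card (three_patterns U) = 3"
          if "U \<subseteq> {1..n}" "card U = m" for U
          using card_three_patterns[of U] that m2 by auto
        show "27/50 * lsq n \<le> real 3 * (real n / 2 ^ m)" using lam L unfolding lam_def by linarith
        show "1 \<le> gprob n (\<lambda>G. \<exists>U. U \<subseteq> {1..n} \<and> card U = m \<and> omits n U (three_patterns U) G) * second_moment_ratio n"
        proof (rule concl[of 3 three_patterns 5])
          have "exp (99/100 * M n * (ln (real n) - ln (M n)) - 81/100 * lsq n - 18 * (27/100 * lsq n)\<^sup>2 / real n)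
             \<le> real (n choose m) * (1 - 3 / 2 ^ m) ^ (n - m)"
            unfolding M_def
          proof (rule expected_three_patterns)
            show "3 / 2 ^ m \<le> (1/2::real)" using Jsmall[of 3] by simp
            show "real n / 2 ^ m \<le> 27/100 * lsq n" using False by (simp add: lam_def)
            show "log 2 (real n) \<le> real n" using e(1,2) by (simp add: M_def)
          qed (use m m2 mn in \<open>auto simp: M_def\<close>)
          then show "(27/50 * lsq n - 1) / M n \<le> real (n choose m) * (1 - real 3 / 2 ^ m) ^ (n - m)"
            using e(6) by simp
          show "card (matches U (three_patterns U) U' (three_patterns U')) \<le> 5" if "U \<inter> U' \<noteq> {}" for U U'
            unfolding three_patterns_def by (rule card_matches_le_5[OF that])
        qed (use S False in auto)
      qed simp
    qed
  qed
qed

section \<open>Pairs of random graphs and balanced sentences\<close>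

lemma k_hat_facts:
  "\<forall>\<^sub>F n in sequentially. (\<exists>!k. k \<in> {1..real n} \<and> f_ext n k = 0) \<and> 1 \<le> \<lfloor>k_hat n\<rfloor> \<and>
     window n (nat \<lfloor>k_hat n\<rfloor> + 2) \<and>
     1 \<le> real (n choose (nat \<lfloor>k_hat n\<rfloor> + 1)) * 2 ^ (nat \<lfloor>k_hat n\<rfloor> + 1) *
       (1 - 1 / 2 ^ (nat \<lfloor>k_hat n\<rfloor> + 1)) ^ (n - (nat \<lfloor>k_hat n\<rfloor> + 1))"
proof -
  have "\<forall>\<^sub>F n in sequentially. (4::nat) \<le> n" by real_asymp
  then show ?thesis using k_hat_window
  proof eventually_elim
    case (elim n)
    define y where "y = real n / 2 powr k_hat n"
    have wnd: "99/100 * lsq n \<le> y" "y \<le> 101/100 * lsq n"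
      using elim by (simp_all add: y_def)
    define k where "k = nat \<lfloor>k_hat n\<rfloor>"
    have k: "real k \<le> k_hat n" "k_hat n < real k + 1" and k1: "1 \<le> \<lfloor>k_hat n\<rfloor>"
      using elim unfolding k_def by linarith+
    have kn: "k + 1 \<le> n" using k elim by linarith
    have p2: "2 powr (k_hat n + c) = 2 powr k_hat n * 2 powr c" for c by (rule powr_add)
    have up: "2 powr (k_hat n + 1) \<le> (2::real) ^ (k + 2)"
    proof -
      have "2 powr (k_hat n + 1) \<le> (2::real) powr real (k + 2)" using k by (intro powr_mono) auto
      then show ?thesis by (simp only: powr_realpow zero_less_numeral)
    qed
    have lo: "(2::real) ^ (k + 2) \<le> 2 powr (k_hat n + 2)"
    proof -
      have "(2::real) powr real (k + 2) \<le> 2 powr (k_hat n + 2)" using k by (intro powr_mono) auto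
      then show ?thesis by (simp only: powr_realpow zero_less_numeral)
    qed
    have "real n / 2 ^ (k + 2) \<le> real n / 2 powr (k_hat n + 1)"
      by (intro divide_left_mono up) auto
    also have "\<dots> = y / 2" by (simp add: p2 y_def)
    finally have w1: "real n / 2 ^ (k + 2) \<le> 101/200 * lsq n" using wnd by linarith
    have "y / 4 = real n / 2 powr (k_hat n + 2)" by (simp add: p2 powr_numeral y_def)
    also have "\<dots> \<le> real n / 2 ^ (k + 2)"
      by (intro divide_left_mono lo) auto
    finally have w2: "99/400 * lsq n \<le> real n / 2 ^ (k + 2)" using wnd by linarith
    define A where "A = binom_ext n (real (k + 1)) * 2 powr real (k + 1) *
      (1 - 1 / 2 powr real (k + 1)) powr (real n - real (k + 1))"
    have "0 < f_ext n (real (k + 1))" using elim k kn by auto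
    then have "0 < ln A" by (simp only: f_ext_def A_def)
    moreover have "0 \<le> A" unfolding A_def using binom_ext_pos[of "real (k + 1)" n] kn by simp
    ultimately have "1 < A" by (metis less_eq_real_def ln_gt_zero_iff ln_0 less_irrefl)
    moreover have "A = real (n choose (k + 1)) * 2 ^ (k + 1) * (1 - 1 / 2 ^ (k + 1)) ^ (n - (k + 1))"
    proof -
      have "1 < (2::real) ^ (k + 1)" by (rule one_less_power) auto
      then have "1 / (2::real) ^ (k + 1) < 1" by simp
      then have b: "0 < 1 - 1 / (2::real) ^ (k + 1)" by simp
      have "real n - real (k + 1) = real (n - (k + 1))" using kn by (simp add: of_nat_diff)
      then show ?thesis unfolding A_def
        using b by (simp only: powr_realpow zero_less_numeral binom_ext_of_nat[OF kn])
    qed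
    ultimately show ?case using elim k1 w1 w2 by (simp add: k_def[symmetric] window_def)
  qed
qed

lemma definable_sentence:
  "definable n 0 d (\<lambda>G s. P G) \<longleftrightarrow> (\<exists>\<phi>. sentence \<phi> \<and> qdepth \<phi> \<le> d \<and> (\<forall>G. models n G \<phi> \<longleftrightarrow> P G))"
proof
  assume "definable n 0 d (\<lambda>G s. P G)"
  then show "\<exists>\<phi>. sentence \<phi> \<and> qdepth \<phi> \<le> d \<and> (\<forall>G. models n G \<phi> \<longleftrightarrow> P G)"
    unfolding definable_def sentence_def models_def by auto
next
  assume "\<exists>\<phi>. sentence \<phi> \<and> qdepth \<phi> \<le> d \<and> (\<forall>G. models n G \<phi> \<longleftrightarrow> P G)"
  then obtain \<phi> where "sentence \<phi>" "qdepth \<phi> \<le> d" "\<And>G. models n G \<phi> \<longleftrightarrow> P G" by blast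
  then show "definable n 0 d (\<lambda>G s. P G)"
    unfolding definable_def using models_iff_sat[of \<phi> n] by (auto simp: sentence_def intro!: exI[of _ \<phi>])
qed

definition pair_prob :: "nat \<Rightarrow> (nat set set \<Rightarrow> nat set set \<Rightarrow> bool) \<Rightarrow> real" where
  "pair_prob n Q = measure_pmf.prob (random_graph_pair n) {(G, H). Q G H}"

lemma graphs_on_nonempty: "graphs_on n \<noteq> {}"
  by (auto simp: graphs_on_def)

lemma pair_prob_eq:
  "pair_prob n Q = (\<Sum>G\<in>graphs_on n. gprob n (Q G)) / 2 ^ (n choose 2)"
proof -
  let ?\<Omega> = "graphs_on n" and ?N = "(2::real) ^ (n choose 2)"
  have N: "real (card ?\<Omega>) = ?N" by (simp add: card_graphs_on)
  have "pair_prob n Q = measure_pmf.prob (pmf_of_set (?\<Omega> \<times> ?\<Omega>)) {(G, H). Q G H}"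
  proof -
    have "pair_pmf (pmf_of_set ?\<Omega>) (pmf_of_set ?\<Omega>) = pmf_of_set (?\<Omega> \<times> ?\<Omega>)"
      by (rule pmf_eqI) (auto simp: pmf_pair graphs_on_nonempty finite_graphs_on
          card_cartesian_product indicator_def)
    then show ?thesis by (simp add: pair_prob_def random_graph_pair_def)
  qed
  also have "\<dots> = real (card ((?\<Omega> \<times> ?\<Omega>) \<inter> {(G, H). Q G H})) / real (card (?\<Omega> \<times> ?\<Omega>))"
    by (rule measure_pmf_of_set) (auto simp: graphs_on_nonempty finite_graphs_on)
  also have "(?\<Omega> \<times> ?\<Omega>) \<inter> {(G, H). Q G H} = (SIGMA G:?\<Omega>. {H \<in> ?\<Omega>. Q G H})" by auto
  also have "real (card (SIGMA G:?\<Omega>. {H \<in> ?\<Omega>. Q G H})) = (\<Sum>G\<in>?\<Omega>. real (card {H \<in> ?\<Omega>. Q G H}))"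
    by (subst card_SigmaI) (auto simp: finite_graphs_on)
  also have "real (card (?\<Omega> \<times> ?\<Omega>)) = ?N * ?N" by (simp add: card_cartesian_product N)
  finally show ?thesis by (simp add: gprob_def sum_divide_distrib)
qed

lemma gprob_le_1: "gprob n A \<le> 1"
proof -
  have "real (card {G \<in> graphs_on n. A G}) \<le> real (card (graphs_on n))"
    unfolding of_nat_le_iff by (intro card_mono finite_graphs_on) auto
  then show ?thesis by (simp add: gprob_def card_graphs_on)
qed

lemma gprob_True: "gprob n (\<lambda>_. True) = 1"
  by (simp add: gprob_def card_graphs_on)

lemma gprob_not: "gprob n (\<lambda>G. \<not> A G) = 1 - gprob n A"
proof -
  have "{G \<in> graphs_on n. \<not> A G} = graphs_on n - {G \<in> graphs_on n. A G}" by auto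
  then have "card {G \<in> graphs_on n. \<not> A G} = card (graphs_on n) - card {G \<in> graphs_on n. A G}"
    by (simp add: card_Diff_subset finite_graphs_on)
  moreover have "card {G \<in> graphs_on n. A G} \<le> card (graphs_on n)"
    by (intro card_mono finite_graphs_on) auto
  ultimately show ?thesis by (simp add: gprob_def card_graphs_on of_nat_diff diff_divide_distrib)
qed

lemma gprob_disj: "gprob n (\<lambda>G. A G \<or> B G) \<le> gprob n A + gprob n B"
proof -
  have "{G \<in> graphs_on n. A G \<or> B G} = {G \<in> graphs_on n. A G} \<union> {G \<in> graphs_on n. B G}" by auto
  then have "card {G \<in> graphs_on n. A G \<or> B G} \<le> card {G \<in> graphs_on n. A G} + card {G \<in> graphs_on n. B G}"
    by (simp only: card_Un_le)
  then have "real (card {G \<in> graphs_on n. A G \<or> B G}) \<le>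
      real (card {G \<in> graphs_on n. A G}) + real (card {G \<in> graphs_on n. B G})"
    by (simp only: of_nat_add[symmetric] of_nat_le_iff)
  then show ?thesis unfolding gprob_def add_divide_distrib[symmetric] by (rule divide_right_mono) simp
qed

lemma gprob_sum: "(\<Sum>G\<in>graphs_on n. of_bool (A G)) / 2 ^ (n choose 2) = gprob n A"
  by (simp add: gprob_def sum_of_bool_eq finite_graphs_on Int_def conj_commute)

lemma pair_prob_mono:
  "(\<And>G H. G \<in> graphs_on n \<Longrightarrow> H \<in> graphs_on n \<Longrightarrow> Q G H \<Longrightarrow> R G H) \<Longrightarrow> pair_prob n Q \<le> pair_prob n R"
  unfolding pair_prob_eq by (intro divide_right_mono sum_mono gprob_mono) auto

lemma pair_prob_disj: "pair_prob n (\<lambda>G H. Q G H \<or> R G H) \<le> pair_prob n Q + pair_prob n R"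
  unfolding pair_prob_eq add_divide_distrib[symmetric] sum.distrib[symmetric]
  by (intro divide_right_mono sum_mono gprob_disj) auto

lemma pair_prob_indep: "pair_prob n (\<lambda>G H. A G \<and> B H) = gprob n A * gprob n B"
proof -
  have "gprob n (\<lambda>H. A G \<and> B H) = of_bool (A G) * gprob n B" for G
    by (cases "A G") (simp_all add: gprob_def)
  then show ?thesis unfolding pair_prob_eq gprob_sum[of A n, symmetric]
    by (simp add: sum_distrib_right)
qed

lemma pair_prob_not: "pair_prob n (\<lambda>G H. \<not> Q G H) = 1 - pair_prob n Q"
  by (simp add: pair_prob_eq gprob_not sum_subtractf diff_divide_distrib card_graphs_on)

lemma prob_distinguishes_eq:
  "prob_distinguishes n \<phi> = gprob n (\<lambda>G. models n G \<phi>) * (1 - gprob n (\<lambda>G. models n G \<phi>))"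
proof -
  have "prob_distinguishes n \<phi> = pair_prob n (\<lambda>G H. models n G \<phi> \<and> \<not> models n H \<phi>)"
    by (simp add: prob_distinguishes_def pair_prob_def distinguishes_def)
  then show ?thesis by (simp add: pair_prob_indep gprob_not)
qed

definition indistinguishable :: "nat \<Rightarrow> nat \<Rightarrow> nat set set \<Rightarrow> nat set set \<Rightarrow> bool" where
  "indistinguishable n d G H \<longleftrightarrow>
     (\<forall>\<phi>. sentence \<phi> \<longrightarrow> qdepth \<phi> \<le> d \<longrightarrow> (models n G \<phi> \<longleftrightarrow> models n H \<phi>))"

lemma indistinguishable_euclidean:
  "indistinguishable n d G H \<Longrightarrow> indistinguishable n d G K \<Longrightarrow> indistinguishable n d H K"
  unfolding indistinguishable_def by blast

lemma distinguishes_if_not_indistinguishable: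
  assumes "\<not> indistinguishable n d G H"
  obtains \<phi> where "sentence \<phi>" "qdepth \<phi> \<le> d" "distinguishes n G H \<phi>"
proof -
  obtain \<phi> where \<phi>: "sentence \<phi>" "qdepth \<phi> \<le> d" "models n G \<phi> \<longleftrightarrow> \<not> models n H \<phi>"
    using assms unfolding indistinguishable_def by blast
  show thesis
  proof (cases "models n G \<phi>")
    case True
    then show thesis using that[of \<phi>] \<phi> by (simp add: distinguishes_def)
  next
    case False
    have neg: "sentence (Neg \<phi>)" using \<phi>(1) by (simp add: sentence_def)
    have "models n K (Neg \<phi>) \<longleftrightarrow> \<not> models n K \<phi>" for K
      using models_iff_sat[OF neg] models_iff_sat[OF \<phi>(1)] by simp
    then show thesis using that[of "Neg \<phi>"] neg \<phi> False by (simp add: distinguishes_def)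
  qed
qed

text \<open>
  For every first graph that contains an omitting set, one sentence describes a copy of that set; the
  second graph is independent and rarely satisfies it.
\<close>

lemma pair_prob_indistinguishable:
  assumes m: "0 < m"
    and S: "\<And>U. U \<subseteq> {1..n} \<Longrightarrow> card U = m \<Longrightarrow> S U \<subseteq> Pow U \<and> card (S U) = J"
  shows "pair_prob n (indistinguishable n (Suc m)) \<le>
    1 - gprob n (\<lambda>G. \<exists>U. U \<subseteq> {1..n} \<and> card U = m \<and> omits n U (S U) G) +
      real n ^ m / 2 ^ (m choose 2) * (1 - real J / 2 ^ m) ^ (n - m)"
proof -
  let ?A = "\<lambda>G. \<exists>U. U \<subseteq> {1..n} \<and> card U = m \<and> omits n U (S U) G"
  define \<eta> where "\<eta> = real n ^ m / 2 ^ (m choose 2) * (1 - real J / 2 ^ m) ^ (n - m)"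
  have *: "gprob n (\<lambda>H. indistinguishable n (Suc m) G H) \<le> \<eta>" if "?A G" for G
  proof -
    obtain U where U: "U \<subseteq> {1..n}" "card U = m" "omits n U (S U) G" using \<open>?A G\<close> by blast
    obtain T S' f where f: "f \<in> {..<m} \<rightarrow> {1..n}" "realizes n m T S' G f"
      and S': "S' \<subseteq> Pow {..<m}" "card S' = card (S U)"
      by (rule omits_realizes[OF U(1,2) conjunct1[OF S[OF U(1,2)]] U(3)])
    obtain \<phi> where \<phi>: "sentence \<phi>" "qdepth \<phi> \<le> Suc m"
      "\<And>H. models n H \<phi> \<longleftrightarrow> (\<exists>f\<in>{..<m} \<rightarrow> {1..n}. realizes n m T S' H f)"
      using definable_ex_realizes[OF m S'(1), of n T, unfolded definable_sentence] by blast
    have "gprob n (\<lambda>H. indistinguishable n (Suc m) G H) \<le>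
      gprob n (\<lambda>H. \<exists>f\<in>{..<m} \<rightarrow> {1..n}. realizes n m T S' H f)"
    proof (rule gprob_mono)
      fix H assume "indistinguishable n (Suc m) G H"
      then have "models n G \<phi> \<longleftrightarrow> models n H \<phi>" using \<phi>(1,2) by (simp add: indistinguishable_def)
      moreover have "models n G \<phi>" unfolding \<phi>(3) using f by (intro bexI[of _ f])
      ultimately show "\<exists>f\<in>{..<m} \<rightarrow> {1..n}. realizes n m T S' H f" by (simp only: \<phi>(3))
    qed
    also have "\<dots> \<le> \<eta>"
      using gprob_ex_realizes[OF S'(1), of n T] S'(2) S[OF U(1,2)] by (simp add: \<eta>_def)
    finally show ?thesis .
  qed
  have "0 \<le> \<eta>"
  proof (cases "\<exists>U. U \<subseteq> {1..n} \<and> card U = m")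
    case True
    then obtain U where U: "U \<subseteq> {1..n}" "card U = m" by blast
    then have "finite U" using finite_subset[of U "{1..n}"] by simp
    then have "J \<le> 2 ^ m" using S[OF U] card_mono[of "Pow U" "S U"] U by (simp add: card_Pow)
    then have "real J \<le> real (2 ^ m)" by (simp only: of_nat_le_iff)
    then show ?thesis by (simp add: \<eta>_def)
  next
    case False
    have "n < m"
    proof (rule ccontr)
      assume "\<not> n < m"
      then obtain U where "U \<subseteq> {1..n}" "card U = m"
        using obtain_subset_with_card_n[of m "{1..n}"] by auto
      with False show False by blast
    qed
    then show ?thesis by (simp add: \<eta>_def)
  qed
  have "gprob n (indistinguishable n (Suc m) G) \<le> of_bool (\<not> ?A G) + \<eta>" for G
    using *[of G] gprob_le_1[of n "indistinguishable n (Suc m) G"] \<open>0 \<le> \<eta>\<close> by (cases "?A G") auto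
  then have "pair_prob n (indistinguishable n (Suc m)) \<le>
    (\<Sum>G\<in>graphs_on n. of_bool (\<not> ?A G) + \<eta>) / 2 ^ (n choose 2)"
    unfolding pair_prob_eq by (intro divide_right_mono sum_mono) auto
  also have "\<dots> = gprob n (\<lambda>G. \<not> ?A G) + \<eta>"
    unfolding sum.distrib add_divide_distrib gprob_sum by (simp add: card_graphs_on)
  finally show ?thesis by (simp only: gprob_not \<eta>_def)
qed

text \<open>
  Among the sentences of depth at most \<open>d\<close> with probability at most \<open>1/2\<close> choose a most likely one. If its
  probability were too small, then adding one more class of indistinguishable graphs would still
  stay below \<open>1/2\<close> and give a more likely sentence. The square of the probability of a class is at most the
  probability that two graphs are indistinguishable.
\<close>

lemma ex_balanced_sentence:
  assumes d: "0 < d"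
  shows "\<exists>\<phi>. sentence \<phi> \<and> qdepth \<phi> \<le> d \<and>
    \<bar>prob_distinguishes n \<phi> - 1 / 4\<bar> \<le> pair_prob n (indistinguishable n d)"
proof -
  define \<epsilon> where "\<epsilon> = pair_prob n (indistinguishable n d)"
  have class_le: "(gprob n (indistinguishable n d G))\<^sup>2 \<le> \<epsilon>" for G
  proof -
    have "pair_prob n (\<lambda>H K. indistinguishable n d G H \<and> indistinguishable n d G K) \<le> \<epsilon>"
      unfolding \<epsilon>_def by (rule pair_prob_mono) (elim conjE, rule indistinguishable_euclidean)
    then show ?thesis by (simp add: pair_prob_indep power2_eq_square)
  qed
  define p where "p \<phi> = gprob n (\<lambda>G. models n G \<phi>)" for \<phi>
  define V where "V = {p \<phi> |\<phi>. sentence \<phi> \<and> qdepth \<phi> \<le> d \<and> p \<phi> \<le> 1 / 2}"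
  have "V \<subseteq> (\<lambda>X. real (card X) / 2 ^ (n choose 2)) ` Pow (graphs_on n)"
    unfolding V_def p_def gprob_def by auto
  then have finV: "finite V" by (rule finite_subset) (simp add: finite_graphs_on)
  have "definable n 0 d (\<lambda>G s. False)" using definable_not[OF definable_True[of 0 d n]] d by simp
  then obtain \<phi>0 where "sentence \<phi>0" "qdepth \<phi>0 \<le> d" "\<And>G. \<not> models n G \<phi>0"
    unfolding definable_sentence by blast
  moreover from this have "p \<phi>0 = 0" by (simp add: p_def gprob_def)
  ultimately have "p \<phi>0 \<in> V" unfolding V_def by (intro CollectI exI[of _ \<phi>0]) simp
  then have "Max V \<in> V" using finV by (intro Max_in) auto
  then obtain \<phi> where \<phi>: "sentence \<phi>" "qdepth \<phi> \<le> d" "p \<phi> \<le> 1 / 2" "Max V = p \<phi>"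
    unfolding V_def by blast
  have "(1 / 2 - p \<phi>)\<^sup>2 \<le> \<epsilon>"
  proof (rule ccontr)
    assume big: "\<not> (1 / 2 - p \<phi>)\<^sup>2 \<le> \<epsilon>"
    have "\<exists>G\<in>graphs_on n. \<not> models n G \<phi>"
    proof (rule ccontr)
      assume "\<not> (\<exists>G\<in>graphs_on n. \<not> models n G \<phi>)"
      then have "gprob n (\<lambda>_. True) \<le> p \<phi>" unfolding p_def by (intro gprob_mono) auto
      then show False using \<phi>(3) by (simp add: gprob_True)
    qed
    then obtain G where G: "G \<in> graphs_on n" "\<not> models n G \<phi>" by blast
    define I where "I = {H \<in> graphs_on n. \<not> indistinguishable n d G H}"
    have "\<exists>\<psi>. sentence \<psi> \<and> qdepth \<psi> \<le> d \<and> distinguishes n G H \<psi>" if "H \<in> I" for H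
    proof -
      have "\<not> indistinguishable n d G H" using that by (simp add: I_def)
      then obtain \<psi> where "sentence \<psi>" "qdepth \<psi> \<le> d" "distinguishes n G H \<psi>"
        by (rule distinguishes_if_not_indistinguishable)
      then show ?thesis by blast
    qed
    then have "\<forall>H\<in>I. \<exists>\<psi>. sentence \<psi> \<and> qdepth \<psi> \<le> d \<and> distinguishes n G H \<psi>" by (intro ballI)
    from bchoice[OF this] obtain \<psi> where
      "\<forall>H\<in>I. sentence (\<psi> H) \<and> qdepth (\<psi> H) \<le> d \<and> distinguishes n G H (\<psi> H)"
      by (elim exE)
    note \<psi> = bspec[OF this]
    have "definable n 0 d (\<lambda>K s. \<forall>H\<in>I. models n K (\<psi> H))"
    proof (rule definable_ball)
      show "definable n 0 d (\<lambda>K s. models n K (\<psi> H))" if "H \<in> I" for H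
        unfolding definable_sentence using \<psi>[OF that] by blast
    qed (use d in \<open>auto simp: I_def finite_graphs_on\<close>)
    moreover have "definable n 0 d (\<lambda>K s. models n K \<phi>)"
      unfolding definable_sentence using \<phi> by blast
    ultimately have "definable n 0 d (\<lambda>K s. \<not> (\<not> models n K \<phi> \<and> \<not> (\<forall>H\<in>I. models n K (\<psi> H))))"
      by (intro definable_not definable_conj)
    then obtain \<theta> where \<theta>: "sentence \<theta>" "qdepth \<theta> \<le> d"
      "\<And>K. models n K \<theta> \<longleftrightarrow> models n K \<phi> \<or> (\<forall>H\<in>I. models n K (\<psi> H))"
      unfolding definable_sentence by auto
    have cls: "indistinguishable n d G K" if "K \<in> graphs_on n" "\<forall>H\<in>I. models n K (\<psi> H)" for K
    proof (rule ccontr)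
      assume "\<not> indistinguishable n d G K"
      then have "K \<in> I" using that(1) by (simp add: I_def)
      then show False using that(2) \<psi>[of K] by (simp add: distinguishes_def)
    qed
    have "p \<theta> \<le> gprob n (\<lambda>K. models n K \<phi> \<or> indistinguishable n d G K)"
      unfolding p_def by (rule gprob_mono) (use \<theta>(3) cls in blast)
    also have "\<dots> \<le> p \<phi> + gprob n (indistinguishable n d G)"
      unfolding p_def by (rule gprob_disj)
    also have "gprob n (indistinguishable n d G) \<le> 1 / 2 - p \<phi>"
    proof (rule power2_le_imp_le)
      show "(gprob n (indistinguishable n d G))\<^sup>2 \<le> (1 / 2 - p \<phi>)\<^sup>2"
        using class_le[of G] big by linarith
    qed (use \<phi>(3) in simp)
    finally have "p \<theta> \<le> 1 / 2" by simp
    \<comment> \<open>Maximality of \<open>\<phi>\<close> is contradicted by \<open>\<theta>\<close>, which also holds in \<open>G\<close>.\<close>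
    then have "p \<theta> \<in> V" using \<theta> unfolding V_def by blast
    then have "p \<theta> \<le> Max V" by (rule Max_ge[OF finV])
    then have "p \<theta> \<le> p \<phi>" by (simp only: \<phi>(4))
    moreover have "p \<phi> < p \<theta>"
    proof -
      have "models n G (\<psi> H)" if "H \<in> I" for H using \<psi>[OF that] by (simp add: distinguishes_def)
      then have "models n G \<theta>" unfolding \<theta>(3) by (intro disjI2 ballI)
      then have "{K \<in> graphs_on n. models n K \<phi>} \<subset> {K \<in> graphs_on n. models n K \<theta>}"
        using G by (auto simp: \<theta>(3))
      then have "card {K \<in> graphs_on n. models n K \<phi>} < card {K \<in> graphs_on n. models n K \<theta>}"
        by (intro psubset_card_mono) (simp_all add: finite_graphs_on)
      then show ?thesis unfolding p_def gprob_def by (intro divide_strict_right_mono) simp_all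
    qed
    ultimately show False by simp
  qed
  moreover have "prob_distinguishes n \<phi> - 1 / 4 = - (1 / 2 - p \<phi>)\<^sup>2"
    unfolding prob_distinguishes_eq p_def by (simp add: power2_eq_square algebra_simps)
  ultimately have "\<bar>prob_distinguishes n \<phi> - 1 / 4\<bar> \<le> \<epsilon>" by simp
  then show ?thesis using \<phi> by (auto simp: \<epsilon>_def)
qed

section \<open>The distinguishing depth\<close>

lemma indistinguishable_rare:
  "\<forall>\<^sub>F n in sequentially. pair_prob n (indistinguishable n (nat \<lfloor>k_hat n\<rfloor> + 3)) \<le>
     1 - 1 / second_moment_ratio n + exp (3 + 1/2 * ln (real n) - 3/100 * lsq n)"
proof -
  have "\<forall>\<^sub>F n in sequentially. 1/2 < second_moment_ratio n"
    by (rule order_tendstoD(1)[OF second_moment_ratio_tendsto]) simp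
  then show ?thesis using k_hat_facts ex_omitting_set_window template_count_window
  proof eventually_elim
    case (elim n)
    define m where "m = nat \<lfloor>k_hat n\<rfloor> + 2"
    have m1: "m - 1 = nat \<lfloor>k_hat n\<rfloor> + 1" by (simp add: m_def)
    have w: "window n m" using elim(2) by (simp only: m_def)
    have "1 \<le> real (n choose (m - 1)) * 2 ^ (m - 1) * (1 - 1 / 2 ^ (m - 1)) ^ (n - (m - 1))"
      unfolding m1 using elim(2) by (elim conjE)
    then obtain J S where JS: "J \<le> 3" "27/50 * lsq n \<le> real J * (real n / 2 ^ m)"
       "\<forall>U. U \<subseteq> {1..n} \<longrightarrow> card U = m \<longrightarrow> S U \<subseteq> Pow U \<and> card (S U) = J"
       "1 \<le> gprob n (\<lambda>G. \<exists>U. U \<subseteq> {1..n} \<and> card U = m \<and> omits n U (S U) G) * second_moment_ratio n"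
      using elim(3) w by (elim allE[of _ m]) blast
    have "pair_prob n (indistinguishable n (Suc m)) \<le>
      1 - gprob n (\<lambda>G. \<exists>U. U \<subseteq> {1..n} \<and> card U = m \<and> omits n U (S U) G) +
      real n ^ m / 2 ^ (m choose 2) * (1 - real J / 2 ^ m) ^ (n - m)"
      by (rule pair_prob_indistinguishable) (use JS(3) in \<open>simp_all add: m_def\<close>)
    moreover have "real n ^ m / 2 ^ (m choose 2) * (1 - real J / 2 ^ m) ^ (n - m) \<le>
       exp (3 + 1/2 * ln (real n) - 3/100 * lsq n)"
      using elim(4) w JS(1,2) by blast
    moreover have "1 / second_moment_ratio n \<le>
        gprob n (\<lambda>G. \<exists>U. U \<subseteq> {1..n} \<and> card U = m \<and> omits n U (S U) G)"
      using JS(4) elim(1) by (simp add: divide_le_eq)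
    moreover have "Suc m = nat \<lfloor>k_hat n\<rfloor> + 3" by (simp add: m_def)
    ultimately show ?case by simp
  qed
qed

lemma indistinguishable_rare_tendsto:
  "(\<lambda>n. 1 - 1 / second_moment_ratio n + exp (3 + 1/2 * ln (real n) - 3/100 * lsq n)) \<longlonglongrightarrow> 0"
proof -
  have "(\<lambda>n. exp (3 + 1/2 * ln (real n) - 3/100 * lsq n)) \<longlonglongrightarrow> 0"
    unfolding lsq_def by real_asymp
  then have "(\<lambda>n. 1 - 1 / second_moment_ratio n + exp (3 + 1/2 * ln (real n) - 3/100 * lsq n)) \<longlonglongrightarrow> 1 - 1 / 1 + 0"
    by (intro tendsto_intros second_moment_ratio_tendsto) simp_all
  then show ?thesis by simp
qed

lemma ext_prop_typical:
  "\<forall>\<^sub>F n in sequentially. gprob n (\<lambda>G. \<not> ext_prop n (nat \<lfloor>k_hat n\<rfloor> - 1) G) \<le>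
     exp (ln (real n) + 1 - 49/50 * lsq n)"
  using k_hat_facts gprob_not_ext_prop_window
proof eventually_elim
  case (elim n)
  have "1 \<le> \<lfloor>k_hat n\<rfloor>" using elim(1) by (elim conjE)
  then have "3 \<le> nat \<lfloor>k_hat n\<rfloor> + 2" by linarith
  moreover have "nat \<lfloor>k_hat n\<rfloor> + 2 - 3 = nat \<lfloor>k_hat n\<rfloor> - 1" by simp
  moreover have "window n (nat \<lfloor>k_hat n\<rfloor> + 2)" using elim(1) by (elim conjE)
  ultimately show ?case using elim(2)[rule_format, of "nat \<lfloor>k_hat n\<rfloor> + 2"] by simp
qed

lemma ext_prop_typical_tendsto: "(\<lambda>n. exp (ln (real n) + 1 - 49/50 * lsq n)) \<longlonglongrightarrow> 0"
  unfolding lsq_def by real_asymp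

lemma pair_prob_not_both_ext_prop:
  "pair_prob n (\<lambda>G H. \<not> ext_prop n r G \<or> \<not> ext_prop n r H) \<le> 2 * gprob n (\<lambda>G. \<not> ext_prop n r G)"
proof -
  have "pair_prob n (\<lambda>G H. \<not> ext_prop n r G) = gprob n (\<lambda>G. \<not> ext_prop n r G)"
    using pair_prob_indep[of n "\<lambda>G. \<not> ext_prop n r G" "\<lambda>_. True"] by (simp add: gprob_True)
  moreover have "pair_prob n (\<lambda>G H. \<not> ext_prop n r H) = gprob n (\<lambda>G. \<not> ext_prop n r G)"
    using pair_prob_indep[of n "\<lambda>_. True" "\<lambda>G. \<not> ext_prop n r G"] by (simp add: gprob_True)
  ultimately show ?thesis
    using pair_prob_disj[of n "\<lambda>G H. \<not> ext_prop n r G" "\<lambda>G H. \<not> ext_prop n r H"] by simp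
qed

lemma depth_gt_of_distinguishes:
  assumes "G \<in> graphs_on n" "H \<in> graphs_on n" "ext_prop n r G" "ext_prop n r H"
    and "sentence \<phi>" "distinguishes n G H \<phi>"
  shows "Suc r < qdepth \<phi>"
proof (rule ccontr)
  assume "\<not> Suc r < qdepth \<phi>"
  then have "models n G \<phi> \<longleftrightarrow> models n H \<phi>"
    using models_eq_of_ext_prop[OF assms(1-5)] by simp
  then show False using assms(6) by (simp add: distinguishes_def)
qed

theorem mainTheorem2:
  "(\<forall>\<^sub>F n in sequentially. \<exists>!k. k \<in> {1..real n} \<and> f_ext n k = 0) \<and>
   (\<exists>\<phi> :: nat \<Rightarrow> fo_formula.
      (\<forall>n. sentence (\<phi> n)) \<and>
      (\<forall>\<^sub>F n in sequentially. int (qdepth (\<phi> n)) \<le> \<lfloor>k_hat n\<rfloor> + 4) \<and>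
      (\<lambda>n. prob_distinguishes n (\<phi> n)) \<longlonglongrightarrow> 1 / 4) \<and>
   \<not> (\<exists>(N :: nat set) (\<phi> :: nat \<Rightarrow> fo_formula).
      infinite N \<and>
      (\<forall>n\<in>N. sentence (\<phi> n) \<and> int (qdepth (\<phi> n)) \<le> \<lfloor>k_hat n\<rfloor>) \<and>
      ((\<lambda>n. prob_distinguishes n (\<phi> n)) \<longlongrightarrow> 1 / 4) (inf sequentially (principal N))) \<and>
   (\<lambda>n. measure_pmf.prob (random_graph_pair n)
      {(G, H). distinguishing_depths n G H \<noteq> {} \<and>
         int (LEAST d. d \<in> distinguishing_depths n G H)
           \<in> {\<lfloor>k_hat n\<rfloor> + 1, \<lfloor>k_hat n\<rfloor> + 2, \<lfloor>k_hat n\<rfloor> + 3}}) \<longlonglongrightarrow> 1"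
proof -
  define k where "k n = nat \<lfloor>k_hat n\<rfloor>" for n
  define \<eta> where "\<eta> n = 1 - 1 / second_moment_ratio n + exp (3 + 1/2 * ln (real n) - 3/100 * lsq n)" for n
  define \<epsilon> where "\<epsilon> n = exp (ln (real n) + 1 - 49/50 * lsq n)" for n
  have \<eta>: "\<eta> \<longlonglongrightarrow> 0" unfolding \<eta>_def by (rule indistinguishable_rare_tendsto)
  have \<epsilon>: "\<epsilon> \<longlonglongrightarrow> 0" unfolding \<epsilon>_def by (rule ext_prop_typical_tendsto)
  have k: "\<forall>\<^sub>F n in sequentially. \<lfloor>k_hat n\<rfloor> = int (k n) \<and> 1 \<le> k n"
    using k_hat_facts
  proof eventually_elim
    case (elim n)
    then have "1 \<le> \<lfloor>k_hat n\<rfloor>" by (elim conjE)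
    then show ?case unfolding k_def by linarith
  qed
  have upper: "\<forall>\<^sub>F n in sequentially. pair_prob n (indistinguishable n (k n + 3)) \<le> \<eta> n"
    using indistinguishable_rare by (simp only: k_def \<eta>_def)
  have lower: "\<forall>\<^sub>F n in sequentially.
      pair_prob n (\<lambda>G H. \<not> ext_prop n (k n - 1) G \<or> \<not> ext_prop n (k n - 1) H) \<le> 2 * \<epsilon> n"
    using ext_prop_typical
  proof eventually_elim
    case (elim n)
    then show ?case
      using pair_prob_not_both_ext_prop[of n "k n - 1"] unfolding k_def \<epsilon>_def by linarith
  qed
  have "\<exists>\<phi> :: nat \<Rightarrow> fo_formula. (\<forall>n. sentence (\<phi> n)) \<and>
      (\<forall>\<^sub>F n in sequentially. int (qdepth (\<phi> n)) \<le> \<lfloor>k_hat n\<rfloor> + 4) \<and>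
      (\<lambda>n. prob_distinguishes n (\<phi> n)) \<longlonglongrightarrow> 1 / 4"
  proof -
    have "\<forall>n. \<exists>\<phi>. sentence \<phi> \<and> qdepth \<phi> \<le> k n + 3 \<and>
      \<bar>prob_distinguishes n \<phi> - 1 / 4\<bar> \<le> pair_prob n (indistinguishable n (k n + 3))"
      using ex_balanced_sentence by simp
    from choice[OF this] obtain \<phi> where
      \<phi>: "\<forall>n. sentence (\<phi> n) \<and> qdepth (\<phi> n) \<le> k n + 3 \<and>
        \<bar>prob_distinguishes n (\<phi> n) - 1 / 4\<bar> \<le> pair_prob n (indistinguishable n (k n + 3))"
      by (elim exE)
    have "\<forall>\<^sub>F n in sequentially. int (qdepth (\<phi> n)) \<le> \<lfloor>k_hat n\<rfloor> + 4"
      using k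
    proof eventually_elim
      case (elim n)
      have "qdepth (\<phi> n) \<le> k n + 3" using \<phi> by blast
      then show ?case using elim by linarith
    qed
    moreover have "(\<lambda>n. prob_distinguishes n (\<phi> n) - 1 / 4) \<longlonglongrightarrow> 0"
    proof (rule Lim_null_comparison[OF _ \<eta>])
      show "\<forall>\<^sub>F n in sequentially. norm (prob_distinguishes n (\<phi> n) - 1 / 4) \<le> \<eta> n"
        using upper
      proof eventually_elim
        case (elim n)
        have "\<bar>prob_distinguishes n (\<phi> n) - 1 / 4\<bar> \<le> pair_prob n (indistinguishable n (k n + 3))"
          using \<phi> by blast
        then show ?case using elim by simp
      qed
    qed
    then have "(\<lambda>n. prob_distinguishes n (\<phi> n)) \<longlonglongrightarrow> 1 / 4" by (rule LIM_zero_cancel)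
    moreover have "\<forall>n. sentence (\<phi> n)" using \<phi> by blast
    ultimately show ?thesis by (intro exI[of _ \<phi>] conjI)
  qed
  moreover have "\<not> (\<exists>(N :: nat set) (\<phi> :: nat \<Rightarrow> fo_formula).
      infinite N \<and>
      (\<forall>n\<in>N. sentence (\<phi> n) \<and> int (qdepth (\<phi> n)) \<le> \<lfloor>k_hat n\<rfloor>) \<and>
      ((\<lambda>n. prob_distinguishes n (\<phi> n)) \<longlongrightarrow> 1 / 4) (inf sequentially (principal N)))"
  proof (intro notI, elim exE conjE)
    fix N :: "nat set" and \<phi> :: "nat \<Rightarrow> fo_formula"
    assume N: "infinite N"
      and \<phi>: "\<forall>n\<in>N. sentence (\<phi> n) \<and> int (qdepth (\<phi> n)) \<le> \<lfloor>k_hat n\<rfloor>"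
      and lim: "((\<lambda>n. prob_distinguishes n (\<phi> n)) \<longlongrightarrow> 1 / 4) (inf sequentially (principal N))"
    have "\<forall>\<^sub>F n in inf sequentially (principal N). 1 / 8 < prob_distinguishes n (\<phi> n)"
      by (rule order_tendstoD(1)[OF lim]) simp
    then have "\<forall>\<^sub>F n in sequentially. n \<in> N \<longrightarrow> 1 / 8 < prob_distinguishes n (\<phi> n)"
      by (simp add: eventually_inf_principal)
    moreover have "\<forall>\<^sub>F n in sequentially. \<epsilon> n < 1 / 16"
      by (rule order_tendstoD(2)[OF \<epsilon>]) simp
    ultimately have "\<forall>\<^sub>F n in sequentially. n \<notin> N" using k lower
    proof eventually_elim
      case (elim n)
      show ?case
      proof
        assume n: "n \<in> N"
        have s: "sentence (\<phi> n)" "qdepth (\<phi> n) \<le> k n" using \<phi> n elim(3) by auto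
        have "prob_distinguishes n (\<phi> n) = pair_prob n (\<lambda>G H. distinguishes n G H (\<phi> n))"
          by (simp add: prob_distinguishes_def pair_prob_def)
        also have "\<dots> \<le> pair_prob n (\<lambda>G H. \<not> ext_prop n (k n - 1) G \<or> \<not> ext_prop n (k n - 1) H)"
        proof (rule pair_prob_mono)
          fix G H assume "G \<in> graphs_on n" "H \<in> graphs_on n" "distinguishes n G H (\<phi> n)"
          then show "\<not> ext_prop n (k n - 1) G \<or> \<not> ext_prop n (k n - 1) H"
            using depth_gt_of_distinguishes[of G n H "k n - 1" "\<phi> n"] s elim(3) by linarith
        qed
        finally show False using elim n by simp
      qed
    qed
    then obtain n0 where n0: "\<And>n. n0 \<le> n \<Longrightarrow> n \<notin> N" unfolding eventually_sequentially by blast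
    have "N \<subseteq> {..<n0}"
    proof
      fix n assume "n \<in> N"
      then have "\<not> n0 \<le> n" using n0 by blast
      then show "n \<in> {..<n0}" by simp
    qed
    then show False using N finite_subset[of N "{..<n0}"] by simp
  qed
  moreover have "(\<lambda>n. measure_pmf.prob (random_graph_pair n)
      {(G, H). distinguishing_depths n G H \<noteq> {} \<and>
         int (LEAST d. d \<in> distinguishing_depths n G H)
           \<in> {\<lfloor>k_hat n\<rfloor> + 1, \<lfloor>k_hat n\<rfloor> + 2, \<lfloor>k_hat n\<rfloor> + 3}}) \<longlonglongrightarrow> 1"
  proof -
    define Q where "Q n G H \<longleftrightarrow> distinguishing_depths n G H \<noteq> {} \<and>
         int (LEAST d. d \<in> distinguishing_depths n G H)
           \<in> {\<lfloor>k_hat n\<rfloor> + 1, \<lfloor>k_hat n\<rfloor> + 2, \<lfloor>k_hat n\<rfloor> + 3}" for n G H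
    have "\<forall>\<^sub>F n in sequentially. norm (pair_prob n (Q n) - 1) \<le> 2 * \<epsilon> n + \<eta> n"
      using k upper lower
    proof eventually_elim
      case (elim n)
      have "pair_prob n (\<lambda>G H. \<not> Q n G H) \<le> pair_prob n (\<lambda>G H.
        (\<not> ext_prop n (k n - 1) G \<or> \<not> ext_prop n (k n - 1) H) \<or> indistinguishable n (k n + 3) G H)"
      proof (rule pair_prob_mono, rule ccontr)
        fix G H assume GH: "G \<in> graphs_on n" "H \<in> graphs_on n" "\<not> Q n G H"
          and "\<not> ((\<not> ext_prop n (k n - 1) G \<or> \<not> ext_prop n (k n - 1) H) \<or>
            indistinguishable n (k n + 3) G H)"
        then have ext: "ext_prop n (k n - 1) G" "ext_prop n (k n - 1) H"
          and dist: "\<not> indistinguishable n (k n + 3) G H" by simp_all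
        let ?D = "distinguishing_depths n G H"
        obtain \<phi> where \<phi>: "sentence \<phi>" "qdepth \<phi> \<le> k n + 3" "distinguishes n G H \<phi>"
          by (rule distinguishes_if_not_indistinguishable[OF dist])
        then have mem: "qdepth \<phi> \<in> ?D" by (auto simp: distinguishing_depths_def)
        have gt: "k n < d" if d: "d \<in> ?D" for d
        proof -
          obtain \<psi> where "sentence \<psi>" "distinguishes n G H \<psi>" "d = qdepth \<psi>"
            using d by (auto simp: distinguishing_depths_def)
          then show ?thesis using depth_gt_of_distinguishes[OF GH(1,2) ext, of \<psi>] elim(1) by simp
        qed
        have "(LEAST d. d \<in> ?D) \<le> k n + 3" using Least_le[of "\<lambda>d. d \<in> ?D", OF mem] \<phi>(2) by simp
        moreover have "k n < (LEAST d. d \<in> ?D)" by (rule gt) (rule LeastI[of "\<lambda>d. d \<in> ?D", OF mem])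
        moreover have "?D \<noteq> {}" using mem by blast
        moreover have "\<lfloor>k_hat n\<rfloor> = int (k n)" using elim(1) by simp
        ultimately have "Q n G H" unfolding Q_def by auto
        then show False using GH(3) by simp
      qed
      also have "\<dots> \<le> 2 * \<epsilon> n + \<eta> n"
        using pair_prob_disj[of n "\<lambda>G H. \<not> ext_prop n (k n - 1) G \<or> \<not> ext_prop n (k n - 1) H"
            "indistinguishable n (k n + 3)"] elim by linarith
      finally have "1 - pair_prob n (Q n) \<le> 2 * \<epsilon> n + \<eta> n" by (simp only: pair_prob_not)
      moreover have "pair_prob n (Q n) \<le> 1" by (simp add: pair_prob_def)
      ultimately show ?case by simp
    qed
    moreover have "(\<lambda>n. 2 * \<epsilon> n + \<eta> n) \<longlonglongrightarrow> 0"
      using tendsto_add[OF tendsto_mult_left[OF \<epsilon>, of 2] \<eta>] by simp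
    ultimately have "(\<lambda>n. pair_prob n (Q n) - 1) \<longlonglongrightarrow> 0" by (rule Lim_null_comparison)
    then have "(\<lambda>n. pair_prob n (Q n)) \<longlonglongrightarrow> 1" by (rule LIM_zero_cancel)
    then show ?thesis unfolding pair_prob_def Q_def .
  qed
  moreover have "\<forall>\<^sub>F n in sequentially. \<exists>!k. k \<in> {1..real n} \<and> f_ext n k = 0"
    using k_hat_facts by eventually_elim (elim conjE)
  ultimately show ?thesis by (intro conjI)
qed

end
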